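(* Let $n,d\ge1$ be integers and $s$ an integer with $2<s\le\sqrt{(n/2)\log2}$, and let $m=s-1$. Let $f_0:\mathbb R\to\mathbb R$, $f(\theta)=\frac1d\sum_{a=1}^df_0(\theta_a)$ for $\theta=(\theta_1,\dots,\theta_d)^\top\in\mathbb R^d$, let $f_h=K_h*f_0$ be the kernel smoothing of $f_0$ with bandwidth $h>0$, and let $\widehat f$ be the estimator defined in the context from independent observations $x_1,\dots,x_n\in\mathbb R^d$ with $\mathbb E[x_j]=\theta$. Suppose the noise $\varepsilon_{j,a}=x_{j,a}-\theta_a$ satisfies $$\mathbb E[\varepsilon_{j,a}\varepsilon_{j,b}]=0,\quad 1\le j\le n,\ 1\le a<b\le d,$$ $$\mathbb E\Big[\big|n^{-1}\textstyle\sum_{j=1}^n\varepsilon_j'\varepsilon_{j,a}\big|^{2k}\Big]\le\sigma_n^{2k}2^{k-1}k!,\quad1\le a\le d,\ 1\le k\le s,$$ where $\sigma_n>0$ and $(\varepsilon_j')_{j\le n}$ is a Rademacher sequence independent of the noise. Then $$\|\widehat f-f(\theta)\|_{L_2(\mathbb P)}\le\big\{\mathrm{bias}_{h,d}^2(\theta)+\kappa_{s,h,n,d}(\theta)\big\}^{1/2}+\|f_h\|_{(s)}\,(2^{7/2}\sigma_n)^s/\sqrt{s!}.$$ If in addition, for certain $\alpha>0$ and $\eta_\alpha(h)>0$, $$\|f_0^{(k)}-f_h^{(k)}\|_{L_\infty}\le\eta_\alpha(h)/h^k\ \ (k\text{ integer},\ 0\le k<\alpha),\qquad\|f_h^{(k)}\|_{L_\infty}\le\eta_\alpha(h)/h^k\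 \ (k\text{ integer},\ \alpha\le k\le s),$$ and $(\sigma_n/h)^2\le s/(2^7e)$, then $$\|\widehat f-f(\theta)\|_{L_2(\mathbb P)}\le|\mathrm{bias}_{h,d}(\theta)|+\eta_\alpha(h)\big(s^{-1/4}+\sqrt{2/d}\,e^{(\sigma_n/h)^2/2}\big)+\kappa_{\alpha,0,n,d}^{1/2}(\theta)$$ $$\le\eta_\alpha(h)\big(1+s^{-1/4}+\sqrt{2/d}\,e^{(\sigma_n/h)^2/2}\big)+\kappa_{\alpha,0,n,d}^{1/2}(\theta).$$
   Context: Kernel smoothing: $f_h(x)=(K_h*f_0)(x)=\int K_h(x-t)f_0(t)\,dt$ with $K_h(x)=h^{-1}K(x/h)$ for a kernel $K$ such that $f_h$ is well defined and has the derivatives appearing in the statement. The notation $f_h$ with $h=0$ refers to the given function $f_0$, whose derivatives $f_0^{(k)}$, $k<\alpha$, are those used in the second part. Estimator: $$\widehat f=\frac1d\sum_{a=1}^d\Big\{f_h(\bar x_a)+\sum_{k=2}^m\frac{f_h^{(k)}(\bar x_a)\,\bar u_a^{(k)}}{k!}\Big\},$$ where $\bar x_a=n^{-1}\sum_{j=1}^nx_{j,a}$ and $\bar u_a^{(k)}=\frac{(n-k)!}{n!}\sum_{1\le j_1\neq\cdots\neq j_k\le n}\prod_{\ell=1}^k(x_{j_\ell,a}-\bar x_a)$ (indices pairwise distinct). $\|f_h\|_{(s)}=\sup_{x\ne y}|f_h^{(s-1)}(x)-f_h^{(s-1)}(y)|/|x-y|$ (Hölder norm of integer order $s$). $\|X\|_{L_2(\mathbb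 P)}=(\mathbb E|X|^2)^{1/2}$. Bias and variance proxies: $$\mathrm{bias}_{h,d}(\theta)=\frac1d\sum_{a=1}^d(f_0-f_h)(\theta_a),\qquad\kappa_{t,h,n,d}(\theta)=\sum_{k=1}^{\lceil t\rceil-1}\frac{\|f_h^{(k)}(\theta)\|_2^2\,\sigma_n^{2k}}{(d^2/2)\,k!},$$ where $\|f_h^{(k)}(\theta)\|_2^2=\sum_{a=1}^d|f_h^{(k)}(\theta_a)|^2$, and $\kappa_{t,0,n,d}$ is the same with $f_0$ in place of $f_h$ (an empty sum is $0$). A Rademacher sequence is an i.i.d. sequence of uniform $\pm1$ signs.
   Formalization: The second part assumes α ≤ s (it fails for α > s, e.g. f_0 = f_h = x^4, s = 4, α = 5, θ = 0, Gaussian noise, large d), and the L_∞ norms are read as pointwise suprema, since with the essential supremum the last inequality fails when f_0 is changed at a point. *)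

theory Defs
  imports "HOL-Probability.Probability"
begin

text \<open>
  Vectors of \<open>\<real>\<^sup>d\<close> have type \<open>real ^ 'd\<close>, so that the dimension is \<open>d = CARD('d)\<close>.  A sample
  \<open>x\<^sub>1, \<dots>, x\<^sub>n\<close> is a function on \<open>nat\<close> of which only the values on \<open>{1..n}\<close> are used.  The \<open>k\<close>-th
  derivative of \<open>g\<close> is \<open>(deriv ^^ k) g\<close>.
\<close>

text \<open>
  \<open>deriv\<close> is total, so existence of derivatives has to be required separately.
\<close>

definition times_differentiable :: "nat \<Rightarrow> (real \<Rightarrow> real) \<Rightarrow> bool" where
  "times_differentiable k g \<longleftrightarrow> (\<forall>i<k. \<forall>x. (deriv ^^ i) g differentiable (at x))"

definition scaled_kernel :: "(real \<Rightarrow> real) \<Rightarrow> real \<Rightarrow> real \<Rightarrow> real" where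
  "scaled_kernel K h x = K (x / h) / h"

definition kernel_smoothing :: "(real \<Rightarrow> real) \<Rightarrow> real \<Rightarrow> (real \<Rightarrow> real) \<Rightarrow> real \<Rightarrow> real" where
  "kernel_smoothing K h f0 x = (LINT t|lebesgue. scaled_kernel K h (x - t) * f0 t)"

definition kernel_smoothing_exists :: "(real \<Rightarrow> real) \<Rightarrow> real \<Rightarrow> (real \<Rightarrow> real) \<Rightarrow> bool" where
  "kernel_smoothing_exists K h f0 \<longleftrightarrow>
     (\<forall>x. integrable lebesgue (\<lambda>t. scaled_kernel K h (x - t) * f0 t))"

definition additive_functional :: "(real \<Rightarrow> real) \<Rightarrow> real ^ 'd \<Rightarrow> real" where
  "additive_functional f0 \<theta> = (1 / real CARD('d)) * (\<Sum>a\<in>UNIV. f0 (\<theta> $ a))"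

definition sample_mean :: "nat \<Rightarrow> (nat \<Rightarrow> real ^ 'd) \<Rightarrow> real ^ 'd" where
  "sample_mean n x = (1 / real n) *\<^sub>R (\<Sum>j=1..n. x j)"

text \<open>
  The tuples of \<open>k\<close> pairwise distinct indices in \<open>{1..n}\<close> are the distinct lists of length \<open>k\<close>.
\<close>

definition centered_ustat :: "nat \<Rightarrow> (nat \<Rightarrow> real ^ 'd) \<Rightarrow> nat \<Rightarrow> 'd \<Rightarrow> real" where
  "centered_ustat n x k a =
     fact (n - k) / fact n *
     (\<Sum>js\<in>{js. length js = k \<and> distinct js \<and> set js \<subseteq> {1..n}}.
        \<Prod>l<k. (x (js ! l) $ a - sample_mean n x $ a))"

definition estimator :: "(real \<Rightarrow> real) \<Rightarrow> nat \<Rightarrow> nat \<Rightarrow> (nat \<Rightarrow> real ^ 'd) \<Rightarrow> real" where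
  "estimator fh m n x =
     (1 / real CARD('d)) *
     (\<Sum>a\<in>UNIV. fh (sample_mean n x $ a) +
        (\<Sum>k=2..m. (deriv ^^ k) fh (sample_mean n x $ a) * centered_ustat n x k a / fact k))"

definition holder_norm :: "nat \<Rightarrow> (real \<Rightarrow> real) \<Rightarrow> ennreal" where
  "holder_norm s g =
     (SUP (x, y)\<in>{(x, y). x \<noteq> y}.
        ennreal (\<bar>(deriv ^^ (s - 1)) g x - (deriv ^^ (s - 1)) g y\<bar> / \<bar>x - y\<bar>))"

text \<open>
  The \<open>L\<^sub>\<infinity>\<close> norm is the pointwise supremum, not the essential one: bounds on it are used at the
  individual points \<open>\<theta>\<^sub>a\<close>, and \<open>f\<^sub>0\<close> itself need not be continuous.
\<close>

definition sup_norm :: "(real \<Rightarrow> real) \<Rightarrow> ennreal" where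
  "sup_norm g = (SUP x. ennreal \<bar>g x\<bar>)"

text \<open>
  \<open>(E X\<^sup>2)\<^sup>1\<^sup>/\<^sup>2\<close>, with value \<open>\<infinity>\<close> when \<open>X\<close> is not square integrable.
\<close>

definition L2_norm :: "'w measure \<Rightarrow> ('w \<Rightarrow> real) \<Rightarrow> ennreal" where
  "L2_norm M X =
     (let I = (\<integral>\<^sup>+\<omega>. ennreal (\<bar>X \<omega>\<bar>\<^sup>2) \<partial>M) in
      if I = \<infinity> then \<infinity> else ennreal (sqrt (enn2real I)))"

definition bias :: "(real \<Rightarrow> real) \<Rightarrow> (real \<Rightarrow> real) \<Rightarrow> real ^ 'd \<Rightarrow> real" where
  "bias f0 fh \<theta> = (1 / real CARD('d)) * (\<Sum>a\<in>UNIV. f0 (\<theta> $ a) - fh (\<theta> $ a))"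

text \<open>
  The variance proxy \<open>\<kappa>\<close>: the index \<open>h\<close> is carried by the function argument (\<open>g = f\<^sub>h\<close>, or \<open>g = f\<^sub>0\<close>
  for \<open>h = 0\<close>), the index \<open>n\<close> by \<open>\<sigma> = \<sigma>\<^sub>n\<close>.
\<close>

definition var_proxy :: "real \<Rightarrow> (real \<Rightarrow> real) \<Rightarrow> real \<Rightarrow> real ^ 'd \<Rightarrow> real" where
  "var_proxy t g \<sigma> \<theta> =
     (\<Sum>k=1..nat \<lceil>t\<rceil> - 1.
        (\<Sum>a\<in>UNIV. \<bar>(deriv ^^ k) g (\<theta> $ a)\<bar>\<^sup>2) * \<sigma> ^ (2 * k) /
        ((real CARD('d))\<^sup>2 / 2 * fact k))"

definition rademacher :: "'w measure \<Rightarrow> (nat \<Rightarrow> 'w \<Rightarrow> real) \<Rightarrow> nat set \<Rightarrow> bool" where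
  "rademacher M r J \<longleftrightarrow>
     prob_space.indep_vars M (\<lambda>_. borel) r J \<and>
     (\<forall>j\<in>J. measure M {\<omega>\<in>space M. r j \<omega> = 1} = 1 / 2 \<and>
            measure M {\<omega>\<in>space M. r j \<omega> = -1} = 1 / 2)"

text \<open>
  Independence of the two families as a whole: the \<open>\<sigma>\<close>-algebras generated by the random elements
  \<open>(X\<^sub>j)\<^sub>j\<close> and \<open>(Y\<^sub>j)\<^sub>j\<close> of the product spaces are independent.  The library's \<open>indep_var\<close> would
  need \<open>X\<close> and \<open>Y\<close> to have the same type.  Measurability of both families is part of \<open>indep_set\<close>.
\<close>

definition indep_families ::
  "'w measure \<Rightarrow> nat set \<Rightarrow> (nat \<Rightarrow> 'w \<Rightarrow> real) \<Rightarrow> (nat \<Rightarrow> 'w \<Rightarrow> real ^ 'd) \<Rightarrow> bool" where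
  "indep_families M J X Y \<longleftrightarrow>
     prob_space.indep_set M
       (sets (vimage_algebra (space M) (\<lambda>\<omega>. \<lambda>j\<in>J. X j \<omega>) (PiM J (\<lambda>_. borel))))
       (sets (vimage_algebra (space M) (\<lambda>\<omega>. \<lambda>j\<in>J. Y j \<omega>) (PiM J (\<lambda>_. borel))))"

end

theory Submission
  imports Defs "HOL-Combinatorics.Multiset_Permutations"
begin

text \<open>
  Let \<open>u\<^sub>l\<close> be the normalized elementary symmetric polynomial of degree \<open>l\<close> in the noise of one
  coordinate.  Expanding the statistics centered at the sample mean in terms of the \<open>u\<^sub>l\<close> and collecting
  the coefficient of \<open>u\<^sub>l\<close> produces a Taylor polynomial of \<open>f\<^sub>h\<^sup>(\<^sup>l\<^sup>)\<close> about the sample mean, evaluated at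
  \<open>\<theta>\<^sub>a\<close>.  Hence the estimator equals \<open>\<Sum>\<^sub>l f\<^sub>h\<^sup>(\<^sup>l\<^sup>)(\<theta>\<^sub>a) u\<^sub>l / l!\<close>, averaged over \<open>a\<close>, up to a remainder bounded by
  \<open>\<parallel>f\<^sub>h\<parallel>\<^sub>(\<^sub>s\<^sub>) / s! \<cdot> \<Sum>\<^sub>l binom(s, l) |mean|\<^sup>s\<^sup>-\<^sup>l |u\<^sub>l|\<close>.  The terms of the main part are orthogonal,
  which yields bias and variance proxy.

  For the remainder, \<open>u\<^sub>l\<close> is, up to a factor at most \<open>4/3\<close>, an average over complex weights \<open>w\<^sub>j\<close> of
  modulus \<open>2\<close> of \<open>(\<Sum>\<^sub>j w\<^sub>j \<epsilon>\<^sub>j / n)\<^sup>l\<close>, with the same weights for all \<open>l < s\<close>.  By the binomial theorem the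
  remainder is then dominated by an average of \<open>(|\<Sum>\<^sub>j \<epsilon>\<^sub>j| + |\<Sum>\<^sub>j w\<^sub>j \<epsilon>\<^sub>j|)\<^sup>s / n\<^sup>s\<close>.  Its second moment is
  compared with the Rademacher moment of order \<open>2 s\<close>, at the cost of a factor \<open>64\<^sup>s\<close>, by convexity in the
  coefficients and Jensen's inequality.
\<close>

section \<open>Elementary symmetric polynomials\<close>

text \<open>The moment hypothesis controls Rademacher sums, which are linear in the noise, whereas
  the remainder contains the sample mean multiplied by the \<open>u\<^sub>l\<close>, that is,
  U-statistics of every degree below \<open>s\<close>. Writing all of them as powers of one random
  linear form, with common weights, leaves only linear sums, about which the hypothesis does speak.
  The link is this: as the average over the 2^n sign patterns stays below the bound, some fixed
  pattern \<open>r\<close> satisfies it; independence and mean zero then lead from \<open>r\<close>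
  to any coefficients of modulus at most \<open>A\<close>, at the price
  \<open>(2 * A) ^ (2 * s)\<close>. The constants fit as follows. \<open>2 powr (7 / 2)\<close>
  squares to \<open>128 = 64 * 2\<close>. The 2 is the one of \<open>2 ^ (s - 1)\<close> in the
  moment bound, up to a spare factor one half, and this half absorbs the square of
  \<open>4 / 3\<close>, the price for replacing a falling factorial by \<open>n ^ k\<close>. The
  square of the same \<open>4 / 3\<close> stays below the 2 in the variance proxy.\<close>

definition esym :: "'i set \<Rightarrow> ('i \<Rightarrow> 'a::comm_semiring_1) \<Rightarrow> nat \<Rightarrow> 'a" where
  "esym J y k = (\<Sum>A | A \<subseteq> J \<and> card A = k. prod y A)"

lemma esym_0:
  assumes "finite J"
  shows "esym J y 0 = 1"
proof -
  have "{A. A \<subseteq> J \<and> card A = 0} = {{}}"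
    using assms by (auto dest: finite_subset)
  then show ?thesis by (simp add: esym_def)
qed

lemma esym_empty_Suc: "esym {} y (Suc k) = 0"
  unfolding esym_def by (rule sum.neutral) auto

text \<open>Subsets are split by whether they contain \<open>j\<close>. The inductions over the
  index set that concern \<open>esym\<close> run on this recursion.\<close>

lemma esym_insert:
  assumes J: "finite J" "j \<notin> J"
  shows "esym (insert j J) y (Suc k) = esym J y (Suc k) + y j * esym J y k"
proof -
  have eq: "{A. A \<subseteq> insert j J \<and> card A = Suc k} =
      {A. A \<subseteq> J \<and> card A = Suc k} \<union> insert j ` {A. A \<subseteq> J \<and> card A = k}" (is "?L = ?P \<union> ?Q")
  proof (intro equalityI subsetI)
    fix A assume A: "A \<in> ?L"
    show "A \<in> ?P \<union> ?Q"
    proof (cases "j \<in> A")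
      case True
      have "A - {j} \<subseteq> J" "card (A - {j}) = k"
        using A True J by (auto simp: card_Diff_singleton_if dest: finite_subset)
      moreover have "A = insert j (A - {j})" using True by auto
      ultimately show ?thesis by blast
    qed (use A in auto)
  next
    fix A assume "A \<in> ?P \<union> ?Q"
    then show "A \<in> ?L"
    proof
      assume "A \<in> ?Q"
      then obtain B where B: "A = insert j B" "B \<subseteq> J" "card B = k" by auto
      then have "finite B" "j \<notin> B" using J by (auto dest: finite_subset)
      then show ?thesis using B by auto
    qed auto
  qed
  have "esym (insert j J) y (Suc k) = sum (prod y) ?P + sum (prod y) ?Q"
    unfolding esym_def eq using J
    by (subst sum.union_disjoint) auto
  also have "sum (prod y) ?Q = (\<Sum>A | A \<subseteq> J \<and> card A = k. prod y (insert j A))"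
  proof (subst sum.reindex)
    show "inj_on (insert j) {A. A \<subseteq> J \<and> card A = k}"
      using J by (auto simp: inj_on_def)
  qed simp
  also have "\<dots> = y j * esym J y k"
    unfolding esym_def sum_distrib_left
  proof (rule sum.cong)
    fix A assume "A \<in> {A. A \<subseteq> J \<and> card A = k}"
    then have "finite A" "j \<notin> A" using J by (auto dest: finite_subset)
    then show "prod y (insert j A) = y j * prod y A" by simp
  qed simp
  finally show ?thesis by (simp add: esym_def)
qed

text \<open>The multinomial expansion of the right-hand side contains every squarefree monomial of
  degree \<open>k\<close> with coefficient \<open>fact k\<close>, and all its other terms are
  nonnegative. Applied to variances, this bounds the contribution of degree \<open>k\<close> by the
  total variance.\<close>

lemma fact_esym_le_power:
  fixes y :: "'i \<Rightarrow> real"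
  assumes "finite J" "\<And>j. j \<in> J \<Longrightarrow> 0 \<le> y j"
  shows "fact k * esym J y k \<le> (sum y J) ^ k"
  using assms
proof (induction J arbitrary: k)
  case empty
  then show ?case by (cases k) (auto simp: esym_0 esym_empty_Suc)
next
  case (insert j J)
  show ?case
  proof (cases k)
    case 0
    then show ?thesis using insert by (simp add: esym_0)
  next
    case (Suc i)
    let ?S = "sum y J"
    have S: "0 \<le> ?S" "0 \<le> y j" using insert.prems by (auto intro: sum_nonneg)
    have "fact k * esym (insert j J) y k =
        fact (Suc i) * esym J y (Suc i) + real (Suc i) * y j * (fact i * esym J y i)"
      using insert.hyps by (simp add: Suc esym_insert algebra_simps)
    also have "\<dots> \<le> ?S ^ Suc i + real (Suc i) * y j * ?S ^ i"
    proof (intro add_mono mult_left_mono)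
      show "fact (Suc i) * esym J y (Suc i) \<le> ?S ^ Suc i" "fact i * esym J y i \<le> ?S ^ i"
        using insert.prems by (intro insert.IH; simp)+
    qed (use S in auto)
    also have "\<dots> \<le> (y j + ?S) ^ Suc i"
    proof -
      have "(y j + ?S) ^ Suc i = (\<Sum>p\<le>Suc i. of_nat (Suc i choose p) * y j ^ p * ?S ^ (Suc i - p))"
        by (rule binomial_ring)
      \<comment> \<open>The terms \<open>p = 0\<close> and \<open>p = 1\<close> are the two summands
        of the recursion; the rest of the binomial sum is nonnegative and is dropped.\<close>
      also have "\<dots> \<ge> (\<Sum>p\<in>{0, 1}. of_nat (Suc i choose p) * y j ^ p * ?S ^ (Suc i - p))"
        using S by (intro sum_mono2) auto
      finally show ?thesis by simp
    qed
    finally show ?thesis using insert.hyps Suc by simp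
  qed
qed

text \<open>A set of size \<open>k\<close> is enumerated by \<open>fact k\<close> distinct lists.
  This turns the tuple sum in \<open>centered_ustat\<close> into a sum over subsets, for which
  orthogonality will hold.\<close>

lemma sum_distinct_lists:
  fixes y :: "'i \<Rightarrow> 'a::comm_semiring_1"
  assumes J: "finite J"
  shows "(\<Sum>js | length js = k \<and> distinct js \<and> set js \<subseteq> J. \<Prod>l<k. y (js ! l)) = of_nat (fact k) * esym J y k"
proof -
  let ?C = "{A. A \<subseteq> J \<and> card A = k}"
  have "{js. length js = k \<and> distinct js \<and> set js \<subseteq> J} = (\<Union>A\<in>?C. permutations_of_set A)"
    by (auto simp: permutations_of_set_def distinct_card)
  then have "(\<Sum>js | length js = k \<and> distinct js \<and> set js \<subseteq> J. \<Prod>l<k. y (js ! l)) =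
      (\<Sum>A\<in>?C. \<Sum>js\<in>permutations_of_set A. \<Prod>l<k. y (js ! l))"
    using J by (simp, subst sum.UNION_disjoint)
      (auto simp: permutations_of_set_def intro: finite_subset[OF _ finite_permutations_of_set])
  also have "\<dots> = (\<Sum>A\<in>?C. \<Sum>js\<in>permutations_of_set A. prod y A)"
  proof (intro sum.cong refl)
    fix A js assume "A \<in> ?C" "js \<in> permutations_of_set A"
    then have js: "set js = A" "distinct js" "length js = k"
      by (auto simp: permutations_of_set_def distinct_card)
    show "(\<Prod>l<k. y (js ! l)) = prod y A"
      using prod.reindex_bij_betw[OF bij_betw_nth[OF js(2) refl refl], of y] js by simp
  qed
  also have "\<dots> = (\<Sum>A\<in>?C. of_nat (fact k) * prod y A)"
    using J by (intro sum.cong) (auto dest: finite_subset)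
  finally show ?thesis by (simp add: esym_def sum_distrib_left)
qed

lemma card_supersets:
  assumes "finite J" "B \<subseteq> J"
  shows "card {A. B \<subseteq> A \<and> A \<subseteq> J \<and> card A = card B + i} = (card J - card B) choose i"
proof -
  have fB: "finite B" using assms finite_subset by auto
  have "bij_betw (\<lambda>C. B \<union> C) {C. C \<subseteq> J - B \<and> card C = i} {A. B \<subseteq> A \<and> A \<subseteq> J \<and> card A = card B + i}"
  proof (rule bij_betwI[where g = "\<lambda>A. A - B"])
    show "(\<union>) B \<in> {C. C \<subseteq> J - B \<and> card C = i} \<rightarrow> {A. B \<subseteq> A \<and> A \<subseteq> J \<and> card A = card B + i}"
    proof
      fix C assume C: "C \<in> {C. C \<subseteq> J - B \<and> card C = i}"
      then have "finite C" "B \<inter> C = {}" using assms by (auto dest: finite_subset)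
      then show "B \<union> C \<in> {A. B \<subseteq> A \<and> A \<subseteq> J \<and> card A = card B + i}"
        using C fB assms by (auto simp: card_Un_disjoint)
    qed
    show "(\<lambda>A. A - B) \<in> {A. B \<subseteq> A \<and> A \<subseteq> J \<and> card A = card B + i} \<rightarrow> {C. C \<subseteq> J - B \<and> card C = i}"
      using fB by (auto simp: card_Diff_subset)
  qed auto
  then have "card {A. B \<subseteq> A \<and> A \<subseteq> J \<and> card A = card B + i} = card {C. C \<subseteq> J - B \<and> card C = i}"
    using bij_betw_same_card by fastforce
  also have "\<dots> = (card J - card B) choose i"
    using assms fB by (subst n_subsets) (auto simp: card_Diff_subset)
  finally show ?thesis .
qed

text \<open>After multiplying out, a subset \<open>B\<close> of size \<open>l\<close> arises from
  each \<open>k\<close>-set above it, and \<open>card_supersets\<close> counts these.\<close>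

lemma esym_shift:
  fixes y :: "'i \<Rightarrow> 'a::comm_ring_1"
  assumes J: "finite J"
  shows "esym J (\<lambda>j. y j - c) k =
    (\<Sum>l\<le>k. of_nat ((card J - l) choose (k - l)) * (- c) ^ (k - l) * esym J y l)"
proof -
  let ?C = "{A. A \<subseteq> J \<and> card A = k}"
  let ?B = "\<lambda>l. {B. B \<subseteq> J \<and> card B = l}"
  let ?t = "\<lambda>B. prod y B * (- c) ^ (k - card B)"
  have "esym J (\<lambda>j. y j - c) k = (\<Sum>A\<in>?C. \<Sum>B\<in>Pow A. ?t B)"
    unfolding esym_def
  proof (rule sum.cong)
    fix A assume A: "A \<in> ?C"
    then have fA: "finite A" using J finite_subset by auto
    have "(\<Prod>j\<in>A. y j - c) = (\<Prod>j\<in>A. y j + (- c))" by simp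
    also have "\<dots> = (\<Sum>B\<in>Pow A. prod y B * (\<Prod>j\<in>A - B. - c))"
      using fA by (rule prod_add)
    also have "\<dots> = (\<Sum>B\<in>Pow A. ?t B)"
      using A fA by (intro sum.cong) (auto simp: card_Diff_subset finite_subset)
    finally show "(\<Prod>j\<in>A. y j - c) = (\<Sum>B\<in>Pow A. ?t B)" .
  qed simp
  \<comment> \<open>An indicator replaces the range depending on \<open>A\<close>, so that the sums
    can be exchanged. The condition \<open>card B \<le> k\<close> makes the truncated subtraction
    \<open>k - card B\<close> exact in the count of supersets.\<close>
  also have "\<dots> = (\<Sum>A\<in>?C. \<Sum>B\<in>{B\<in>Pow J. card B \<le> k}. if B \<subseteq> A then ?t B else 0)"
  proof (rule sum.cong)
    fix A assume A: "A \<in> ?C"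
    then have fA: "finite A" using J finite_subset by auto
    have "Pow A = {B \<in> {B\<in>Pow J. card B \<le> k}. B \<subseteq> A}"
      using A fA by (auto intro: card_mono)
    then show "(\<Sum>B\<in>Pow A. ?t B) = (\<Sum>B\<in>{B\<in>Pow J. card B \<le> k}. if B \<subseteq> A then ?t B else 0)"
      using J by (simp only:) (subst sum.inter_filter, auto)
  qed simp
  also have "\<dots> = (\<Sum>B\<in>{B\<in>Pow J. card B \<le> k}. \<Sum>A\<in>?C. if B \<subseteq> A then ?t B else 0)"
    by (rule sum.swap)
  also have "\<dots> = (\<Sum>B\<in>{B\<in>Pow J. card B \<le> k}. of_nat ((card J - card B) choose (k - card B)) * ?t B)"
  proof (rule sum.cong)
    fix B assume B: "B \<in> {B\<in>Pow J. card B \<le> k}"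
    have "(\<Sum>A\<in>?C. if B \<subseteq> A then ?t B else 0) = (\<Sum>A\<in>{A\<in>?C. B \<subseteq> A}. ?t B)"
      using J by (subst sum.inter_filter) auto
    also have "\<dots> = of_nat (card {A\<in>?C. B \<subseteq> A}) * ?t B"
      by simp
    also have "{A\<in>?C. B \<subseteq> A} = {A. B \<subseteq> A \<and> A \<subseteq> J \<and> card A = card B + (k - card B)}"
      using B by auto
    also have "card \<dots> = (card J - card B) choose (k - card B)"
      using B J by (intro card_supersets) auto
    finally show "(\<Sum>A\<in>?C. if B \<subseteq> A then ?t B else 0) =
        of_nat ((card J - card B) choose (k - card B)) * ?t B" .
  qed simp
  also have "\<dots> = (\<Sum>l\<le>k. \<Sum>B\<in>{B\<in>{B\<in>Pow J. card B \<le> k}. card B = l}.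
      of_nat ((card J - card B) choose (k - card B)) * ?t B)"
    using J by (intro sum.group[symmetric]) auto
  also have "\<dots> = (\<Sum>l\<le>k. of_nat ((card J - l) choose (k - l)) * (- c) ^ (k - l) * esym J y l)"
    unfolding esym_def sum_distrib_left
    by (intro sum.cong) (auto simp: algebra_simps)
  finally show ?thesis .
qed

text \<open>Divided by the number of subsets, the elementary symmetric polynomials obey the binomial
  theorem of the powers \<open>(y - c) ^ k\<close>; the reason is the identity
  \<open>choose_mult\<close> for subsets of subsets. It is this form from which Taylor coefficients
  emerge later.\<close>

lemma esym_shift_normalized:
  fixes y :: "'i \<Rightarrow> real"
  assumes J: "finite J" and k: "k \<le> card J"
  shows "esym J (\<lambda>j. y j - c) k / real (card J choose k) =
    (\<Sum>l\<le>k. real (k choose l) * (- c) ^ (k - l) * (esym J y l / real (card J choose l)))"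
  unfolding esym_shift[OF J] sum_divide_distrib
proof (rule sum.cong)
  fix l assume l: "l \<in> {..k}"
  have "real (card J choose k) * real (k choose l) =
      real (card J choose l) * real ((card J - l) choose (k - l))"
    using choose_mult[of l k "card J"] l k by (simp flip: of_nat_mult)
  moreover have "0 < real (card J choose k)" "0 < real (card J choose l)"
    using l k by simp_all
  ultimately have "real ((card J - l) choose (k - l)) / real (card J choose k) =
      real (k choose l) / real (card J choose l)"
    by (simp add: field_simps)
  then have "real ((card J - l) choose (k - l)) / real (card J choose k) * ((- c) ^ (k - l) * esym J y l) =
      real (k choose l) / real (card J choose l) * ((- c) ^ (k - l) * esym J y l)"
    by (rule arg_cong)
  then show "real ((card J - l) choose (k - l)) * (- c) ^ (k - l) * esym J y l / real (card J choose k) =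
      real (k choose l) * (- c) ^ (k - l) * (esym J y l / real (card J choose l))"
    by (simp add: mult_ac)
qed simp

text \<open>Read \<open>q\<close> as a probability on \<open>T\<close>, and
  \<open>J \<rightarrow>\<^sub>E T\<close> with the product weights as independent draws of
  \<open>z\<close>, one per index. In the expanded power each monomial is weighted by a product of
  moments of \<open>z\<close>; since those of order 2 and more vanish, every monomial with a
  repeated index disappears.\<close>

lemma averaged_power_eq_esym:
  fixes q z :: "'b \<Rightarrow> 'a::comm_ring_1"
  assumes J: "finite J" and T: "finite T"
    and mom: "\<And>p. p \<le> s \<Longrightarrow> (\<Sum>i\<in>T. q i * z i ^ p) = (if p \<le> 1 then 1 else 0)"
    and k: "k \<le> s"
  shows "(\<Sum>\<phi>\<in>J \<rightarrow>\<^sub>E T. (\<Prod>j\<in>J. q (\<phi> j)) * (\<Sum>j\<in>J. z (\<phi> j) * y j) ^ k) =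
    of_nat (fact k) * esym J y k"
  using J k
proof (induction J arbitrary: k)
  case empty
  then show ?case by (cases k) (auto simp: esym_0 esym_empty_Suc)
next
  case (insert j J)
  let ?W = "\<lambda>\<phi>. \<Prod>j\<in>J. q (\<phi> j)" and ?S = "\<lambda>\<phi>. \<Sum>j\<in>J. z (\<phi> j) * y j"
  let ?E = "\<lambda>p. \<Sum>\<phi>\<in>J \<rightarrow>\<^sub>E T. ?W \<phi> * ?S \<phi> ^ p"
  have "(\<Sum>\<phi>\<in>insert j J \<rightarrow>\<^sub>E T. (\<Prod>j\<in>insert j J. q (\<phi> j)) * (\<Sum>j\<in>insert j J. z (\<phi> j) * y j) ^ k) =
      (\<Sum>(i, \<phi>)\<in>T \<times> (J \<rightarrow>\<^sub>E T). q i * ?W \<phi> * (z i * y j + ?S \<phi>) ^ k)"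
    \<comment> \<open>The draw at the new index \<open>j\<close> is separated from those on
      \<open>J\<close>, as in Fubini's theorem.\<close>
    unfolding PiE_insert_eq
  proof (subst sum.reindex[OF inj_combinator[OF insert.hyps(2)]], rule sum.cong, simp, clarify)
    fix i \<phi> assume "i \<in> T"
    have "?W (\<phi>(j := i)) = ?W \<phi>" "?S (\<phi>(j := i)) = ?S \<phi>"
      using insert.hyps by (auto intro!: prod.cong sum.cong)
    then show "((\<lambda>\<phi>. (\<Prod>j\<in>insert j J. q (\<phi> j)) * (\<Sum>j\<in>insert j J. z (\<phi> j) * y j) ^ k) \<circ> (\<lambda>(y, g). g(j := y))) (i, \<phi>)
        = q i * ?W \<phi> * (z i * y j + ?S \<phi>) ^ k"
      using insert.hyps by simp
  qed
  also have "\<dots> = (\<Sum>i\<in>T. \<Sum>\<phi>\<in>J \<rightarrow>\<^sub>E T. \<Sum>p\<le>k.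
      of_nat (k choose p) * y j ^ p * (q i * z i ^ p) * (?W \<phi> * ?S \<phi> ^ (k - p)))"
    by (simp add: sum.cartesian_product[symmetric] binomial_ring sum_distrib_left power_mult_distrib mult_ac)
  also have "\<dots> = (\<Sum>i\<in>T. \<Sum>p\<le>k. \<Sum>\<phi>\<in>J \<rightarrow>\<^sub>E T.
      of_nat (k choose p) * y j ^ p * (q i * z i ^ p) * (?W \<phi> * ?S \<phi> ^ (k - p)))"
    by (intro sum.cong refl sum.swap)
  also have "\<dots> = (\<Sum>p\<le>k. \<Sum>i\<in>T. \<Sum>\<phi>\<in>J \<rightarrow>\<^sub>E T.
      of_nat (k choose p) * y j ^ p * (q i * z i ^ p) * (?W \<phi> * ?S \<phi> ^ (k - p)))"
    by (rule sum.swap)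
  also have "\<dots> = (\<Sum>p\<le>k. of_nat (k choose p) * y j ^ p * (\<Sum>i\<in>T. q i * z i ^ p) * ?E (k - p))"
    by (simp only: sum_distrib_left[symmetric] sum_distrib_right mult.assoc)
  \<comment> \<open>Only the exponents 0 and 1 of \<open>y j\<close> survive, which matches the two
    summands of the recursion for \<open>esym\<close>.\<close>
  also have "\<dots> = (\<Sum>p\<le>k. if p \<le> 1 then of_nat (k choose p) * y j ^ p * ?E (k - p) else 0)"
    using insert.prems by (intro sum.cong) (auto simp: mom)
  also have "\<dots> = (\<Sum>p\<in>{p\<in>{..k}. p \<le> 1}. of_nat (k choose p) * y j ^ p * (of_nat (fact (k - p)) * esym J y (k - p)))"
    using insert.IH insert.prems by (subst sum.inter_filter) (auto intro!: sum.cong)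
  also have "\<dots> = of_nat (fact k) * esym (insert j J) y k"
  proof (cases k)
    case 0
    then have "{p\<in>{..k}. p \<le> 1} = {0}" by auto
    then show ?thesis using 0 insert.hyps by (simp add: esym_0)
  next
    case (Suc i)
    then have "{p\<in>{..k}. p \<le> 1} = {0, 1}" by auto
    then show ?thesis using Suc insert.hyps by (simp add: esym_insert algebra_simps)
  qed
  finally show ?case .
qed

section \<open>Polarization and Taylor expansion\<close>

text \<open>Orthogonality of the characters of the cyclic group of order \<open>N\<close>: a
  geometric sum with ratio \<open>\<zeta> ^ p\<close>, which is 1 exactly when \<open>N\<close>
  divides \<open>p\<close>.\<close>

lemma sum_powers_root_of_unity:
  fixes N p :: nat
  assumes N: "0 < N"
  defines "\<zeta> \<equiv> cis (2 * pi / real N)"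
  shows "(\<Sum>m<N. \<zeta> ^ (m * p)) = (if N dvd p then of_nat N else 0)"
proof -
  have eq: "\<zeta> ^ (m * p) = (\<zeta> ^ p) ^ m" for m
    by (simp add: power_mult[symmetric] mult.commute)
  have pow: "\<zeta> ^ N = 1"
    using N cis_2pi unfolding \<zeta>_def Complex.DeMoivre by simp
  show ?thesis
  proof (cases "N dvd p")
    case True
    then have "\<zeta> ^ p = 1" using pow by (auto simp: power_mult)
    then show ?thesis using True by (simp add: eq)
  next
    case False
    have "\<zeta> ^ p \<noteq> 1"
    proof
      assume "\<zeta> ^ p = 1"
      then have "cis (2 * pi * real p / real N) = 1"
        by (simp add: \<zeta>_def Complex.DeMoivre mult_ac)
      then have "cos (2 * pi * real p / real N) = 1"
        by (simp add: complex_eq_iff)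
      then obtain k :: int where "2 * pi * real p / real N = real_of_int k * 2 * pi"
        by (auto simp: cos_one_2pi_int)
      then have "real p = real_of_int k * real N"
        using N by (simp add: field_simps)
      then have "int p = k * int N"
        by (metis of_int_eq_iff of_int_mult of_int_of_nat_eq)
      then have "int N dvd int p" by simp
      then show False using False by simp
    qed
    moreover have "(\<zeta> ^ p) ^ N = 1"
      using pow by (metis mult.commute power_mult power_one)
    ultimately show ?thesis using False by (simp add: eq sum_gp_strict)
  qed
qed

text \<open>
  No real random variable has \<open>E w = 1\<close> and \<open>E w\<^sup>2 = 0\<close>, but the complex \<open>w = 2 e\<^sup>i\<^sup>t\<close>, with \<open>t\<close> of density
  proportional to \<open>1 + cos t\<close>, has mean \<open>1\<close> and vanishing moments of all orders \<open>\<ge> 2\<close>.  The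
  weights are a discretization of it at roots of unity, exact up to order \<open>s\<close>.
\<close>

lemma complex_weights_exist:
  obtains N :: nat and q :: "nat \<Rightarrow> real" and z :: "nat \<Rightarrow> complex"
  where "\<And>i. 0 \<le> q i" "\<And>i. cmod (z i) = 2"
    "\<And>p. p \<le> s \<Longrightarrow> (\<Sum>i<N. complex_of_real (q i) * z i ^ p) = (if p \<le> 1 then 1 else 0)"
proof -
  \<comment> \<open>The moment of order \<open>p\<close> involves the exponents \<open>p\<close>,
    \<open>p + 1\<close> and \<open>p + (N - 1)\<close>. With \<open>N = s + 2\<close> and
    \<open>p \<le> s\<close>, \<open>N\<close> divides the first only for \<open>p = 0\<close>, the
    second never, and the third only for \<open>p = 1\<close>.\<close>
  define N where "N = s + 2"
  define \<zeta> where "\<zeta> = cis (2 * pi / real N)"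
  define q where "q m = (1 + Re (\<zeta> ^ m)) / real N" for m
  define z where "z m = 2 * \<zeta> ^ m" for m
  have N: "2 \<le> N" by (simp add: N_def)
  have norm: "cmod (\<zeta> ^ m) = 1" for m
    by (simp add: \<zeta>_def norm_power)
  have pow: "\<zeta> ^ N = 1"
    using N cis_2pi unfolding \<zeta>_def Complex.DeMoivre by simp
  \<comment> \<open>The conjugate of a root of unity is its power \<open>N - 1\<close>, so the
    cosine in the density becomes a sum of natural powers.\<close>
  have Re: "complex_of_real (Re (\<zeta> ^ m)) = (\<zeta> ^ m + \<zeta> ^ (m * (N - 1))) / 2" for m
  proof -
    have "\<zeta> ^ (m * (N - 1)) * \<zeta> ^ m = \<zeta> ^ (m * N)"
      using N by (simp flip: power_add add: algebra_simps mult_eq_if)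
    also have "\<dots> = 1"
      using pow by (metis mult.commute power_mult power_one)
    also have "1 = cnj (\<zeta> ^ m) * \<zeta> ^ m"
      using norm[of m] by (metis complex_norm_square mult.commute of_real_1 power_one)
    finally have "\<zeta> ^ (m * (N - 1)) = cnj (\<zeta> ^ m)"
      using norm[of m] by (metis mult_right_cancel norm_zero zero_neq_one)
    then have "\<zeta> ^ m + \<zeta> ^ (m * (N - 1)) = \<zeta> ^ m + cnj (\<zeta> ^ m)"
      by (rule arg_cong)
    also have "\<dots> = 2 * complex_of_real (Re (\<zeta> ^ m))"
      by (simp only: complex_add_cnj of_real_mult of_real_numeral)
    finally show ?thesis by simp
  qed
  show thesis
  proof
    fix i
    have "- 1 \<le> Re (\<zeta> ^ i)"
      using abs_Re_le_cmod[of "\<zeta> ^ i"] norm[of i] by simp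
    then show "0 \<le> q i" by (simp add: q_def)
    show "cmod (z i) = 2" using norm[of i] by (simp add: z_def norm_mult)
  next
    fix p assume p: "p \<le> s"
    let ?R = "\<lambda>k. \<Sum>m<N. \<zeta> ^ (m * k)"
    have "(\<Sum>i<N. complex_of_real (q i) * z i ^ p) =
        (\<Sum>i<N. 2 ^ p / of_nat N * (\<zeta> ^ (i * p) + \<zeta> ^ (i * (p + 1)) / 2 + \<zeta> ^ (i * (p + (N - 1))) / 2))"
    proof (rule sum.cong)
      fix i
      have "complex_of_real (q i) * z i ^ p =
          (1 + (\<zeta> ^ i + \<zeta> ^ (i * (N - 1))) / 2) / of_nat N * (2 ^ p * \<zeta> ^ (i * p))"
        by (simp add: q_def z_def Re power_mult_distrib power_mult)
      also have "\<dots> = 2 ^ p / of_nat N *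
          (\<zeta> ^ (i * p) + (\<zeta> ^ (i * p) * \<zeta> ^ i) / 2 + (\<zeta> ^ (i * p) * \<zeta> ^ (i * (N - 1))) / 2)"
        by (simp add: field_simps)
      also have "\<zeta> ^ (i * p) * \<zeta> ^ i = \<zeta> ^ (i * (p + 1))"
        by (simp add: power_add[symmetric] algebra_simps)
      also have "\<zeta> ^ (i * p) * \<zeta> ^ (i * (N - 1)) = \<zeta> ^ (i * (p + (N - 1)))"
        by (simp add: power_add[symmetric] algebra_simps)
      finally show "complex_of_real (q i) * z i ^ p =
          2 ^ p / of_nat N * (\<zeta> ^ (i * p) + \<zeta> ^ (i * (p + 1)) / 2 + \<zeta> ^ (i * (p + (N - 1))) / 2)" .
    qed simp
    also have "\<dots> = 2 ^ p / of_nat N * (?R p + ?R (p + 1) / 2 + ?R (p + (N - 1)) / 2)"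
      by (simp only: sum_distrib_left[symmetric] sum.distrib sum_divide_distrib)
    \<comment> \<open>For \<open>p = 0\<close> the first sum equals \<open>N\<close>; for
      \<open>p = 1\<close> the last one contributes \<open>N / 2\<close>, and the factor
      \<open>2 ^ p\<close> restores the value 1.\<close>
    also have "\<dots> = (if p \<le> 1 then 1 else 0)"
    proof -
      have R: "?R k = (if N dvd k then of_nat N else 0)" for k
        using sum_powers_root_of_unity[of N k] N by (simp add: \<zeta>_def)
      have 1: "N dvd p \<longleftrightarrow> p = 0"
        using p by (auto simp: N_def dest: dvd_imp_le)
      have 2: "\<not> N dvd p + 1"
        using p by (auto simp: N_def dest: dvd_imp_le)
      have 3: "N dvd p + (N - 1) \<longleftrightarrow> p = 1"
      proof
        assume "N dvd p + (N - 1)"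
        then obtain k where k: "p + (N - 1) = N * k" by blast
        have "k < 2"
        proof (rule ccontr)
          assume "\<not> k < 2"
          then have "N * 2 \<le> N * k" by simp
          then show False using k p N_def by linarith
        qed
        moreover have "k \<noteq> 0" using k N by (intro notI) simp
        ultimately have "k = 1" by linarith
        then show "p = 1" using k N by simp
      qed (use N in auto)
      show ?thesis using N unfolding R 1 3 by (auto simp: 2[simplified] le_Suc_eq)
    qed
    finally show "(\<Sum>i<N. complex_of_real (q i) * z i ^ p) = (if p \<le> 1 then 1 else 0)" .
  qed
qed

text \<open>The falling factorial is at least \<open>n ^ k * (1 - k^2 / (2 * n))\<close>, the
  birthday bound for a collision among \<open>k\<close> draws, proved by induction. Since
  \<open>ln 2 \<le> 1\<close>, the hypothesis on \<open>s\<close> gives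
  \<open>2 * k^2 \<le> n\<close>, so the bracket is at least \<open>3 / 4\<close>.\<close>

lemma power_le_fact_binomial:
  fixes n s k :: nat
  assumes s: "real s \<le> sqrt (real n / 2 * ln 2)" and n: "1 \<le> n" and k: "k \<le> s"
  shows "real n ^ k \<le> 4 / 3 * (fact k * real (n choose k))" "k \<le> n"
proof -
  have "(real s)\<^sup>2 \<le> (sqrt (real n / 2 * ln 2))\<^sup>2"
    using s by (intro power_mono) auto
  also have "\<dots> = real n / 2 * ln 2" by simp
  also have "\<dots> \<le> real n / 2"
    using ln_le_minus_one[of "2::real"] by (intro mult_left_le) auto
  finally have s2: "2 * (real s)\<^sup>2 \<le> real n" by simp
  have kk: "real k \<le> (real k)\<^sup>2"
    by (cases k) (simp_all add: power2_eq_square)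
  have k2: "2 * (real k)\<^sup>2 \<le> real n"
  proof -
    have "(real k)\<^sup>2 \<le> (real s)\<^sup>2" using k by (intro power_mono) auto
    then show ?thesis using s2 by linarith
  qed
  show kn: "k \<le> n" using k2 kk by linarith
  have gen: "real n ^ i * (1 - (real i)\<^sup>2 / (2 * real n)) \<le> fact i * real (n choose i)" if "i \<le> k" for i
    using that
  proof (induction i)
    case (Suc i)
    have "real n ^ Suc i * (1 - (real (Suc i))\<^sup>2 / (2 * real n)) \<le>
        real n ^ Suc i * ((1 - (real i)\<^sup>2 / (2 * real n)) * (1 - real i / real n))"
      using n by (intro mult_left_mono) (auto simp: field_simps power2_eq_square)
    also have "\<dots> = real n ^ i * (1 - (real i)\<^sup>2 / (2 * real n)) * (real n - real i)"
      using n by (simp add: field_simps)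
    also have "\<dots> \<le> fact i * real (n choose i) * (real n - real i)"
      using Suc kn by (intro mult_right_mono) auto
    also have "\<dots> = fact (Suc i) * real (n choose Suc i)"
    proof -
      have "Suc i * (n choose Suc i) = (n - i) * (n choose i)"
        using Suc.prems kn by (metis binomial_absorb_comp binomial_absorption)
      then have "real (Suc i) * real (n choose Suc i) = (real n - real i) * real (n choose i)"
        using Suc.prems kn by (metis Suc_leD le_trans of_nat_diff of_nat_mult)
      then have "fact i * (real (Suc i) * real (n choose Suc i)) = fact i * ((real n - real i) * real (n choose i))"
        by (rule arg_cong)
      then show ?thesis unfolding fact_Suc of_nat_mult by (simp only: mult_ac)
    qed
    finally show ?case .
  qed simp
  have "real n ^ k * (3 / 4) \<le> real n ^ k * (1 - (real k)\<^sup>2 / (2 * real n))"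
    using k2 n by (intro mult_left_mono) (auto simp: field_simps)
  with gen[OF order_refl] show "real n ^ k \<le> 4 / 3 * (fact k * real (n choose k))"
    by linarith
qed

section \<open>Taylor's formula with a Lipschitz top derivative\<close>

lemma has_derivative_dominated_right:
  fixes f g :: "real \<Rightarrow> real"
  assumes "c \<le> y" "f c = 0" "g c = 0"
    and f: "\<And>x. c \<le> x \<Longrightarrow> (f has_real_derivative f' x) (at x)"
    and g: "\<And>x. c \<le> x \<Longrightarrow> (g has_real_derivative g' x) (at x)"
    and le: "\<And>x. c \<le> x \<Longrightarrow> \<bar>f' x\<bar> \<le> g' x"
  shows "\<bar>f y\<bar> \<le> g y"
proof -
  have "g c - f c \<le> g y - f y"
  proof (rule DERIV_nonneg_imp_nondecreasing[OF \<open>c \<le> y\<close>])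
    fix x assume "c \<le> x" "x \<le> y"
    then show "\<exists>d. ((\<lambda>x. g x - f x) has_real_derivative d) (at x) \<and> 0 \<le> d"
      using le[of x] by (intro exI[of _ "g' x - f' x"] conjI DERIV_diff f g) auto
  qed
  moreover have "g c + f c \<le> g y + f y"
  proof (rule DERIV_nonneg_imp_nondecreasing[OF \<open>c \<le> y\<close>])
    fix x assume "c \<le> x" "x \<le> y"
    then show "\<exists>d. ((\<lambda>x. g x + f x) has_real_derivative d) (at x) \<and> 0 \<le> d"
      using le[of x] by (intro exI[of _ "g' x + f' x"] conjI DERIV_add f g) auto
  qed
  ultimately show ?thesis using assms by auto
qed

lemma has_derivative_power_div_fact:
  fixes a c :: real
  shows "((\<lambda>x. a * (x - c) ^ Suc i / fact (Suc i)) has_real_derivative a * (x - c) ^ i / fact i) (at x)"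
proof -
  have "((\<lambda>x. a / fact (Suc i) * (x - c) ^ Suc i) has_real_derivative
      a / fact (Suc i) * (real (Suc i) * (x - c) ^ i)) (at x)"
    by (rule DERIV_cmult) (auto intro!: derivative_eq_intros simp del: power_Suc)
  also have "a / fact (Suc i) * (real (Suc i) * (x - c) ^ i) = a * (x - c) ^ i / fact i"
    unfolding fact_Suc by (simp del: of_nat_Suc)
  finally show ?thesis by simp
qed

text \<open>Only a Lipschitz constant of \<open>D r\<close> is available, as in the Hoelder norm, so
  there is no derivative of order \<open>Suc r\<close> for a remainder formula. Instead the
  remainder is compared with its bound through their derivatives, to which the induction hypothesis
  for the shifted sequence applies. This is why \<open>D\<close> is an arbitrary sequence of
  functions.\<close>

lemma taylor_lipschitz_right:
  fixes D :: "nat \<Rightarrow> real \<Rightarrow> real"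
  assumes "\<And>i x. i < r \<Longrightarrow> (D i has_real_derivative D (Suc i) x) (at x)"
    and "\<And>x y. \<bar>D r x - D r y\<bar> \<le> L * \<bar>x - y\<bar>" and "c \<le> y"
  shows "\<bar>D 0 y - (\<Sum>i\<le>r. D i c * (y - c) ^ i / fact i)\<bar> \<le> L * (y - c) ^ Suc r / fact (Suc r)"
  using assms
proof (induction r arbitrary: D y)
  case 0
  then show ?case using 0(2)[of y c] by simp
next
  case (Suc r)
  define f where "f x = D 0 x - (\<Sum>i\<le>Suc r. D i c * (x - c) ^ i / fact i)" for x
  define f' where "f' x = D (Suc 0) x - (\<Sum>i\<le>r. D (Suc i) c * (x - c) ^ i / fact i)" for x
  define g where "g x = L * (x - c) ^ Suc (Suc r) / fact (Suc (Suc r))" for x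
  define g' where "g' x = L * (x - c) ^ Suc r / fact (Suc r)" for x
  have "\<bar>f y\<bar> \<le> g y"
  proof (rule has_derivative_dominated_right[OF \<open>c \<le> y\<close>])
    show "f c = 0" by (simp add: f_def sum.atMost_Suc_shift)
    show "g c = 0" by (simp add: g_def)
    fix x assume x: "c \<le> x"
    show "(f has_real_derivative f' x) (at x)"
    proof -
      have t: "((\<lambda>x. D (Suc i) c * (x - c) ^ Suc i / fact (Suc i)) has_real_derivative
          D (Suc i) c * (x - c) ^ i / fact i) (at x)" for i
        by (rule has_derivative_power_div_fact)
      have "((\<lambda>x. D 0 x - (D 0 c + (\<Sum>i\<le>r. D (Suc i) c * (x - c) ^ Suc i / fact (Suc i)))) has_real_derivative
          D (Suc 0) x - (0 + (\<Sum>i\<le>r. D (Suc i) c * (x - c) ^ i / fact i))) (at x)"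
        by (intro DERIV_diff DERIV_add DERIV_const DERIV_sum t Suc.prems) simp
      then show ?thesis
        unfolding f_def f'_def sum.atMost_Suc_shift by simp
    qed
    show "(g has_real_derivative g' x) (at x)"
      unfolding g_def g'_def by (rule has_derivative_power_div_fact)
    show "\<bar>f' x\<bar> \<le> g' x"
      unfolding f'_def g'_def using Suc.IH[of "\<lambda>i. D (Suc i)" x] Suc.prems x by simp
  qed
  then show ?case by (simp only: f_def g_def)
qed

lemma taylor_lipschitz:
  fixes D :: "nat \<Rightarrow> real \<Rightarrow> real"
  assumes D: "\<And>i x. i < r \<Longrightarrow> (D i has_real_derivative D (Suc i) x) (at x)"
    and L: "\<And>x y. \<bar>D r x - D r y\<bar> \<le> L * \<bar>x - y\<bar>"
  shows "\<bar>D 0 y - (\<Sum>i\<le>r. D i c * (y - c) ^ i / fact i)\<bar> \<le> L * \<bar>y - c\<bar> ^ Suc r / fact (Suc r)"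
proof (cases "c \<le> y")
  case True
  then show ?thesis using taylor_lipschitz_right[OF assms] by simp
next
  case False
  \<comment> \<open>These are the derivatives of the reflected function \<open>D 0 (- x)\<close>;
    the reflection moves \<open>y\<close> to the right of the centre.\<close>
  define E where "E i x = (- 1) ^ i * D i (- x)" for i x
  have "\<bar>E 0 (- y) - (\<Sum>i\<le>r. E i (- c) * (- y - - c) ^ i / fact i)\<bar> \<le> L * (- y - - c) ^ Suc r / fact (Suc r)"
  proof (rule taylor_lipschitz_right)
    fix i x assume "i < r"
    then have "((\<lambda>x. D i (- x)) has_real_derivative D (Suc i) (- x) * (- 1)) (at x)"
      by (intro DERIV_chain2[OF D]) (auto intro!: derivative_eq_intros)
    from DERIV_cmult[OF this, of "(- 1) ^ i"]
    show "(E i has_real_derivative E (Suc i) x) (at x)"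
      by (simp add: E_def[abs_def])
  next
    fix x y
    have "\<bar>E r x - E r y\<bar> = \<bar>D r (- x) - D r (- y)\<bar>"
      by (simp add: E_def abs_mult flip: right_diff_distrib)
    then show "\<bar>E r x - E r y\<bar> \<le> L * \<bar>x - y\<bar>"
      using L[of "- x" "- y"] by (simp add: abs_minus_commute)
  qed (use False in simp)
  moreover have "E i (- c) * (- y - - c) ^ i = D i c * (y - c) ^ i" for i
  proof -
    have "(- 1) ^ i * (c - y) ^ i = (y - c) ^ i"
      unfolding power_mult_distrib[symmetric] by simp
    then show ?thesis by (simp add: E_def)
  qed
  ultimately have "\<bar>E 0 (- y) - (\<Sum>i\<le>r. D i c * (y - c) ^ i / fact i)\<bar> \<le> L * (- y - - c) ^ Suc r / fact (Suc r)"
    by (simp only:)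
  moreover have "\<bar>y - c\<bar> = - y - - c" "E 0 (- y) = D 0 y" using False by (simp_all add: E_def)
  ultimately show ?thesis by metis
qed

text \<open>The representation by averaged powers is an identity of complex numbers; the weights
  \<open>q\<close> are nonnegative and so survive the passage to moduli. The constant
  \<open>C\<close> appears because the linear forms are normalized by \<open>n\<close>, but the
  statistic by the number of subsets.\<close>

lemma polarization_bound:
  fixes y :: "'i \<Rightarrow> real" and z :: "'b \<Rightarrow> complex"
  assumes J: "finite J" "card J = n" "1 \<le> n" and T: "finite T"
    and q: "\<And>i. 0 \<le> q i"
    and mom: "\<And>p. p \<le> s \<Longrightarrow> (\<Sum>i\<in>T. complex_of_real (q i) * z i ^ p) = (if p \<le> 1 then 1 else 0)"
    and ratio: "real n ^ l \<le> C * (fact l * real (n choose l))" and l: "l \<le> s" "l \<le> n"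
  shows "\<bar>esym J y l / real (n choose l)\<bar> \<le>
    C * (\<Sum>\<phi>\<in>J \<rightarrow>\<^sub>E T. (\<Prod>j\<in>J. q (\<phi> j)) * cmod ((\<Sum>j\<in>J. z (\<phi> j) * y j) / real n) ^ l)"
proof -
  have n: "0 < real n" and c: "0 < real (n choose l)" using J l by simp_all
  let ?V = "\<Sum>\<phi>\<in>J \<rightarrow>\<^sub>E T. (\<Prod>j\<in>J. q (\<phi> j)) * cmod ((\<Sum>j\<in>J. z (\<phi> j) * y j) / real n) ^ l"
  have es: "esym J (\<lambda>j. complex_of_real (y j)) l = of_real (esym J y l)"
    by (simp add: esym_def)
  have "fact l * \<bar>esym J y l\<bar> = cmod (of_nat (fact l) * esym J (\<lambda>j. complex_of_real (y j)) l)"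
    unfolding es norm_mult norm_of_nat norm_of_real by simp
  also have "of_nat (fact l) * esym J (\<lambda>j. complex_of_real (y j)) l =
      (\<Sum>\<phi>\<in>J \<rightarrow>\<^sub>E T. (\<Prod>j\<in>J. complex_of_real (q (\<phi> j))) * (\<Sum>j\<in>J. z (\<phi> j) * y j) ^ l)"
    by (rule averaged_power_eq_esym[OF J(1) T mom l(1), symmetric])
  also have "cmod \<dots> \<le> (\<Sum>\<phi>\<in>J \<rightarrow>\<^sub>E T. (\<Prod>j\<in>J. q (\<phi> j)) * cmod (\<Sum>j\<in>J. z (\<phi> j) * y j) ^ l)"
    using q by (intro order_trans[OF norm_sum] sum_mono)
      (simp add: norm_mult norm_power abs_mult prod_nonneg flip: of_real_prod)
  also have "\<dots> = real n ^ l * ?V"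
    using n by (simp add: norm_divide power_divide sum_distrib_left)
  also have "\<dots> \<le> C * (fact l * real (n choose l)) * ?V"
    by (intro mult_right_mono ratio sum_nonneg mult_nonneg_nonneg prod_nonneg q) auto
  finally have "fact l * \<bar>esym J y l\<bar> \<le> fact l * (C * real (n choose l) * ?V)"
    by (simp add: mult_ac)
  then have "\<bar>esym J y l\<bar> \<le> C * real (n choose l) * ?V"
    by (subst (asm) mult_le_cancel_left_pos) auto
  then show ?thesis
    using c by (simp add: abs_divide pos_divide_le_eq mult_ac)
qed

section \<open>Remainder of the expansion about the sample mean\<close>

lemma sum_atMost_triangle_swap:
  fixes a :: "nat \<Rightarrow> nat \<Rightarrow> 'a::comm_monoid_add"
  shows "(\<Sum>k\<le>m. \<Sum>l\<le>k. a k l) = (\<Sum>l\<le>m. \<Sum>k\<in>{l..m}. a k l)"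
proof (induction m)
  case (Suc m)
  have "(\<Sum>l\<le>Suc m. \<Sum>k\<in>{l..Suc m}. a k l) = (\<Sum>l\<le>m. (\<Sum>k\<in>{l..m}. a k l) + a (Suc m) l) + a (Suc m) (Suc m)"
    by simp
  then show ?case using Suc by (simp add: sum.distrib ac_simps)
qed simp

text \<open>
  Expanding the centered statistics in the uncentered ones, the coefficient of the \<open>l\<close>-th of these
  is the Taylor polynomial of \<open>D l\<close> about \<open>t + e\<close>, evaluated at \<open>t\<close>.
\<close>

lemma taylor_ustat_remainder:
  fixes D :: "nat \<Rightarrow> real \<Rightarrow> real" and y :: "'i \<Rightarrow> real"
  assumes J: "finite J" "m \<le> card J"
    and D: "\<And>i x. i < m \<Longrightarrow> (D i has_real_derivative D (Suc i) x) (at x)"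
    and L: "\<And>x y. \<bar>D m x - D m y\<bar> \<le> L * \<bar>x - y\<bar>"
  defines "u \<equiv> \<lambda>l. esym J y l / real (card J choose l)"
  shows "\<bar>(\<Sum>k\<le>m. D k (t + e) * (esym J (\<lambda>j. y j - e) k / real (card J choose k)) / fact k)
      - (\<Sum>l\<le>m. D l t * u l / fact l)\<bar>
    \<le> (\<Sum>l\<le>m. L * \<bar>e\<bar> ^ (Suc m - l) / fact (Suc m - l) * (\<bar>u l\<bar> / fact l))"
proof -
  have "(\<Sum>k\<le>m. D k (t + e) * (esym J (\<lambda>j. y j - e) k / real (card J choose k)) / fact k) =
      (\<Sum>k\<le>m. \<Sum>l\<le>k. D k (t + e) * (- e) ^ (k - l) / fact (k - l) * (u l / fact l))"
  proof (rule sum.cong)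
    fix k assume k: "k \<in> {..m}"
    have "D k (t + e) * (esym J (\<lambda>j. y j - e) k / real (card J choose k)) / fact k =
        (\<Sum>l\<le>k. D k (t + e) * (real (k choose l) * (- e) ^ (k - l) * u l) / fact k)"
      using k J unfolding u_def
      by (subst esym_shift_normalized) (auto simp: sum_distrib_left sum_divide_distrib)
    also have "\<dots> = (\<Sum>l\<le>k. D k (t + e) * (- e) ^ (k - l) / fact (k - l) * (u l / fact l))"
      by (intro sum.cong refl) (simp add: binomial_fact mult_ac)
    finally show "D k (t + e) * (esym J (\<lambda>j. y j - e) k / real (card J choose k)) / fact k =
        (\<Sum>l\<le>k. D k (t + e) * (- e) ^ (k - l) / fact (k - l) * (u l / fact l))" .
  qed simp
  also have "\<dots> = (\<Sum>l\<le>m. \<Sum>k\<in>{l..m}. D k (t + e) * (- e) ^ (k - l) / fact (k - l) * (u l / fact l))"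
    by (rule sum_atMost_triangle_swap)
  also have "\<dots> = (\<Sum>l\<le>m. (\<Sum>i\<le>m - l. D (l + i) (t + e) * (- e) ^ i / fact i) * (u l / fact l))"
  proof (rule sum.cong)
    fix l assume "l \<in> {..m}"
    then have "(\<Sum>k\<in>{l..m}. D k (t + e) * (- e) ^ (k - l) / fact (k - l) * (u l / fact l)) =
        (\<Sum>i\<in>{0..m - l}. D (l + i) (t + e) * (- e) ^ i / fact i * (u l / fact l))"
      using sum.shift_bounds_cl_nat_ivl[of "\<lambda>k. D k (t + e) * (- e) ^ (k - l) / fact (k - l) * (u l / fact l)" 0 l "m - l"]
      by (simp add: add.commute)
    then show "(\<Sum>k\<in>{l..m}. D k (t + e) * (- e) ^ (k - l) / fact (k - l) * (u l / fact l)) =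
        (\<Sum>i\<le>m - l. D (l + i) (t + e) * (- e) ^ i / fact i) * (u l / fact l)"
      unfolding sum_distrib_right atMost_atLeast0 .
  qed simp
  finally have eq: "(\<Sum>k\<le>m. D k (t + e) * (esym J (\<lambda>j. y j - e) k / real (card J choose k)) / fact k)
      - (\<Sum>l\<le>m. D l t * u l / fact l) =
      (\<Sum>l\<le>m. ((\<Sum>i\<le>m - l. D (l + i) (t + e) * (- e) ^ i / fact i) - D l t) * (u l / fact l))"
    by (simp add: sum_subtractf left_diff_distrib diff_divide_distrib)
  show ?thesis
    unfolding eq
  proof (intro order_trans[OF sum_abs] sum_mono)
    fix l assume l: "l \<in> {..m}"
    \<comment> \<open>Degree \<open>l\<close> has the derivatives \<open>D l\<close> to
      \<open>D m\<close> at its disposal, hence a Taylor remainder of order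
      \<open>Suc m - l\<close>. Together with \<open>u l\<close> every term has total degree
      \<open>Suc m\<close>.\<close>
    have "\<bar>D (l + 0) t - (\<Sum>i\<le>m - l. D (l + i) (t + e) * (t - (t + e)) ^ i / fact i)\<bar> \<le>
        L * \<bar>t - (t + e)\<bar> ^ Suc (m - l) / fact (Suc (m - l))"
      using l D L by (intro taylor_lipschitz) auto
    then have "\<bar>(\<Sum>i\<le>m - l. D (l + i) (t + e) * (- e) ^ i / fact i) - D l t\<bar> \<le>
        L * \<bar>e\<bar> ^ (Suc m - l) / fact (Suc m - l)"
      using l by (simp only: Suc_diff_le atMost_iff) (simp add: abs_minus_commute)
    then show "\<bar>((\<Sum>i\<le>m - l. D (l + i) (t + e) * (- e) ^ i / fact i) - D l t) * (u l / fact l)\<bar> \<le>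
        L * \<bar>e\<bar> ^ (Suc m - l) / fact (Suc m - l) * (\<bar>u l\<bar> / fact l)"
      unfolding abs_mult[of _ "u l / fact l"] abs_divide[of "u l"] by (simp only: abs_of_nonneg fact_ge_zero) (intro mult_right_mono, auto)
  qed
qed

lemma taylor_ustat_remainder_bound:
  fixes D :: "nat \<Rightarrow> real \<Rightarrow> real" and y :: "'i \<Rightarrow> real" and z :: "'b \<Rightarrow> complex"
  assumes J: "finite J" "card J = n" "1 \<le> n" "m \<le> n" and T: "finite T"
    and D: "\<And>i x. i < m \<Longrightarrow> (D i has_real_derivative D (Suc i) x) (at x)"
    and L: "\<And>x y. \<bar>D m x - D m y\<bar> \<le> L * \<bar>x - y\<bar>" "0 \<le> L"
    and q: "\<And>i. 0 \<le> q i"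
    and mom: "\<And>p. p \<le> m \<Longrightarrow> (\<Sum>i\<in>T. complex_of_real (q i) * z i ^ p) = (if p \<le> 1 then 1 else 0)"
    and ratio: "\<And>l. l \<le> m \<Longrightarrow> real n ^ l \<le> C * (fact l * real (n choose l))" and C: "0 \<le> C"
  shows "\<bar>(\<Sum>k\<le>m. D k (t + e) * (esym J (\<lambda>j. y j - e) k / real (n choose k)) / fact k)
      - (\<Sum>l\<le>m. D l t * (esym J y l / real (n choose l)) / fact l)\<bar>
    \<le> L * C / fact (Suc m) * (\<Sum>\<phi>\<in>J \<rightarrow>\<^sub>E T. (\<Prod>j\<in>J. q (\<phi> j)) *
          (\<bar>e\<bar> + cmod ((\<Sum>j\<in>J. z (\<phi> j) * y j) / real n)) ^ Suc m)"
proof -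
  let ?W = "\<lambda>\<phi>. \<Prod>j\<in>J. q (\<phi> j)" and ?Z = "\<lambda>\<phi>. cmod ((\<Sum>j\<in>J. z (\<phi> j) * y j) / real n)"
  let ?P = "J \<rightarrow>\<^sub>E T"
  have W: "0 \<le> ?W \<phi>" for \<phi> by (intro prod_nonneg q)
  have "\<bar>(\<Sum>k\<le>m. D k (t + e) * (esym J (\<lambda>j. y j - e) k / real (n choose k)) / fact k)
      - (\<Sum>l\<le>m. D l t * (esym J y l / real (n choose l)) / fact l)\<bar> \<le>
      (\<Sum>l\<le>m. L * \<bar>e\<bar> ^ (Suc m - l) / fact (Suc m - l) * (\<bar>esym J y l / real (n choose l)\<bar> / fact l))"
    using taylor_ustat_remainder[OF J(1) _ D L(1), where y = y and t = t and e = e] J by simp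
  also have "\<dots> \<le> (\<Sum>l\<le>m. L * \<bar>e\<bar> ^ (Suc m - l) / fact (Suc m - l) * (C * (\<Sum>\<phi>\<in>?P. ?W \<phi> * ?Z \<phi> ^ l) / fact l))"
    using L J q mom ratio T
    by (intro sum_mono mult_left_mono divide_right_mono polarization_bound[where s = m]) auto
  \<comment> \<open>The nonnegative term \<open>l = Suc m\<close> is added to complete the binomial
    sum. It is not the bound of any statistic, so moments of the weights up to order
    \<open>m\<close> suffice.\<close>
  also have "\<dots> \<le> (\<Sum>l\<le>Suc m. L * \<bar>e\<bar> ^ (Suc m - l) / fact (Suc m - l) * (C * (\<Sum>\<phi>\<in>?P. ?W \<phi> * ?Z \<phi> ^ l) / fact l))"
    using L C W by (intro sum_mono2) (auto intro!: mult_nonneg_nonneg divide_nonneg_nonneg sum_nonneg)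
  also have "\<dots> = (\<Sum>l\<le>Suc m. \<Sum>\<phi>\<in>?P. L * C / fact (Suc m) * (?W \<phi> *
      (real (Suc m choose l) * ?Z \<phi> ^ l * \<bar>e\<bar> ^ (Suc m - l))))"
    unfolding sum_distrib_left sum_divide_distrib
    by (intro sum.cong refl) (simp add: binomial_fact mult_ac del: fact_Suc)
  also have "\<dots> = (\<Sum>\<phi>\<in>?P. \<Sum>l\<le>Suc m. L * C / fact (Suc m) * (?W \<phi> *
      (real (Suc m choose l) * ?Z \<phi> ^ l * \<bar>e\<bar> ^ (Suc m - l))))"
    by (rule sum.swap)
  also have "\<dots> = L * C / fact (Suc m) * (\<Sum>\<phi>\<in>?P. ?W \<phi> * (?Z \<phi> + \<bar>e\<bar>) ^ Suc m)"
    by (simp only: binomial_ring sum_distrib_left)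
  finally show ?thesis by (simp only: add.commute)
qed

text \<open>A midpoint rule: by concavity \<open>ln k\<close> is at least the integral of
  \<open>ln\<close> over \<open>[k - 1/2, k + 1/2]\<close>, and these integrals add up to the one
  over \<open>[1/2, s + 1/2]\<close>, which is \<open>G s\<close> plus a positive constant. The
  factor \<open>sqrt s\<close> stems from the half in \<open>(s + 1/2) * ln s\<close>.\<close>

lemma fact_ge_stirling:
  fixes s :: nat
  assumes "0 < s"
  shows "sqrt (real s) * (real s / exp 1) ^ s \<le> fact s"
proof -
  define G where "G x = (x + 1 / 2) * ln (x + 1 / 2) - x" for x :: real
  \<comment> \<open>This compares \<open>ln c\<close> with the mean of \<open>ln\<close> over
    \<open>[c - h, c + h]\<close>, the integral being written out. The difference is nondecreasing
    in \<open>h\<close> since \<open>(c + x) * (c - x) \<le> c * c\<close>.\<close>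
  have midpoint: "(c + h) * ln (c + h) - (c - h) * ln (c - h) \<le> 2 * h * ln c + 2 * h" if "0 \<le> h" "h < c" for c h :: real
  proof -
    let ?f = "\<lambda>h. 2 * h * ln c + 2 * h - (c + h) * ln (c + h) + (c - h) * ln (c - h)"
    have "?f 0 \<le> ?f h"
    proof (rule DERIV_nonneg_imp_nondecreasing[OF \<open>0 \<le> h\<close>])
      fix x assume x: "0 \<le> x" "x \<le> h"
      then have pos: "0 < c + x" "0 < c - x" "0 < c" using that by auto
      have "(?f has_real_derivative 2 * ln c - ln (c + x) - ln (c - x)) (at x)"
      proof -
        have "((\<lambda>h. (c + h) * ln (c + h)) has_real_derivative ln (c + x) + 1) (at x)"
          "((\<lambda>h. (c - h) * ln (c - h)) has_real_derivative - ln (c - x) - 1) (at x)"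
          using pos by (auto intro!: derivative_eq_intros simp: divide_simps)
        then have "(?f has_real_derivative 2 * 1 * ln c + 2 * 1 - (ln (c + x) + 1) + (- ln (c - x) - 1)) (at x)"
          by (intro DERIV_add DERIV_diff) (auto intro!: derivative_eq_intros)
        then show ?thesis by (simp add: algebra_simps)
      qed
      moreover have "0 \<le> 2 * ln c - ln (c + x) - ln (c - x)"
      proof -
        have "ln ((c + x) * (c - x)) \<le> ln (c * c)"
          using pos by (intro ln_mono mult_pos_pos) (auto simp: algebra_simps)
        then show ?thesis using pos by (simp add: ln_mult)
      qed
      ultimately show "\<exists>d. (?f has_real_derivative d) (at x) \<and> 0 \<le> d" by blast
    qed
    then show ?thesis by simp
  qed
  have step: "G (real s) \<le> ln (fact s)" for s
  proof (induction s)
    case 0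
    have "G 0 \<le> 0" by (simp add: G_def ln_div)
    then show ?case by simp
  next
    case (Suc s)
    have "G (real (Suc s)) - G (real s) \<le> ln (real (Suc s))"
      using midpoint[of "1 / 2" "real s + 1"] by (simp add: G_def algebra_simps)
    also have "\<dots> = ln (fact (Suc s)) - ln (fact s)"
      by (simp add: ln_mult)
    finally show ?case using Suc by linarith
  qed
  have "sqrt (real s) * (real s / exp 1) ^ s = exp ((real s + 1 / 2) * ln (real s) - real s)"
  proof -
    have "exp ((real s + 1 / 2) * ln (real s) - real s) =
        exp (real s * ln (real s)) * exp (1 / 2 * ln (real s)) / exp (real s * 1)"
      by (simp add: exp_add exp_diff distrib_right)
    also have "\<dots> = real s ^ s * sqrt (real s) / exp 1 ^ s"
      using assms unfolding exp_of_nat_mult by (simp add: powr_half_sqrt[symmetric] powr_def)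
    finally show ?thesis by (simp add: power_divide)
  qed
  also have "\<dots> \<le> exp (G (real s))"
    using assms by (auto simp: G_def intro!: mult_left_mono)
  also have "\<dots> \<le> exp (ln (fact s))"
    using step[of s] by (simp only: exp_le_cancel_iff)
  finally show ?thesis by simp
qed

section \<open>Moments of weighted sums of independent variables\<close>

lemma sum_power2_expand:
  fixes f :: "'i \<Rightarrow> real"
  shows "(sum f A)\<^sup>2 = (\<Sum>i\<in>A. \<Sum>j\<in>A. f i * f j)"
  by (simp add: power2_eq_square sum_product)

text \<open>Midpoint convexity of the even power. The factor one half is kept so that two equal
  bounds later add up to \<open>2 ^ (2 * s)\<close> and no more.\<close>

lemma power_add_le_even:
  fixes a b :: real
  shows "(a + b) ^ (2 * s) \<le> 2 ^ (2 * s) / 2 * (a ^ (2 * s) + b ^ (2 * s))"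
proof -
  have "((1 - 1 / 2) *\<^sub>R a + (1 / 2) *\<^sub>R b) ^ (2 * s) \<le> (1 - 1 / 2) * a ^ (2 * s) + (1 / 2) * b ^ (2 * s)"
    by (intro convex_onD[OF convex_power_even]) auto
  also have "(1 - 1 / 2) *\<^sub>R a + (1 / 2) *\<^sub>R b = (a + b) / 2" by simp
  finally show ?thesis by (simp add: power_divide field_simps)
qed

text \<open>The tangent of the convex even power at \<open>a\<close> lies below its graph; after
  division by \<open>a ^ (2 * s)\<close> this is Bernoulli's inequality.\<close>

lemma power_add_ge_even:
  fixes a b :: real
  assumes "0 < s"
  shows "a ^ (2 * s) + 2 * real s * (a ^ (2 * s - 1) * b) \<le> (a + b) ^ (2 * s)"
proof (cases "a = 0")
  case False
  have "a ^ (2 * s) + 2 * real s * (a ^ (2 * s - 1) * b) = a ^ (2 * s) * (1 + real (2 * s) * (b / a))"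
    using False assms by (simp add: field_simps flip: power_Suc)
  also have "\<dots> \<le> a ^ (2 * s) * (1 + b / a) ^ (2 * s)"
    by (intro mult_left_mono Bernoulli_inequality_even) auto
  also have "\<dots> = (a + b) ^ (2 * s)"
    using False by (simp flip: power_mult_distrib add: distrib_left)
  finally show ?thesis .
next
  case True
  have "2 * s - 1 \<noteq> 0" "2 * s \<noteq> 0" using assms by linarith+
  then have "a ^ (2 * s) = 0" "a ^ (2 * s - 1) = 0" using True by (simp_all only: power_0_left if_False)
  then show ?thesis by (simp only: zero_le_even_power even_mult_iff even_numeral) simp
qed

lemma abs_power_le_one_plus:
  fixes a :: real
  assumes "k \<le> p"
  shows "\<bar>a\<bar> ^ k \<le> 1 + \<bar>a\<bar> ^ p"
proof (cases "\<bar>a\<bar> \<le> 1")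
  case True
  then have "\<bar>a\<bar> ^ k \<le> 1" by (intro power_le_one) auto
  then show ?thesis using zero_le_power[of "\<bar>a\<bar>" p] by linarith
next
  case False
  then have "\<bar>a\<bar> ^ k \<le> \<bar>a\<bar> ^ p" using assms by (intro power_increasing) auto
  then show ?thesis by linarith
qed

lemma (in prob_space) integrable_power_le:
  fixes X :: "'a \<Rightarrow> real"
  assumes [measurable]: "X \<in> borel_measurable M" and X: "integrable M (\<lambda>\<omega>. X \<omega> ^ (2 * s))" and k: "k \<le> 2 * s"
  shows "integrable M (\<lambda>\<omega>. X \<omega> ^ k)"
proof (rule Bochner_Integration.integrable_bound[of _ "\<lambda>\<omega>. 1 + X \<omega> ^ (2 * s)"])
  show "AE \<omega> in M. norm (X \<omega> ^ k) \<le> norm (1 + X \<omega> ^ (2 * s))"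
  proof (rule AE_I2)
    fix \<omega>
    have "\<bar>X \<omega>\<bar> ^ (2 * s) = X \<omega> ^ (2 * s)" by (simp add: power_mult)
    then show "norm (X \<omega> ^ k) \<le> norm (1 + X \<omega> ^ (2 * s))"
      using abs_power_le_one_plus[OF k, of "X \<omega>"] by (simp add: power_abs)
  qed
qed (use X in auto)

lemma integrable_power_add:
  fixes X Y :: "'a \<Rightarrow> real"
  assumes [measurable]: "X \<in> borel_measurable M" "Y \<in> borel_measurable M"
    and X: "integrable M (\<lambda>\<omega>. X \<omega> ^ (2 * s))" and Y: "integrable M (\<lambda>\<omega>. Y \<omega> ^ (2 * s))"
  shows "integrable M (\<lambda>\<omega>. (X \<omega> + Y \<omega>) ^ (2 * s))"
proof (rule Bochner_Integration.integrable_bound)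
  show "integrable M (\<lambda>\<omega>. 2 ^ (2 * s) / 2 * (X \<omega> ^ (2 * s) + Y \<omega> ^ (2 * s)))"
    using X Y by (intro integrable_mult_right Bochner_Integration.integrable_add)
  show "AE \<omega> in M. norm ((X \<omega> + Y \<omega>) ^ (2 * s)) \<le> norm (2 ^ (2 * s) / 2 * (X \<omega> ^ (2 * s) + Y \<omega> ^ (2 * s)))"
  proof (rule AE_I2)
    fix \<omega>
    have "0 \<le> (X \<omega> + Y \<omega>) ^ (2 * s)" by (simp add: zero_le_even_power)
    then show "norm ((X \<omega> + Y \<omega>) ^ (2 * s)) \<le> norm (2 ^ (2 * s) / 2 * (X \<omega> ^ (2 * s) + Y \<omega> ^ (2 * s)))"
      using power_add_le_even[of "X \<omega>" "Y \<omega>" s] by simp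
  qed
qed simp

lemma (in prob_space) integrable_power_sum:
  fixes X :: "'i \<Rightarrow> 'a \<Rightarrow> real"
  assumes "finite J" "0 < s" "\<And>j. j \<in> J \<Longrightarrow> X j \<in> borel_measurable M"
    and "\<And>j. j \<in> J \<Longrightarrow> integrable M (\<lambda>\<omega>. X j \<omega> ^ (2 * s))"
  shows "integrable M (\<lambda>\<omega>. (\<Sum>j\<in>J. X j \<omega>) ^ (2 * s))"
  using assms
proof (induction J)
  case (insert j J)
  have "integrable M (\<lambda>\<omega>. (X j \<omega> + (\<Sum>j\<in>J. X j \<omega>)) ^ (2 * s))"
    using insert.prems insert.IH by (intro integrable_power_add borel_measurable_sum) auto
  then show ?case using insert.hyps by simp
qed (simp add: power_0_left)

text \<open>Jensen's inequality conditionally on the indices in \<open>P\<close>, carried out with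
  the tangent line at the partial sum: the linear term has expectation zero because the remaining
  variables are centered and independent of that sum.\<close>

lemma (in prob_space) power_sum_mono_independent:
  fixes X :: "'i \<Rightarrow> 'a \<Rightarrow> real"
  assumes J: "finite J" "P \<subseteq> J" and s: "0 < s"
    and ind: "indep_vars (\<lambda>_. borel) X J"
    and int: "\<And>j. j \<in> J \<Longrightarrow> integrable M (\<lambda>\<omega>. X j \<omega> ^ (2 * s))"
    and mean: "\<And>j. j \<in> J \<Longrightarrow> expectation (X j) = 0"
  shows "expectation (\<lambda>\<omega>. (\<Sum>j\<in>P. X j \<omega>) ^ (2 * s)) \<le> expectation (\<lambda>\<omega>. (\<Sum>j\<in>J. X j \<omega>) ^ (2 * s))"
proof -
  have fP: "finite P" using J finite_subset by auto
  have X[measurable]: "X j \<in> borel_measurable M" if "j \<in> J" for j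
    using ind that by (auto simp: indep_vars_def)
  let ?Y = "\<lambda>\<omega>. \<Sum>j\<in>P. X j \<omega>"
  have Y[measurable]: "?Y \<in> borel_measurable M"
    using X J by (intro borel_measurable_sum) auto
  have intY: "integrable M (\<lambda>\<omega>. ?Y \<omega> ^ (2 * s))"
    using J fP s int by (intro integrable_power_sum) auto
  have intJ: "integrable M (\<lambda>\<omega>. (\<Sum>j\<in>J. X j \<omega>) ^ (2 * s))"
    using J s int by (intro integrable_power_sum) auto
  have cross: "integrable M (\<lambda>\<omega>. ?Y \<omega> ^ (2 * s - 1) * X j \<omega>) \<and> expectation (\<lambda>\<omega>. ?Y \<omega> ^ (2 * s - 1) * X j \<omega>) = 0"
    if j: "j \<in> J - P" for j
  proof -
    have "indep_var borel (X j) borel ?Y"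
      using j J by (intro indep_vars_sum fP indep_vars_subset[OF ind]) auto
    then have "indep_var borel ((\<lambda>x. x) \<circ> X j) borel ((\<lambda>y. y ^ (2 * s - 1)) \<circ> ?Y)"
      by (rule indep_var_compose) auto
    then have iv: "indep_var borel (X j) borel (\<lambda>\<omega>. ?Y \<omega> ^ (2 * s - 1))"
      by (simp add: comp_def)
    have i1: "integrable M (X j)"
      using integrable_power_le[of "X j" s 1] j int s by simp
    have i2: "integrable M (\<lambda>\<omega>. ?Y \<omega> ^ (2 * s - 1))"
      by (rule integrable_power_le[OF Y intY]) simp
    show ?thesis
      using indep_var_lebesgue_integral[OF iv i1 i2] indep_var_integrable[OF iv i1 i2] mean[of j] j
      by (simp add: mult.commute)
  qed
  have "expectation (\<lambda>\<omega>. ?Y \<omega> ^ (2 * s)) =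
      expectation (\<lambda>\<omega>. ?Y \<omega> ^ (2 * s) + 2 * real s * (\<Sum>j\<in>J - P. ?Y \<omega> ^ (2 * s - 1) * X j \<omega>))"
  proof -
    have "expectation (\<lambda>\<omega>. \<Sum>j\<in>J - P. ?Y \<omega> ^ (2 * s - 1) * X j \<omega>) = 0"
      using cross by (subst Bochner_Integration.integral_sum) simp_all
    moreover have "integrable M (\<lambda>\<omega>. \<Sum>j\<in>J - P. ?Y \<omega> ^ (2 * s - 1) * X j \<omega>)"
      using cross by (intro Bochner_Integration.integrable_sum) blast
    ultimately show ?thesis
      by (subst Bochner_Integration.integral_add) (simp_all only: intY integral_mult_right_zero
        integrable_mult_right mult_zero_right add_0_right)
  qed
  also have "\<dots> \<le> expectation (\<lambda>\<omega>. (\<Sum>j\<in>J. X j \<omega>) ^ (2 * s))"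
  proof (rule integral_mono)
    fix \<omega>
    have "(\<Sum>j\<in>J. X j \<omega>) = ?Y \<omega> + (\<Sum>j\<in>J - P. X j \<omega>)"
      using sum.subset_diff[OF J(2,1)] by (simp add: add.commute)
    then show "?Y \<omega> ^ (2 * s) + 2 * real s * (\<Sum>j\<in>J - P. ?Y \<omega> ^ (2 * s - 1) * X j \<omega>) \<le> (\<Sum>j\<in>J. X j \<omega>) ^ (2 * s)"
      using power_add_ge_even[OF s, of "?Y \<omega>" "\<Sum>j\<in>J - P. X j \<omega>"] by (simp add: sum_distrib_left)
  next
    show "integrable M (\<lambda>\<omega>. ?Y \<omega> ^ (2 * s) + 2 * real s * (\<Sum>j\<in>J - P. ?Y \<omega> ^ (2 * s - 1) * X j \<omega>))"
      using cross by (intro Bochner_Integration.integrable_add intY integrable_mult_right Bochner_Integration.integrable_sum) blast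
  qed (rule intJ)
  finally show ?thesis .
qed

text \<open>The signed sum is the difference of the sums over the indices with sign 1 and with sign
  -1. Convexity separates these, and each of them is dominated by the full sum.\<close>

lemma (in prob_space) power_sum_signs_le:
  fixes X :: "'i \<Rightarrow> 'a \<Rightarrow> real"
  assumes J: "finite J" and s: "0 < s"
    and ind: "indep_vars (\<lambda>_. borel) X J"
    and int: "\<And>j. j \<in> J \<Longrightarrow> integrable M (\<lambda>\<omega>. X j \<omega> ^ (2 * s))"
    and mean: "\<And>j. j \<in> J \<Longrightarrow> expectation (X j) = 0"
    and r: "\<And>j. j \<in> J \<Longrightarrow> r j \<in> {1, -1}"
  shows "expectation (\<lambda>\<omega>. (\<Sum>j\<in>J. r j * X j \<omega>) ^ (2 * s)) \<le> 2 ^ (2 * s) * expectation (\<lambda>\<omega>. (\<Sum>j\<in>J. X j \<omega>) ^ (2 * s))"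
proof -
  let ?E = "expectation (\<lambda>\<omega>. (\<Sum>j\<in>J. X j \<omega>) ^ (2 * s))"
  define P where "P = {j\<in>J. r j = 1}"
  define Q where "Q = {j\<in>J. r j \<noteq> 1}"
  have sub: "P \<subseteq> J" "Q \<subseteq> J" by (auto simp: P_def Q_def)
  then have fin: "finite P" "finite Q" using J finite_subset by auto
  have X[measurable]: "X j \<in> borel_measurable M" if "j \<in> J" for j
    using ind that by (auto simp: indep_vars_def)
  have [measurable]: "(\<lambda>\<omega>. \<Sum>j\<in>P. X j \<omega>) \<in> borel_measurable M" "(\<lambda>\<omega>. \<Sum>j\<in>Q. X j \<omega>) \<in> borel_measurable M"
    using sub X by (auto intro!: borel_measurable_sum)
  have ints: "integrable M (\<lambda>\<omega>. (\<Sum>j\<in>P. X j \<omega>) ^ (2 * s))" "integrable M (\<lambda>\<omega>. (\<Sum>j\<in>Q. X j \<omega>) ^ (2 * s))"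
    using sub fin s int by (auto intro!: integrable_power_sum)
  have split: "(\<Sum>j\<in>J. r j * X j \<omega>) = (\<Sum>j\<in>P. X j \<omega>) + - (\<Sum>j\<in>Q. X j \<omega>)" for \<omega>
  proof -
    have "J = P \<union> Q" "P \<inter> Q = {}" by (auto simp: P_def Q_def)
    then have "(\<Sum>j\<in>J. r j * X j \<omega>) = (\<Sum>j\<in>P. r j * X j \<omega>) + (\<Sum>j\<in>Q. r j * X j \<omega>)"
      using fin by (simp add: sum.union_disjoint)
    also have "(\<Sum>j\<in>P. r j * X j \<omega>) = (\<Sum>j\<in>P. X j \<omega>)"
      by (intro sum.cong) (auto simp: P_def)
    also have "(\<Sum>j\<in>Q. r j * X j \<omega>) = (\<Sum>j\<in>Q. - X j \<omega>)"
      using r by (intro sum.cong) (fastforce simp: Q_def)+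
    finally show ?thesis by (simp add: sum_negf)
  qed
  have "expectation (\<lambda>\<omega>. (\<Sum>j\<in>J. r j * X j \<omega>) ^ (2 * s)) \<le>
      expectation (\<lambda>\<omega>. 2 ^ (2 * s) / 2 * ((\<Sum>j\<in>P. X j \<omega>) ^ (2 * s) + (\<Sum>j\<in>Q. X j \<omega>) ^ (2 * s)))"
  proof (rule integral_mono')
    show "integrable M (\<lambda>\<omega>. 2 ^ (2 * s) / 2 * ((\<Sum>j\<in>P. X j \<omega>) ^ (2 * s) + (\<Sum>j\<in>Q. X j \<omega>) ^ (2 * s)))"
      using ints by auto
  next
    fix \<omega>
    show "(\<Sum>j\<in>J. r j * X j \<omega>) ^ (2 * s) \<le> 2 ^ (2 * s) / 2 * ((\<Sum>j\<in>P. X j \<omega>) ^ (2 * s) + (\<Sum>j\<in>Q. X j \<omega>) ^ (2 * s))"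
      unfolding split using power_add_le_even[of "\<Sum>j\<in>P. X j \<omega>" "- (\<Sum>j\<in>Q. X j \<omega>)" s] by simp
    show "0 \<le> 2 ^ (2 * s) / 2 * ((\<Sum>j\<in>P. X j \<omega>) ^ (2 * s) + (\<Sum>j\<in>Q. X j \<omega>) ^ (2 * s))"
      by (simp add: zero_le_even_power)
  qed
  also have "\<dots> = 2 ^ (2 * s) / 2 * (expectation (\<lambda>\<omega>. (\<Sum>j\<in>P. X j \<omega>) ^ (2 * s)) + expectation (\<lambda>\<omega>. (\<Sum>j\<in>Q. X j \<omega>) ^ (2 * s)))"
    using ints by simp
  also have "\<dots> \<le> 2 ^ (2 * s) / 2 * (?E + ?E)"
    using assms sub by (intro mult_left_mono add_mono power_sum_mono_independent) auto
  finally show ?thesis by simp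
qed

text \<open>
  The left-hand side is convex in each coefficient, hence maximal at coefficients \<open>\<plusminus>1\<close>.
\<close>

lemma (in prob_space) power_sum_contraction:
  fixes X :: "'i \<Rightarrow> 'a \<Rightarrow> real"
  assumes J: "finite J" and s: "0 < s"
    and X[measurable]: "\<And>j. j \<in> J \<Longrightarrow> X j \<in> borel_measurable M"
    and int: "\<And>j. j \<in> J \<Longrightarrow> integrable M (\<lambda>\<omega>. X j \<omega> ^ (2 * s))"
    and signs: "\<And>r. (\<And>j. j \<in> J \<Longrightarrow> r j \<in> {1, -1}) \<Longrightarrow> expectation (\<lambda>\<omega>. (\<Sum>j\<in>J. r j * X j \<omega>) ^ (2 * s)) \<le> B"
    and a: "\<And>j. j \<in> J \<Longrightarrow> \<bar>a j\<bar> \<le> 1"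
  shows "expectation (\<lambda>\<omega>. (\<Sum>j\<in>J. a j * X j \<omega>) ^ (2 * s)) \<le> B"
proof -
  have intc: "integrable M (\<lambda>\<omega>. (\<Sum>j\<in>J. b j * X j \<omega>) ^ (2 * s))" for b
    using J s int by (intro integrable_power_sum) (auto simp: power_mult_distrib)
  \<comment> \<open>\<open>K\<close> holds the indices whose coefficient need not be a sign yet; the
    induction replaces them one at a time.\<close>
  have "expectation (\<lambda>\<omega>. (\<Sum>j\<in>J. b j * X j \<omega>) ^ (2 * s)) \<le> B"
    if "K \<subseteq> J" "\<And>j. j \<in> K \<Longrightarrow> \<bar>b j\<bar> \<le> 1" "\<And>j. j \<in> J - K \<Longrightarrow> b j \<in> {1, -1}" for K b
    using finite_subset[OF that(1) J] that
  proof (induction K arbitrary: b)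
    case empty
    then show ?case by (intro signs) auto
  next
    case (insert i K)
    let ?b1 = "b(i := 1)" and ?b2 = "b(i := - 1)"
    \<comment> \<open>The parameter for which \<open>b i = (1 - t) * 1 + t * (- 1)\<close>.\<close>
    define t where "t = (1 - b i) / 2"
    have t: "0 \<le> t" "t \<le> 1" using insert.prems(2)[of i] by (auto simp: t_def abs_le_iff)
    have IH: "expectation (\<lambda>\<omega>. (\<Sum>j\<in>J. ?b1 j * X j \<omega>) ^ (2 * s)) \<le> B"
      "expectation (\<lambda>\<omega>. (\<Sum>j\<in>J. ?b2 j * X j \<omega>) ^ (2 * s)) \<le> B"
      using insert.prems insert.hyps by (intro insert.IH; auto)+
    have bt: "b j = (1 - t) * ?b1 j + t * ?b2 j" for j
      by (simp add: t_def field_simps)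
    have comb: "(\<Sum>j\<in>J. b j * X j \<omega>) = (1 - t) *\<^sub>R (\<Sum>j\<in>J. ?b1 j * X j \<omega>) + t *\<^sub>R (\<Sum>j\<in>J. ?b2 j * X j \<omega>)" for \<omega>
      by (subst bt) (simp add: sum_distrib_left sum.distrib[symmetric] distrib_right mult.assoc del: fun_upd_apply)
    have "expectation (\<lambda>\<omega>. (\<Sum>j\<in>J. b j * X j \<omega>) ^ (2 * s)) \<le>
        expectation (\<lambda>\<omega>. (1 - t) * (\<Sum>j\<in>J. ?b1 j * X j \<omega>) ^ (2 * s) + t * (\<Sum>j\<in>J. ?b2 j * X j \<omega>) ^ (2 * s))"
    proof (rule integral_mono)
      show "integrable M (\<lambda>\<omega>. (1 - t) * (\<Sum>j\<in>J. ?b1 j * X j \<omega>) ^ (2 * s) + t * (\<Sum>j\<in>J. ?b2 j * X j \<omega>) ^ (2 * s))"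
        by (intro Bochner_Integration.integrable_add integrable_mult_right intc)
      show "(\<Sum>j\<in>J. b j * X j \<omega>) ^ (2 * s) \<le>
          (1 - t) * (\<Sum>j\<in>J. ?b1 j * X j \<omega>) ^ (2 * s) + t * (\<Sum>j\<in>J. ?b2 j * X j \<omega>) ^ (2 * s)" for \<omega>
        unfolding comb using t by (intro convex_onD[OF convex_power_even]) auto
    qed (rule intc)
    also have "\<dots> = (1 - t) * expectation (\<lambda>\<omega>. (\<Sum>j\<in>J. ?b1 j * X j \<omega>) ^ (2 * s)) +
        t * expectation (\<lambda>\<omega>. (\<Sum>j\<in>J. ?b2 j * X j \<omega>) ^ (2 * s))"
      using intc by (simp del: fun_upd_apply)
    also have "\<dots> \<le> (1 - t) * B + t * B"
      using t IH by (intro add_mono mult_left_mono) auto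
    finally show ?case by (simp add: algebra_simps)
  qed
  from this[of J a] show ?thesis using a by simp
qed

text \<open>After division by \<open>A\<close>, contraction reduces the coefficients to signs. The
  comparison is with one fixed pattern \<open>r\<close>, because the Rademacher moment yields one
  good pattern; passing from \<open>r\<close> to any other pattern costs the factor
  \<open>2 ^ (2 * s)\<close>.\<close>

lemma (in prob_space) power_sum_coefficients_le:
  fixes X :: "'i \<Rightarrow> 'a \<Rightarrow> real"
  assumes J: "finite J" and s: "0 < s"
    and ind: "indep_vars (\<lambda>_. borel) X J"
    and int: "\<And>j. j \<in> J \<Longrightarrow> integrable M (\<lambda>\<omega>. X j \<omega> ^ (2 * s))"
    and mean: "\<And>j. j \<in> J \<Longrightarrow> expectation (X j) = 0"
    and r: "\<And>j. j \<in> J \<Longrightarrow> r j \<in> {1, -1}"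
    and a: "\<And>j. j \<in> J \<Longrightarrow> \<bar>a j\<bar> \<le> A" and A: "0 < A"
  shows "expectation (\<lambda>\<omega>. (\<Sum>j\<in>J. a j * X j \<omega>) ^ (2 * s)) \<le>
    (2 * A) ^ (2 * s) * expectation (\<lambda>\<omega>. (\<Sum>j\<in>J. r j * X j \<omega>) ^ (2 * s))"
proof -
  let ?B = "2 ^ (2 * s) * expectation (\<lambda>\<omega>. (\<Sum>j\<in>J. r j * X j \<omega>) ^ (2 * s))"
  have X[measurable]: "X j \<in> borel_measurable M" if "j \<in> J" for j
    using ind that by (auto simp: indep_vars_def)
  have ind': "indep_vars (\<lambda>_. borel) (\<lambda>j \<omega>. r j * X j \<omega>) J"
    by (rule indep_vars_compose2[OF ind]) auto
  have "expectation (\<lambda>\<omega>. (\<Sum>j\<in>J. a j / A * X j \<omega>) ^ (2 * s)) \<le> ?B"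
  proof (rule power_sum_contraction[OF J s X int])
    fix r' :: "'i \<Rightarrow> real" assume r': "\<And>j. j \<in> J \<Longrightarrow> r' j \<in> {1, -1}"
    \<comment> \<open>The variables \<open>r j * X j\<close> are again independent and centered, and
      relative to them the pattern \<open>r'\<close> becomes \<open>r' j * r j\<close>, because
      \<open>r j\<close> squares to 1.\<close>
    have "expectation (\<lambda>\<omega>. (\<Sum>j\<in>J. (r' j * r j) * (r j * X j \<omega>)) ^ (2 * s)) \<le> ?B"
    proof (rule power_sum_signs_le[OF J s ind'])
      fix j assume j: "j \<in> J"
      show "integrable M (\<lambda>\<omega>. (r j * X j \<omega>) ^ (2 * s))"
        using int[OF j] by (simp add: power_mult_distrib)
      show "expectation (\<lambda>\<omega>. r j * X j \<omega>) = 0"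
        using mean[OF j] by simp
      show "r' j * r j \<in> {1, -1}" using r[OF j] r'[OF j] by auto
    qed
    also have "(\<lambda>\<omega>. (\<Sum>j\<in>J. (r' j * r j) * (r j * X j \<omega>)) ^ (2 * s)) = (\<lambda>\<omega>. (\<Sum>j\<in>J. r' j * X j \<omega>) ^ (2 * s))"
    proof (intro ext arg_cong[where f = "\<lambda>x. x ^ (2 * s)"] sum.cong refl)
      fix j \<omega> assume "j \<in> J"
      then show "(r' j * r j) * (r j * X j \<omega>) = r' j * X j \<omega>" using r[of j] by auto
    qed
    finally show "expectation (\<lambda>\<omega>. (\<Sum>j\<in>J. r' j * X j \<omega>) ^ (2 * s)) \<le> ?B" .
  qed (use a A in auto)
  moreover have "(\<Sum>j\<in>J. a j * X j \<omega>) ^ (2 * s) = A ^ (2 * s) * (\<Sum>j\<in>J. a j / A * X j \<omega>) ^ (2 * s)" for \<omega>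
    using A by (simp add: sum_distrib_left flip: power_mult_distrib)
  ultimately show ?thesis
    using A by (simp add: power_mult_distrib mult.assoc mult.left_commute)
qed

section \<open>Rademacher averages and orthogonality\<close>

lemma borel_measurable_vec_component [measurable]:
  "(\<lambda>v :: real ^ 'd. v $ a) \<in> borel_measurable borel"
  by (intro borel_measurable_continuous_onI continuous_intros)

text \<open>Independence is given between \<open>\<sigma>\<close>-algebras, while the product
  formula is about random variables; the \<open>\<sigma>\<close>-algebra of the indicator is
  generated by \<open>A\<close> alone. Nonnegative integrals are used because integrability of the
  powers of the noise is still to be derived.\<close>

lemma (in prob_space) indep_nn_integral_indicator:
  assumes ind: "indep_set \<A> (sets (vimage_algebra (space M) V N))"
    and A: "A \<in> \<A>" and V: "V \<in> space M \<rightarrow> space N" and f[measurable]: "f \<in> borel_measurable N"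
  shows "(\<integral>\<^sup>+\<omega>. indicator A \<omega> * f (V \<omega>) \<partial>M) = emeasure M A * (\<integral>\<^sup>+\<omega>. f (V \<omega>) \<partial>M)"
proof -
  let ?G = "vimage_algebra (space M) V N"
  have Aev: "A \<in> events" and G: "sets ?G \<subseteq> events"
    using ind A by (auto simp: indep_sets2_eq)
  have VG: "V \<in> measurable ?G N"
    using V by (rule measurable_vimage_algebra1)
  have fG: "(\<lambda>\<omega>. f (V \<omega>)) \<in> borel_measurable ?G"
    using measurable_compose[OF VG f] .
  have fM: "(\<lambda>\<omega>. f (V \<omega>)) \<in> borel_measurable M"
    using fG G unfolding measurable_def by (auto simp: space_vimage_algebra)
  have "indep_var borel (indicator A :: 'a \<Rightarrow> ennreal) borel (\<lambda>\<omega>. f (V \<omega>))"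
    unfolding indep_var_eq
  proof (intro conjI)
    show "indicator A \<in> borel_measurable M" using Aev by simp
    show "(\<lambda>\<omega>. f (V \<omega>)) \<in> borel_measurable M" by (rule fM)
    let ?I = "{indicator A -` B \<inter> space M |B. B \<in> sets (borel :: ennreal measure)}"
    let ?F = "{(\<lambda>\<omega>. f (V \<omega>)) -` B \<inter> space M |B. B \<in> sets borel}"
    have indA: "indep_set {A} (sets ?G)"
      using ind A by (auto simp: indep_sets2_eq)
    have "indep_set (sigma_sets (space M) {A}) (sigma_sets (space M) (sets ?G))"
    proof (rule indep_set_sigma_sets[OF indA])
      show "Int_stable {A}" by (auto simp: Int_stable_def)
      show "Int_stable (sets ?G)" by (auto simp: Int_stable_def)
    qed
    moreover have "sigma_sets (space M) ?I \<subseteq> sigma_sets (space M) {A}"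
    proof (rule sigma_sets_mono, clarify)
      fix B :: "ennreal set" assume "B \<in> sets borel"
      have "indicator A -` B \<inter> space M = (if 1 \<in> B then A else {}) \<union> (if 0 \<in> B then space M - A else {})"
      proof (rule set_eqI)
        fix x show "x \<in> indicator A -` B \<inter> space M \<longleftrightarrow>
            x \<in> (if 1 \<in> B then A else {}) \<union> (if 0 \<in> B then space M - A else {})"
          using sets.sets_into_space[OF Aev] by (cases "x \<in> A") auto
      qed
      moreover have "A \<union> (space M - A) = space M" "space M \<in> sigma_sets (space M) {A}"
        using sets.sets_into_space[OF Aev] by (auto intro: sigma_sets_top)
      ultimately show "indicator A -` B \<inter> space M \<in> sigma_sets (space M) {A}"
        by (auto intro: sigma_sets.Empty sigma_sets.Basic sigma_sets.Compl)
    qed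
    moreover have "sigma_sets (space M) ?F \<subseteq> sigma_sets (space M) (sets ?G)"
      using fG by (intro sigma_sets_mono) (auto simp: measurable_def space_vimage_algebra intro!: sigma_sets.Basic)
    ultimately show "indep_set (sigma_sets (space M) ?I) (sigma_sets (space M) ?F)"
      unfolding indep_sets2_eq by (meson subset_iff)
  qed
  \<comment> \<open>\<open>indep_var\<close> indexes the target spaces by booleans as well; both are
    \<open>borel\<close> here, so that family is constant.\<close>
  then have iv: "indep_vars (\<lambda>_. borel) (case_bool (indicator A) (\<lambda>\<omega>. f (V \<omega>))) UNIV"
    unfolding indep_var_def by (rule back_subst[of "\<lambda>N. indep_vars N _ _"]) (auto split: bool.split)
  show ?thesis
    using indep_vars_nn_integral[OF _ iv] Aev by (simp add: UNIV_bool mult.commute)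
qed

text \<open>On the event that the signs equal \<open>r\<close>, of probability
  \<open>(1 / 2) ^ card J\<close>, they may be frozen, and by independence the noise keeps its law
  there. Outside these disjoint events the integrand built from them is 0, so a pointwise inequality
  replaces an argument almost everywhere and measurability of \<open>g\<close> is asked for each
  fixed \<open>r\<close> only.\<close>

lemma (in prob_space) rademacher_average_le:
  fixes Y :: "nat \<Rightarrow> 'a \<Rightarrow> real ^ 'd" and g :: "(nat \<Rightarrow> real) \<Rightarrow> (nat \<Rightarrow> real ^ 'd) \<Rightarrow> ennreal"
  assumes J: "finite J" "J \<noteq> {}" and rad: "rademacher M e J" and ind: "indep_families M J e Y"
    and g: "\<And>r. g r \<in> borel_measurable (PiM J (\<lambda>_. borel))"
  shows "(\<Sum>r\<in>J \<rightarrow>\<^sub>E {1, -1}. ennreal ((1 / 2) ^ card J) * (\<integral>\<^sup>+\<omega>. g r (\<lambda>j\<in>J. Y j \<omega>) \<partial>M))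
    \<le> (\<integral>\<^sup>+\<omega>. g (\<lambda>j\<in>J. e j \<omega>) (\<lambda>j\<in>J. Y j \<omega>) \<partial>M)"
proof -
  let ?R = "J \<rightarrow>\<^sub>E {1, -1 :: real}"
  let ?eV = "\<lambda>\<omega>. \<lambda>j\<in>J. e j \<omega>" and ?V = "\<lambda>\<omega>. \<lambda>j\<in>J. Y j \<omega>"
  define E where "E r = ?eV -` (PiE J (\<lambda>j. {r j})) \<inter> space M" for r
  have V: "?V \<in> space M \<rightarrow> space (PiM J (\<lambda>_. borel))" by (auto simp: space_PiM)
  have eV: "?eV \<in> space M \<rightarrow> space (PiM J (\<lambda>_. borel))" by (auto simp: space_PiM)
  have E: "E r \<in> sets (vimage_algebra (space M) ?eV (PiM J (\<lambda>_. borel)))" for r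
    unfolding E_def using J by (intro in_vimage_algebra sets_PiM_I_finite) auto
  have indE: "indep_set (sets (vimage_algebra (space M) ?eV (PiM J (\<lambda>_. borel))))
      (sets (vimage_algebra (space M) ?V (PiM J (\<lambda>_. borel))))"
    using ind by (simp add: indep_families_def)
  then have Eev: "E r \<in> events" for r
    using E by (auto simp: indep_sets2_eq)
  have VG: "?V \<in> measurable M (PiM J (\<lambda>_. borel))"
  proof -
    have "sets (vimage_algebra (space M) ?V (PiM J (\<lambda>_. borel))) \<subseteq> events"
      using indE by (auto simp: indep_sets2_eq)
    then show ?thesis
      using measurable_vimage_algebra1[OF V] unfolding measurable_def by (auto simp: space_vimage_algebra)
  qed
  have gm[measurable]: "(\<lambda>\<omega>. g r (?V \<omega>)) \<in> borel_measurable M" for r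
    using measurable_compose[OF VG g] .
  have prob: "emeasure M (E r) = ennreal ((1 / 2) ^ card J)" if r: "r \<in> ?R" for r
  proof -
    have "E r = (\<Inter>j\<in>J. e j -` {r j} \<inter> space M)"
      using J unfolding E_def by (auto simp: PiE_iff)
    moreover have "prob (\<Inter>j\<in>J. e j -` {r j} \<inter> space M) = (\<Prod>j\<in>J. prob (e j -` {r j} \<inter> space M))"
      using rad J by (intro indep_varsD_finite[where M' = "\<lambda>_. borel"]) (auto simp: rademacher_def)
    moreover have "prob (e j -` {r j} \<inter> space M) = 1 / 2" if "j \<in> J" for j
    proof -
      have "e j -` {c} \<inter> space M = {\<omega> \<in> space M. e j \<omega> = c}" for c by auto
      then show ?thesis using rad r that by (auto simp: rademacher_def PiE_iff)
    qed
    ultimately show ?thesis by (simp add: emeasure_eq_measure)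
  qed
  have "(\<Sum>r\<in>?R. ennreal ((1 / 2) ^ card J) * (\<integral>\<^sup>+\<omega>. g r (?V \<omega>) \<partial>M)) =
      (\<Sum>r\<in>?R. \<integral>\<^sup>+\<omega>. indicator (E r) \<omega> * g r (?V \<omega>) \<partial>M)"
  proof (rule sum.cong)
    fix r assume r: "r \<in> ?R"
    show "ennreal ((1 / 2) ^ card J) * (\<integral>\<^sup>+\<omega>. g r (?V \<omega>) \<partial>M) = (\<integral>\<^sup>+\<omega>. indicator (E r) \<omega> * g r (?V \<omega>) \<partial>M)"
      unfolding prob[OF r, symmetric] by (rule indep_nn_integral_indicator[OF indE E V g, symmetric])
  qed simp
  also have "\<dots> = (\<integral>\<^sup>+\<omega>. (\<Sum>r\<in>?R. indicator (E r) \<omega> * g r (?V \<omega>)) \<partial>M)"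
    by (rule nn_integral_sum[symmetric]) (intro borel_measurable_times_ennreal borel_measurable_indicator Eev gm)
  also have "\<dots> \<le> (\<integral>\<^sup>+\<omega>. g (?eV \<omega>) (?V \<omega>) \<partial>M)"
  proof (rule nn_integral_mono)
    fix \<omega> assume "\<omega> \<in> space M"
    have uniq: "r = ?eV \<omega>" if "r \<in> ?R" "\<omega> \<in> E r" for r
    proof
      fix j show "r j = ?eV \<omega> j"
        using that by (cases "j \<in> J") (auto simp: E_def PiE_iff extensional_def)
    qed
    have "(\<Sum>r\<in>?R. indicator (E r) \<omega> * g r (?V \<omega>)) \<le> (\<Sum>r\<in>?R. if r = ?eV \<omega> then g r (?V \<omega>) else 0)"
    proof (rule sum_mono)
      fix r assume "r \<in> ?R"
      show "indicator (E r) \<omega> * g r (?V \<omega>) \<le> (if r = ?eV \<omega> then g r (?V \<omega>) else 0)"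
      proof (cases "\<omega> \<in> E r")
        case True
        show ?thesis
          unfolding if_P[OF uniq[OF \<open>r \<in> ?R\<close> True]] using True by simp
      qed simp
    qed
    also have "\<dots> \<le> g (?eV \<omega>) (?V \<omega>)"
      using J by (subst sum.delta) (auto intro: finite_PiE)
    finally show "(\<Sum>r\<in>?R. indicator (E r) \<omega> * g r (?V \<omega>)) \<le> g (?eV \<omega>) (?V \<omega>)" .
  qed
  finally show ?thesis .
qed

text \<open>\<open>B\<close> bounds the uniform average over finitely many sign patterns. Each
  pattern has positive weight, so its moment is finite, and the smallest moment is at most the
  average.\<close>

lemma (in prob_space) rademacher_moment_signs:
  fixes Y :: "nat \<Rightarrow> 'a \<Rightarrow> real ^ 'd"
  assumes J: "finite J" "J \<noteq> {}" and rad: "rademacher M e J" and ind: "indep_families M J e Y"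
    and Y[measurable]: "\<And>j. j \<in> J \<Longrightarrow> Y j \<in> borel_measurable M" and c: "0 < c"
    and B: "(\<integral>\<^sup>+\<omega>. ennreal (\<bar>c * (\<Sum>j\<in>J. e j \<omega> * Y j \<omega> $ a)\<bar> ^ (2 * k)) \<partial>M) \<le> ennreal B" "0 \<le> B"
  shows "r \<in> J \<rightarrow>\<^sub>E {1, -1} \<Longrightarrow> integrable M (\<lambda>\<omega>. (\<Sum>j\<in>J. r j * Y j \<omega> $ a) ^ (2 * k))"
    and "\<exists>r. (\<forall>j\<in>J. r j \<in> {1, -1}) \<and> c ^ (2 * k) * expectation (\<lambda>\<omega>. (\<Sum>j\<in>J. r j * Y j \<omega> $ a) ^ (2 * k)) \<le> B"
proof -
  let ?R = "J \<rightarrow>\<^sub>E {1, -1 :: real}"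
  define p :: real where "p = (1 / 2) ^ card J"
  have p: "0 < p" by (simp add: p_def)
  let ?S = "\<lambda>r \<omega>. \<Sum>j\<in>J. r j * Y j \<omega> $ a"
  define g :: "(nat \<Rightarrow> real) \<Rightarrow> (nat \<Rightarrow> real ^ 'd) \<Rightarrow> ennreal" where
    "g r v = ennreal (\<bar>c * (\<Sum>j\<in>J. r j * v j $ a)\<bar> ^ (2 * k))" for r v
  have finR: "finite ?R" using J by (intro finite_PiE) auto
  have cardR: "real (card ?R) * p = 1"
    using J by (simp add: card_PiE p_def power_divide)
  have gm: "g r \<in> borel_measurable (PiM J (\<lambda>_. borel))" for r
  proof -
    have "(\<lambda>v. v j $ a) \<in> borel_measurable (PiM J (\<lambda>_. borel :: (real ^ 'd) measure))" if "j \<in> J" for j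
      using that by (intro measurable_compose[OF _ borel_measurable_vec_component, of "\<lambda>v. v j"]) simp
    then show ?thesis
      unfolding g_def[abs_def] by measurable
  qed
  have geq: "g (\<lambda>j\<in>J. e j \<omega>) (\<lambda>j\<in>J. Y j \<omega>) = ennreal (\<bar>c * (\<Sum>j\<in>J. e j \<omega> * Y j \<omega> $ a)\<bar> ^ (2 * k))"
    "g r (\<lambda>j\<in>J. Y j \<omega>) = ennreal (c ^ (2 * k) * ?S r \<omega> ^ (2 * k))" for \<omega> r
    by (simp_all add: g_def power_mult power_mult_distrib)
  have sum_le: "(\<Sum>r\<in>?R. ennreal p * (\<integral>\<^sup>+\<omega>. ennreal (c ^ (2 * k) * ?S r \<omega> ^ (2 * k)) \<partial>M)) \<le> ennreal B"
    using order_trans[OF rademacher_average_le[of J e Y g, OF J rad ind gm] B(1)[folded geq(1)]]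
    unfolding geq(2) p_def[symmetric] .
  have Sm[measurable]: "?S r \<in> borel_measurable M" for r
    by measurable
  have nonneg: "0 \<le> ?S r \<omega> ^ (2 * k)" for r \<omega> by (simp add: zero_le_even_power)
  have fin: "integrable M (\<lambda>\<omega>. ?S r \<omega> ^ (2 * k))" if "r \<in> ?R" for r
  proof -
    have "ennreal p * (\<integral>\<^sup>+\<omega>. ennreal (c ^ (2 * k) * ?S r \<omega> ^ (2 * k)) \<partial>M) \<le> ennreal B"
      by (rule order_trans[OF member_le_sum[OF that] sum_le]) (use finR in auto)
    then have "ennreal p * (\<integral>\<^sup>+\<omega>. ennreal (c ^ (2 * k) * ?S r \<omega> ^ (2 * k)) \<partial>M) < \<infinity>"
      by (rule le_less_trans) simp
    then have "(\<integral>\<^sup>+\<omega>. ennreal (c ^ (2 * k) * ?S r \<omega> ^ (2 * k)) \<partial>M) < \<infinity>"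
      using p by (auto simp: ennreal_mult_less_top)
    then have "integrable M (\<lambda>\<omega>. c ^ (2 * k) * ?S r \<omega> ^ (2 * k))"
      using c nonneg by (intro integrableI_nonneg) auto
    then show ?thesis using c by simp
  qed
  then show "r \<in> ?R \<Longrightarrow> integrable M (\<lambda>\<omega>. ?S r \<omega> ^ (2 * k))" .
  have val: "(\<integral>\<^sup>+\<omega>. ennreal (c ^ (2 * k) * ?S r \<omega> ^ (2 * k)) \<partial>M) =
      ennreal (c ^ (2 * k) * expectation (\<lambda>\<omega>. ?S r \<omega> ^ (2 * k)))" if "r \<in> ?R" for r
    using fin[OF that] c nonneg by (subst nn_integral_eq_integral) auto
  have "(\<Sum>r\<in>?R. ennreal p * (\<integral>\<^sup>+\<omega>. ennreal (c ^ (2 * k) * ?S r \<omega> ^ (2 * k)) \<partial>M)) =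
      (\<Sum>r\<in>?R. ennreal (p * (c ^ (2 * k) * expectation (\<lambda>\<omega>. ?S r \<omega> ^ (2 * k)))))"
  proof (rule sum.cong)
    fix r assume "r \<in> ?R"
    show "ennreal p * (\<integral>\<^sup>+\<omega>. ennreal (c ^ (2 * k) * ?S r \<omega> ^ (2 * k)) \<partial>M) =
        ennreal (p * (c ^ (2 * k) * expectation (\<lambda>\<omega>. ?S r \<omega> ^ (2 * k))))"
      unfolding val[OF \<open>r \<in> ?R\<close>] using p by (intro ennreal_mult'[symmetric]) simp
  qed simp
  also have "\<dots> = ennreal (\<Sum>r\<in>?R. p * (c ^ (2 * k) * expectation (\<lambda>\<omega>. ?S r \<omega> ^ (2 * k))))"
    using p c nonneg by (intro sum_ennreal mult_nonneg_nonneg Bochner_Integration.integral_nonneg) auto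
  finally have real_le: "(\<Sum>r\<in>?R. p * (c ^ (2 * k) * expectation (\<lambda>\<omega>. ?S r \<omega> ^ (2 * k)))) \<le> B"
    using sum_le B(2) by simp
  have "\<exists>r\<in>?R. c ^ (2 * k) * expectation (\<lambda>\<omega>. ?S r \<omega> ^ (2 * k)) \<le> B"
  proof (rule ccontr)
    assume "\<not> ?thesis"
    then have "\<And>r. r \<in> ?R \<Longrightarrow> p * B < p * (c ^ (2 * k) * expectation (\<lambda>\<omega>. ?S r \<omega> ^ (2 * k)))"
      using p by (auto simp: not_le)
    moreover have "?R \<noteq> {}" by (auto simp: PiE_eq_empty_iff)
    ultimately have "(\<Sum>r\<in>?R. p * B) < (\<Sum>r\<in>?R. p * (c ^ (2 * k) * expectation (\<lambda>\<omega>. ?S r \<omega> ^ (2 * k))))"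
      using finR by (intro sum_strict_mono) auto
    moreover have "(\<Sum>r\<in>?R. p * B) = B"
      using cardR by (simp flip: mult.assoc)
    ultimately show False using real_le by linarith
  qed
  then show "\<exists>r. (\<forall>j\<in>J. r j \<in> {1, -1}) \<and> c ^ (2 * k) * expectation (\<lambda>\<omega>. ?S r \<omega> ^ (2 * k)) \<le> B"
    by (auto simp: PiE_iff)
qed

text \<open>\<open>2 * X i\<close> is the difference of two signed sums that differ in the sign at
  \<open>i\<close> only. The moment hypothesis bounds sums; this recovers integrability for the
  single observations.\<close>

lemma (in prob_space) integrable_power_of_signs:
  fixes X :: "'i \<Rightarrow> 'a \<Rightarrow> real"
  assumes J: "finite J" "i \<in> J"
    and X[measurable]: "\<And>j. j \<in> J \<Longrightarrow> X j \<in> borel_measurable M"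
    and int: "\<And>r. r \<in> J \<rightarrow>\<^sub>E {1, -1} \<Longrightarrow> integrable M (\<lambda>\<omega>. (\<Sum>j\<in>J. r j * X j \<omega>) ^ (2 * k))"
  shows "integrable M (\<lambda>\<omega>. X i \<omega> ^ (2 * k))"
proof -
  define r where "r = (\<lambda>j\<in>J. 1 :: real)"
  have r: "r \<in> J \<rightarrow>\<^sub>E {1, -1}" "r(i := - 1) \<in> J \<rightarrow>\<^sub>E {1, -1}"
    using J by (auto simp: r_def PiE_iff extensional_def)
  have "integrable M (\<lambda>\<omega>. ((\<Sum>j\<in>J. r j * X j \<omega>) + - (\<Sum>j\<in>J. (r(i := -1)) j * X j \<omega>)) ^ (2 * k))"
    using int[OF r(1)] int[OF r(2)]
    by (intro integrable_power_add borel_measurable_sum borel_measurable_uminus borel_measurable_times X) auto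
  moreover have "(\<Sum>j\<in>J. r j * X j \<omega>) + - (\<Sum>j\<in>J. (r(i := -1)) j * X j \<omega>) = 2 * X i \<omega>" for \<omega>
    using J by (subst (1 2) sum.remove[of _ i]) (auto simp: r_def sum_negf intro!: sum.cong)
  ultimately have "integrable M (\<lambda>\<omega>. 2 ^ (2 * k) * X i \<omega> ^ (2 * k))"
    by (simp only: power_mult_distrib)
  then show ?thesis by simp
qed

text \<open>The expectation factors over the indices. If the subsets differ, some index carries a
  single centered coordinate; if they agree and \<open>a \<noteq> b\<close>, any index of the common
  set carries a product of two uncorrelated coordinates, and \<open>A \<noteq> {}\<close> guarantees
  such an index. The case \<open>B = {}\<close> gives mean zero.\<close>

lemma (in prob_space) product_orthogonal:
  fixes Y :: "'i \<Rightarrow> 'a \<Rightarrow> real ^ 'd"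
  assumes J: "finite J" and ind: "indep_vars (\<lambda>_. borel) Y J"
    and mean: "\<And>j a. j \<in> J \<Longrightarrow> integrable M (\<lambda>\<omega>. Y j \<omega> $ a) \<and> expectation (\<lambda>\<omega>. Y j \<omega> $ a) = 0"
    and sq: "\<And>j a. j \<in> J \<Longrightarrow> integrable M (\<lambda>\<omega>. (Y j \<omega> $ a)\<^sup>2)"
    and cross: "\<And>j a b. j \<in> J \<Longrightarrow> a \<noteq> b \<Longrightarrow> integrable M (\<lambda>\<omega>. Y j \<omega> $ a * Y j \<omega> $ b) \<and>
        expectation (\<lambda>\<omega>. Y j \<omega> $ a * Y j \<omega> $ b) = 0"
    and AB: "A \<subseteq> J" "B \<subseteq> J" "A \<noteq> {}"
  shows "integrable M (\<lambda>\<omega>. (\<Prod>j\<in>A. Y j \<omega> $ a) * (\<Prod>j\<in>B. Y j \<omega> $ b))"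
    and "expectation (\<lambda>\<omega>. (\<Prod>j\<in>A. Y j \<omega> $ a) * (\<Prod>j\<in>B. Y j \<omega> $ b)) =
      (if a = b \<and> A = B then \<Prod>j\<in>A. expectation (\<lambda>\<omega>. (Y j \<omega> $ a)\<^sup>2) else 0)"
proof -
  define G where "G j v = (if j \<in> A then v $ a else 1) * (if j \<in> B then v $ b else 1)" for j and v :: "real ^ 'd"
  have eq: "(\<Prod>j\<in>A. Y j \<omega> $ a) * (\<Prod>j\<in>B. Y j \<omega> $ b) = (\<Prod>j\<in>J. G j (Y j \<omega>))" for \<omega>
  proof -
    have "(\<Prod>j\<in>J. if j \<in> A then Y j \<omega> $ a else 1) = (\<Prod>j\<in>A. Y j \<omega> $ a)"
      "(\<Prod>j\<in>J. if j \<in> B then Y j \<omega> $ b else 1) = (\<Prod>j\<in>B. Y j \<omega> $ b)"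
      using J AB by (simp_all add: prod.If_cases Int_absorb1 Int_absorb2 Int_commute)
    then show ?thesis by (simp add: G_def prod.distrib)
  qed
  have iG: "indep_vars (\<lambda>_. borel) (\<lambda>j \<omega>. G j (Y j \<omega>)) J"
    by (rule indep_vars_compose2[OF ind]) (simp add: G_def[abs_def])
  have intG: "integrable M (\<lambda>\<omega>. G j (Y j \<omega>))" if "j \<in> J" for j
  proof -
    have "integrable M (\<lambda>\<omega>. Y j \<omega> $ a * Y j \<omega> $ b)"
      using sq[OF that, of a] cross[OF that, of a b] by (cases "a = b") (auto simp: power2_eq_square)
    then show ?thesis
      using mean[OF that] by (cases "j \<in> A"; cases "j \<in> B") (simp_all add: G_def)
  qed
  show "integrable M (\<lambda>\<omega>. (\<Prod>j\<in>A. Y j \<omega> $ a) * (\<Prod>j\<in>B. Y j \<omega> $ b))"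
    unfolding eq using intG by (intro indep_vars_integrable J iG)
  have "expectation (\<lambda>\<omega>. (\<Prod>j\<in>A. Y j \<omega> $ a) * (\<Prod>j\<in>B. Y j \<omega> $ b)) = (\<Prod>j\<in>J. expectation (\<lambda>\<omega>. G j (Y j \<omega>)))"
    unfolding eq using intG by (intro indep_vars_lebesgue_integral J iG)
  also have "\<dots> = (if a = b \<and> A = B then \<Prod>j\<in>A. expectation (\<lambda>\<omega>. (Y j \<omega> $ a)\<^sup>2) else 0)"
  proof (cases "a = b \<and> A = B")
    case True
    have "(\<Prod>j\<in>J. expectation (\<lambda>\<omega>. G j (Y j \<omega>))) =
        (\<Prod>j\<in>J. if j \<in> A then expectation (\<lambda>\<omega>. (Y j \<omega> $ a)\<^sup>2) else 1)"
      using True by (intro prod.cong) (auto simp: G_def power2_eq_square prob_space)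
    then show ?thesis using True J AB by (simp add: prod.If_cases Int_absorb1 Int_absorb2 Int_commute)
  next
    case False
    obtain j where "j \<in> J" "expectation (\<lambda>\<omega>. G j (Y j \<omega>)) = 0"
    proof (cases "A = B")
      case True
      then obtain j where "j \<in> A" "j \<in> B" "j \<in> J" using AB by auto
      then show ?thesis using that[of j] False True cross[of j a b] by (simp add: G_def)
    next
      case False
      then obtain j where "j \<in> J" "j \<in> A \<longleftrightarrow> j \<notin> B" using AB by auto
      then show ?thesis
        using that[of j] mean[of j] by (cases "j \<in> A") (simp_all add: G_def)
    qed
    then have "(\<Prod>j\<in>J. expectation (\<lambda>\<omega>. G j (Y j \<omega>))) = 0"
      using J by (auto intro: prod_zero)
    then show ?thesis using False by auto
  qed
  finally show "expectation (\<lambda>\<omega>. (\<Prod>j\<in>A. Y j \<omega> $ a) * (\<Prod>j\<in>B. Y j \<omega> $ b)) =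
      (if a = b \<and> A = B then \<Prod>j\<in>A. expectation (\<lambda>\<omega>. (Y j \<omega> $ a)\<^sup>2) else 0)" .
qed

lemma (in prob_space) second_moment_orthogonal_sum:
  fixes \<xi> :: "'i \<Rightarrow> 'a \<Rightarrow> real"
  assumes Q: "finite Q"
    and mean: "\<And>p. p \<in> Q \<Longrightarrow> integrable M (\<xi> p) \<and> expectation (\<xi> p) = 0"
    and int: "\<And>p q. p \<in> Q \<Longrightarrow> q \<in> Q \<Longrightarrow> integrable M (\<lambda>\<omega>. \<xi> p \<omega> * \<xi> q \<omega>)"
    and orth: "\<And>p q. p \<in> Q \<Longrightarrow> q \<in> Q \<Longrightarrow> expectation (\<lambda>\<omega>. \<xi> p \<omega> * \<xi> q \<omega>) = (if p = q then v p else 0)"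
  shows "integrable M (\<lambda>\<omega>. (b + (\<Sum>p\<in>Q. c p * \<xi> p \<omega>))\<^sup>2)"
    and "expectation (\<lambda>\<omega>. (b + (\<Sum>p\<in>Q. c p * \<xi> p \<omega>))\<^sup>2) = b\<^sup>2 + (\<Sum>p\<in>Q. (c p)\<^sup>2 * v p)"
proof -
  have eq: "(b + (\<Sum>p\<in>Q. c p * \<xi> p \<omega>))\<^sup>2 =
      b\<^sup>2 + ((\<Sum>p\<in>Q. 2 * b * c p * \<xi> p \<omega>) + (\<Sum>p\<in>Q. \<Sum>q\<in>Q. c p * c q * (\<xi> p \<omega> * \<xi> q \<omega>)))" for \<omega>
    by (simp add: power2_sum sum_power2_expand sum_distrib_left mult_ac)
  have i1: "integrable M (\<lambda>\<omega>. \<Sum>p\<in>Q. 2 * b * c p * \<xi> p \<omega>)"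
    using mean by (intro Bochner_Integration.integrable_sum integrable_mult_right) auto
  have i2: "integrable M (\<lambda>\<omega>. \<Sum>p\<in>Q. \<Sum>q\<in>Q. c p * c q * (\<xi> p \<omega> * \<xi> q \<omega>))"
    using int by (intro Bochner_Integration.integrable_sum integrable_mult_right) auto
  show "integrable M (\<lambda>\<omega>. (b + (\<Sum>p\<in>Q. c p * \<xi> p \<omega>))\<^sup>2)"
    unfolding eq using i1 i2 by simp
  have "expectation (\<lambda>\<omega>. \<Sum>p\<in>Q. 2 * b * c p * \<xi> p \<omega>) = 0"
    using mean by (subst Bochner_Integration.integral_sum) auto
  moreover have "expectation (\<lambda>\<omega>. \<Sum>p\<in>Q. \<Sum>q\<in>Q. c p * c q * (\<xi> p \<omega> * \<xi> q \<omega>)) =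
      (\<Sum>p\<in>Q. \<Sum>q\<in>Q. c p * c q * (if p = q then v p else 0))"
    using int orth by (simp add: Bochner_Integration.integral_sum Bochner_Integration.integrable_sum)
  moreover have "\<dots> = (\<Sum>p\<in>Q. (c p)\<^sup>2 * v p)"
    using Q by (simp add: if_distrib sum.delta power2_eq_square cong: if_cong)
  ultimately show "expectation (\<lambda>\<omega>. (b + (\<Sum>p\<in>Q. c p * \<xi> p \<omega>))\<^sup>2) = b\<^sup>2 + (\<Sum>p\<in>Q. (c p)\<^sup>2 * v p)"
    unfolding eq using i1 i2 by (simp add: prob_space)
qed

section \<open>Inequalities for second moments\<close>

lemma L2_norm_le:
  assumes "(\<integral>\<^sup>+\<omega>. ennreal (\<bar>X \<omega>\<bar>\<^sup>2) \<partial>M) \<le> ennreal (c\<^sup>2)" "0 \<le> c"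
  shows "L2_norm M X \<le> ennreal c"
proof -
  define I where "I = (\<integral>\<^sup>+\<omega>. ennreal (\<bar>X \<omega>\<bar>\<^sup>2) \<partial>M)"
  have I: "I \<le> ennreal (c\<^sup>2)" using assms by (simp add: I_def)
  then have "I \<noteq> \<infinity>" by (auto simp: top_unique)
  moreover have "enn2real I \<le> c\<^sup>2"
    using I enn2real_mono[OF I] by simp
  then have "sqrt (enn2real I) \<le> c"
    using assms(2) real_le_lsqrt by simp
  ultimately show ?thesis
    unfolding L2_norm_def Let_def I_def[symmetric] by (simp add: ennreal_leI)
qed

lemma ennreal_power2_le_imp_le:
  assumes "x\<^sup>2 \<le> ennreal (c\<^sup>2)" "0 \<le> c"
  shows "x \<le> ennreal c"
proof (cases x)
  case (real r)
  then have "r\<^sup>2 \<le> c\<^sup>2" using assms by (simp add: ennreal_power)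
  then have "r \<le> c" using assms(2) by (rule power2_le_imp_le)
  then show ?thesis using real by (simp add: ennreal_leI)
next
  case top
  then show ?thesis using assms by (simp add: top_unique power2_eq_square ennreal_mult_eq_top_iff)
qed

text \<open>Minkowski's inequality, with the cross term bounded by Cauchy-Schwarz. The sum of
  absolute values is what dominates the error of the estimator pointwise.\<close>

lemma nn_integral_add_power2_le:
  fixes f g :: "'a \<Rightarrow> real"
  assumes [measurable]: "f \<in> borel_measurable M" "g \<in> borel_measurable M"
    and f: "(\<integral>\<^sup>+\<omega>. ennreal ((f \<omega>)\<^sup>2) \<partial>M) \<le> ennreal (a\<^sup>2)" and g: "(\<integral>\<^sup>+\<omega>. ennreal ((g \<omega>)\<^sup>2) \<partial>M) \<le> ennreal (b\<^sup>2)"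
    and ab: "0 \<le> a" "0 \<le> b"
  shows "(\<integral>\<^sup>+\<omega>. ennreal ((\<bar>f \<omega>\<bar> + \<bar>g \<omega>\<bar>)\<^sup>2) \<partial>M) \<le> ennreal ((a + b)\<^sup>2)"
proof -
  let ?I = "\<integral>\<^sup>+\<omega>. ennreal \<bar>f \<omega>\<bar> * ennreal \<bar>g \<omega>\<bar> \<partial>M"
  have "?I\<^sup>2 \<le> (\<integral>\<^sup>+\<omega>. (ennreal \<bar>f \<omega>\<bar>)\<^sup>2 \<partial>M) * (\<integral>\<^sup>+\<omega>. (ennreal \<bar>g \<omega>\<bar>)\<^sup>2 \<partial>M)"
    by (rule Cauchy_Schwarz_nn_integral) auto
  also have "\<dots> \<le> ennreal (a\<^sup>2) * ennreal (b\<^sup>2)"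
    using f g by (intro mult_mono) (auto simp: ennreal_power)
  also have "\<dots> = ennreal ((a * b)\<^sup>2)"
    by (simp add: ennreal_mult power_mult_distrib)
  finally have I2: "?I\<^sup>2 \<le> ennreal ((a * b)\<^sup>2)" .
  have I: "?I \<le> ennreal (a * b)"
    using ab by (intro ennreal_power2_le_imp_le[OF I2]) auto
  have "(\<integral>\<^sup>+\<omega>. ennreal ((\<bar>f \<omega>\<bar> + \<bar>g \<omega>\<bar>)\<^sup>2) \<partial>M) =
      (\<integral>\<^sup>+\<omega>. ennreal ((f \<omega>)\<^sup>2) + ennreal ((g \<omega>)\<^sup>2) + 2 * (ennreal \<bar>f \<omega>\<bar> * ennreal \<bar>g \<omega>\<bar>) \<partial>M)"
    by (intro nn_integral_cong) (simp add: power2_sum ennreal_mult[symmetric] ennreal_plus[symmetric] ennreal_numeral[symmetric]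
        del: ennreal_plus ennreal_numeral)
  also have "\<dots> = (\<integral>\<^sup>+\<omega>. ennreal ((f \<omega>)\<^sup>2) \<partial>M) + (\<integral>\<^sup>+\<omega>. ennreal ((g \<omega>)\<^sup>2) \<partial>M) + 2 * ?I"
    by (simp add: nn_integral_add nn_integral_cmult)
  also have "\<dots> \<le> ennreal (a\<^sup>2) + ennreal (b\<^sup>2) + 2 * ennreal (a * b)"
    using f g I by (intro add_mono mult_left_mono) auto
  also have "\<dots> = ennreal ((a + b)\<^sup>2)"
    using ab by (simp add: power2_sum ennreal_mult[symmetric] ennreal_plus[symmetric] ennreal_numeral[symmetric]
        del: ennreal_plus ennreal_numeral)
  finally show ?thesis .
qed

text \<open>Jensen's inequality for the square: the weighted variance about the mean
  \<open>m\<close> is nonnegative.\<close>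

lemma weighted_sum_power2_le:
  fixes W f :: "'i \<Rightarrow> real"
  assumes "\<And>i. i \<in> I \<Longrightarrow> 0 \<le> W i" "sum W I = 1"
  shows "(\<Sum>i\<in>I. W i * f i)\<^sup>2 \<le> (\<Sum>i\<in>I. W i * (f i)\<^sup>2)"
proof -
  define m where "m = (\<Sum>i\<in>I. W i * f i)"
  have "0 \<le> (\<Sum>i\<in>I. W i * (f i - m)\<^sup>2)"
    using assms by (intro sum_nonneg) auto
  also have "\<dots> = (\<Sum>i\<in>I. W i * (f i)\<^sup>2 - 2 * m * (W i * f i) + m\<^sup>2 * W i)"
    by (intro sum.cong refl) (simp add: power2_diff algebra_simps)
  also have "\<dots> = (\<Sum>i\<in>I. W i * (f i)\<^sup>2) - 2 * m * m + m\<^sup>2 * 1"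
    by (simp only: sum.distrib sum_subtractf sum_distrib_left[symmetric] m_def[symmetric] assms(2))
  finally show ?thesis by (simp add: m_def[symmetric] power2_eq_square)
qed

text \<open>Convexity with the unequal weights \<open>1 / 4\<close> and \<open>3 / 4\<close>, then
  once more for real and imaginary part. In the application \<open>u\<close> has coefficients 1 and
  \<open>z\<close> complex coefficients of modulus 2, and both parts must stay below
  \<open>64 ^ s\<close>: the first has base \<open>16 * 4 = 64\<close>, the second
  \<open>16 / 9 * 2 * 16 = 512 / 9\<close>. Equal weights would give 128 for the second.\<close>

lemma power_abs_add_cmod_le:
  assumes "0 < s"
  shows "(\<bar>u\<bar> + cmod z) ^ (2 * s) \<le>
    1 / 4 * (4 ^ (2 * s) * u ^ (2 * s)) + 3 / 8 * ((4 / 3) ^ (2 * s) * 2 ^ s * (Re z ^ (2 * s) + Im z ^ (2 * s)))"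
proof -
  have "(\<bar>u\<bar> + cmod z) ^ (2 * s) = ((1 - 3 / 4) *\<^sub>R (4 * \<bar>u\<bar>) + (3 / 4) *\<^sub>R (4 / 3 * cmod z)) ^ (2 * s)"
    by simp
  also have "\<dots> \<le> (1 - 3 / 4) * (4 * \<bar>u\<bar>) ^ (2 * s) + 3 / 4 * (4 / 3 * cmod z) ^ (2 * s)"
    by (rule convex_onD[OF convex_power_even]) auto
  also have "(4 * \<bar>u\<bar>) ^ (2 * s) = 4 ^ (2 * s) * u ^ (2 * s)"
    by (simp add: power_mult_distrib power_mult)
  also have "(4 / 3 * cmod z) ^ (2 * s) = (4 / 3) ^ (2 * s) * ((Re z)\<^sup>2 + (Im z)\<^sup>2) ^ s"
    by (simp only: power_mult_distrib power_mult cmod_power2)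
  also have "((Re z)\<^sup>2 + (Im z)\<^sup>2) ^ s \<le> 2 ^ s / 2 * (Re z ^ (2 * s) + Im z ^ (2 * s))"
  proof -
    have "((1 - 1 / 2) *\<^sub>R (Re z)\<^sup>2 + (1 / 2) *\<^sub>R (Im z)\<^sup>2) ^ s \<le> (1 - 1 / 2) * ((Re z)\<^sup>2) ^ s + 1 / 2 * ((Im z)\<^sup>2) ^ s"
    proof (rule convex_onD)
      show "convex_on {0 :: real..} (\<lambda>x. x ^ s)"
        by (cases "even s") (auto intro: convex_power_odd convex_on_subset[OF convex_power_even])
    qed auto
    also have "(1 - 1 / 2) *\<^sub>R (Re z)\<^sup>2 + (1 / 2) *\<^sub>R (Im z)\<^sup>2 = ((Re z)\<^sup>2 + (Im z)\<^sup>2) / 2" by simp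
    finally show ?thesis unfolding power_mult by (simp add: power_divide field_simps)
  qed
  finally show ?thesis by (simp add: mult_left_mono)
qed

section \<open>Second moments of the main part and of the remainder\<close>

lemma esym_1:
  assumes "finite J"
  shows "esym J y (Suc 0) = sum y J"
  using assms by (induction J) (simp_all add: esym_empty_Suc esym_insert esym_0 add.commute)

lemma sum_esym_eq_sum_subsets:
  assumes J: "finite J"
  shows "(\<Sum>l=1..m. w l * esym J y l) = (\<Sum>A | A \<subseteq> J \<and> card A \<in> {1..m}. w (card A) * prod y A)"
proof -
  let ?S = "{A. A \<subseteq> J \<and> card A \<in> {1..m}}"
  have "(\<Sum>A\<in>?S. w (card A) * prod y A) = (\<Sum>l\<in>{1..m}. \<Sum>A\<in>{A\<in>?S. card A = l}. w (card A) * prod y A)"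
    using J by (intro sum.group[symmetric]) auto
  also have "\<dots> = (\<Sum>l=1..m. w l * esym J y l)"
    unfolding esym_def sum_distrib_left by (intro sum.cong) auto
  finally show ?thesis by simp
qed

text \<open>A Hoeffding-type expansion: the products indexed by a coordinate and a nonempty subset
  are centered and mutually orthogonal, so they and the constant \<open>b\<close> contribute
  separately. The variance of a product is the product of the variances, hence the contributions
  recombine to elementary symmetric polynomials of the variances.\<close>

lemma (in prob_space) esym_second_moment:
  fixes Y :: "'i \<Rightarrow> 'a \<Rightarrow> real ^ 'd" and w :: "'d \<Rightarrow> nat \<Rightarrow> real" and b :: real and m :: nat
  assumes J: "finite J" and ind: "indep_vars (\<lambda>_. borel) Y J"
    and mean: "\<And>j a. j \<in> J \<Longrightarrow> integrable M (\<lambda>\<omega>. Y j \<omega> $ a) \<and> expectation (\<lambda>\<omega>. Y j \<omega> $ a) = 0"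
    and sq: "\<And>j a. j \<in> J \<Longrightarrow> integrable M (\<lambda>\<omega>. (Y j \<omega> $ a)\<^sup>2)"
    and cross: "\<And>j a b. j \<in> J \<Longrightarrow> a \<noteq> b \<Longrightarrow> integrable M (\<lambda>\<omega>. Y j \<omega> $ a * Y j \<omega> $ b) \<and>
        expectation (\<lambda>\<omega>. Y j \<omega> $ a * Y j \<omega> $ b) = 0"
  defines "F \<equiv> \<lambda>\<omega>. b + (\<Sum>a\<in>UNIV. \<Sum>l=1..m. w a l * esym J (\<lambda>j. Y j \<omega> $ a) l)"
  shows "integrable M (\<lambda>\<omega>. (F \<omega>)\<^sup>2)"
    and "expectation (\<lambda>\<omega>. (F \<omega>)\<^sup>2) =
      b\<^sup>2 + (\<Sum>a\<in>UNIV. \<Sum>l=1..m. (w a l)\<^sup>2 * esym J (\<lambda>j. expectation (\<lambda>\<omega>. (Y j \<omega> $ a)\<^sup>2)) l)"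
proof -
  define S where "S = {A. A \<subseteq> J \<and> card A \<in> {1..m}}"
  define Q where "Q = (UNIV :: 'd set) \<times> S"
  define c where "c p = w (fst p) (card (snd p))" for p :: "'d \<times> 'i set"
  define \<xi> where "\<xi> p \<omega> = (\<Prod>j\<in>snd p. Y j \<omega> $ fst p)" for p :: "'d \<times> 'i set" and \<omega>
  define v where "v p = (\<Prod>j\<in>snd p. expectation (\<lambda>\<omega>. (Y j \<omega> $ fst p)\<^sup>2))" for p :: "'d \<times> 'i set"
  have finS: "finite S" unfolding S_def using J by simp
  have Q: "snd p \<subseteq> J" "snd p \<noteq> {}" if "p \<in> Q" for p
    using that by (auto simp: Q_def S_def)
  note orth = product_orthogonal[OF J ind mean sq cross]
  have F: "F \<omega> = b + (\<Sum>p\<in>Q. c p * \<xi> p \<omega>)" for \<omega>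
    unfolding F_def sum_esym_eq_sum_subsets[OF J] S_def[symmetric] Q_def c_def \<xi>_def
    by (simp add: sum.cartesian_product case_prod_beta)
  have V: "(\<Sum>p\<in>Q. (c p)\<^sup>2 * v p) =
      (\<Sum>a\<in>UNIV. \<Sum>l=1..m. (w a l)\<^sup>2 * esym J (\<lambda>j. expectation (\<lambda>\<omega>. (Y j \<omega> $ a)\<^sup>2)) l)"
    unfolding sum_esym_eq_sum_subsets[OF J] S_def[symmetric] Q_def c_def v_def
    by (simp add: sum.cartesian_product case_prod_beta)
  \<comment> \<open>The case of an empty second subset in \<open>product_orthogonal\<close>.\<close>
  have mean': "integrable M (\<xi> p) \<and> expectation (\<xi> p) = 0" if "p \<in> Q" for p
    using orth[of "snd p" "{}" "fst p" "fst p"] Q[OF that] by (simp add: \<xi>_def[abs_def])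
  have int': "integrable M (\<lambda>\<omega>. \<xi> p \<omega> * \<xi> q \<omega>)" if "p \<in> Q" "q \<in> Q" for p q
    unfolding \<xi>_def using Q[OF that(1)] Q[OF that(2)] by (intro orth)
  have orth': "expectation (\<lambda>\<omega>. \<xi> p \<omega> * \<xi> q \<omega>) = (if p = q then v p else 0)" if "p \<in> Q" "q \<in> Q" for p q
    unfolding \<xi>_def v_def using orth(2)[of "snd p" "snd q" "fst p" "fst q"] Q[OF that(1)] Q[OF that(2)]
    by (simp add: prod_eq_iff)
  have finQ: "finite Q" using finS by (simp add: Q_def)
  show "integrable M (\<lambda>\<omega>. (F \<omega>)\<^sup>2)"
    unfolding F by (rule second_moment_orthogonal_sum[OF finQ mean' int' orth'])
  show "expectation (\<lambda>\<omega>. (F \<omega>)\<^sup>2) =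
      b\<^sup>2 + (\<Sum>a\<in>UNIV. \<Sum>l=1..m. (w a l)\<^sup>2 * esym J (\<lambda>j. expectation (\<lambda>\<omega>. (Y j \<omega> $ a)\<^sup>2)) l)"
    unfolding F V[symmetric] by (rule second_moment_orthogonal_sum[OF finQ mean' int' orth'])
qed

text \<open>The signs square to 1 and disappear, so a second moment bound for any one sign pattern
  is a bound for the total variance.\<close>

lemma (in prob_space) second_moment_signed_sum:
  fixes Y :: "'i \<Rightarrow> 'a \<Rightarrow> real ^ 'd"
  assumes J: "finite J" and ind: "indep_vars (\<lambda>_. borel) Y J"
    and mean: "\<And>j a. j \<in> J \<Longrightarrow> integrable M (\<lambda>\<omega>. Y j \<omega> $ a) \<and> expectation (\<lambda>\<omega>. Y j \<omega> $ a) = 0"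
    and sq: "\<And>j a. j \<in> J \<Longrightarrow> integrable M (\<lambda>\<omega>. (Y j \<omega> $ a)\<^sup>2)"
    and cross: "\<And>j a b. j \<in> J \<Longrightarrow> a \<noteq> b \<Longrightarrow> integrable M (\<lambda>\<omega>. Y j \<omega> $ a * Y j \<omega> $ b) \<and>
        expectation (\<lambda>\<omega>. Y j \<omega> $ a * Y j \<omega> $ b) = 0"
    and r: "\<And>j. j \<in> J \<Longrightarrow> r j \<in> {1, -1}"
  shows "expectation (\<lambda>\<omega>. (\<Sum>j\<in>J. r j * Y j \<omega> $ a)\<^sup>2) = (\<Sum>j\<in>J. expectation (\<lambda>\<omega>. (Y j \<omega> $ a)\<^sup>2))"
proof -
  note orth = product_orthogonal[OF J ind mean sq cross]
  have "expectation (\<lambda>\<omega>. (0 + (\<Sum>j\<in>J. r j * Y j \<omega> $ a))\<^sup>2) =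
      0\<^sup>2 + (\<Sum>j\<in>J. (r j)\<^sup>2 * expectation (\<lambda>\<omega>. (Y j \<omega> $ a)\<^sup>2))"
  proof (rule second_moment_orthogonal_sum[OF J])
    fix i j assume ij: "i \<in> J" "j \<in> J"
    show "integrable M (\<lambda>\<omega>. Y i \<omega> $ a * Y j \<omega> $ a)"
      using orth(1)[of "{i}" "{j}" a a] ij by simp
    show "expectation (\<lambda>\<omega>. Y i \<omega> $ a * Y j \<omega> $ a) = (if i = j then expectation (\<lambda>\<omega>. (Y i \<omega> $ a)\<^sup>2) else 0)"
      using orth(2)[of "{i}" "{j}" a a] ij by simp
  qed (use mean in auto)
  also have "(\<Sum>j\<in>J. (r j)\<^sup>2 * expectation (\<lambda>\<omega>. (Y j \<omega> $ a)\<^sup>2)) = (\<Sum>j\<in>J. expectation (\<lambda>\<omega>. (Y j \<omega> $ a)\<^sup>2))"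
    using r by (intro sum.cong refl) fastforce
  finally show ?thesis by simp
qed

text \<open>\<open>R\<close> is an average over the weights; Jensen moves the square inside, which
  leaves moments of order \<open>2 * s\<close> of real linear sums. These are compared with the one
  sign pattern \<open>r\<close>, whose normalized moment is at most \<open>\<tau>\<close>.\<close>

lemma (in prob_space) polarized_power_second_moment:
  fixes X :: "'i \<Rightarrow> 'a \<Rightarrow> real" and q :: "'b \<Rightarrow> real" and z :: "'b \<Rightarrow> complex"
  assumes J: "finite J" and n: "0 < n" and s: "0 < s" and T: "finite T"
    and ind: "indep_vars (\<lambda>_. borel) X J"
    and int: "\<And>j. j \<in> J \<Longrightarrow> integrable M (\<lambda>\<omega>. X j \<omega> ^ (2 * s))"
    and mean: "\<And>j. j \<in> J \<Longrightarrow> expectation (X j) = 0"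
    and r: "\<And>j. j \<in> J \<Longrightarrow> r j \<in> {1, -1}"
    and \<tau>: "(1 / real n) ^ (2 * s) * expectation (\<lambda>\<omega>. (\<Sum>j\<in>J. r j * X j \<omega>) ^ (2 * s)) \<le> \<tau>"
    and q: "\<And>i. 0 \<le> q i" "sum q T = 1" and z: "\<And>i. cmod (z i) \<le> 2"
  defines "R \<equiv> \<lambda>\<omega>. \<Sum>\<phi>\<in>J \<rightarrow>\<^sub>E T. (\<Prod>j\<in>J. q (\<phi> j)) *
      (\<bar>(\<Sum>j\<in>J. X j \<omega>) / real n\<bar> + cmod ((\<Sum>j\<in>J. z (\<phi> j) * X j \<omega>) / real n)) ^ s"
  shows "R \<in> borel_measurable M" and "(\<integral>\<^sup>+\<omega>. ennreal ((R \<omega>)\<^sup>2) \<partial>M) \<le> ennreal (64 ^ s * \<tau>)"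
proof -
  let ?P = "J \<rightarrow>\<^sub>E T" and ?W = "\<lambda>\<phi>. \<Prod>j\<in>J. q (\<phi> j)"
  define B where "B = expectation (\<lambda>\<omega>. (\<Sum>j\<in>J. r j * X j \<omega>) ^ (2 * s))"
  have B: "0 \<le> B" by (auto simp: B_def zero_le_even_power intro!: Bochner_Integration.integral_nonneg)
  have X[measurable]: "X j \<in> borel_measurable M" if "j \<in> J" for j
    using ind that by (auto simp: indep_vars_def)
  show [measurable]: "R \<in> borel_measurable M"
    unfolding R_def by measurable
  have W: "0 \<le> ?W \<phi>" for \<phi> by (intro prod_nonneg q)
  \<comment> \<open>The product weights form a probability again, since their sum factors.\<close>
  have sumW: "sum ?W ?P = 1"
    using prod_sum_PiE[of J "\<lambda>_. T" "\<lambda>_. q"] J T q by simp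
  \<comment> \<open>Used with \<open>A = 1\<close> for the sample mean and \<open>A = 2\<close> for
    the real and imaginary parts of the polarized sums.\<close>
  have scale: "integrable M (\<lambda>\<omega>. ((\<Sum>j\<in>J. c j * X j \<omega>) / real n) ^ (2 * s)) \<and>
      expectation (\<lambda>\<omega>. ((\<Sum>j\<in>J. c j * X j \<omega>) / real n) ^ (2 * s)) \<le> (2 * A) ^ (2 * s) * \<tau>"
    if c: "\<And>j. j \<in> J \<Longrightarrow> \<bar>c j\<bar> \<le> A" and A: "0 < A" for c A
  proof -
    have i: "integrable M (\<lambda>\<omega>. (\<Sum>j\<in>J. c j * X j \<omega>) ^ (2 * s))"
      using J s int by (intro integrable_power_sum) (auto simp: power_mult_distrib)
    have "expectation (\<lambda>\<omega>. (\<Sum>j\<in>J. c j * X j \<omega>) ^ (2 * s)) \<le> (2 * A) ^ (2 * s) * B"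
      unfolding B_def by (rule power_sum_coefficients_le[OF J s ind int mean r c A])
    then have "(1 / real n) ^ (2 * s) * expectation (\<lambda>\<omega>. (\<Sum>j\<in>J. c j * X j \<omega>) ^ (2 * s)) \<le>
        (1 / real n) ^ (2 * s) * ((2 * A) ^ (2 * s) * B)"
      by (intro mult_left_mono) auto
    also have "\<dots> = (2 * A) ^ (2 * s) * ((1 / real n) ^ (2 * s) * B)"
      by (simp only: mult_ac)
    also have "\<dots> \<le> (2 * A) ^ (2 * s) * \<tau>"
      using \<tau> by (intro mult_left_mono) (auto simp: B_def zero_le_even_power)
    finally show ?thesis using i by (simp add: power_divide)
  qed
  define e where "e \<omega> = (\<Sum>j\<in>J. X j \<omega>) / real n" for \<omega>
  define Z where "Z \<phi> \<omega> = (\<Sum>j\<in>J. z (\<phi> j) * X j \<omega>) / complex_of_real (real n)" for \<phi> :: "'i \<Rightarrow> 'b" and \<omega>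
  define V where "V \<phi> \<omega> = 1 / 4 * (4 ^ (2 * s) * e \<omega> ^ (2 * s)) +
      3 / 8 * ((4 / 3) ^ (2 * s) * 2 ^ s * (Re (Z \<phi> \<omega>) ^ (2 * s) + Im (Z \<phi> \<omega>) ^ (2 * s)))" for \<phi> \<omega>
  have ReZ: "Re (Z \<phi> \<omega>) = (\<Sum>j\<in>J. Re (z (\<phi> j)) * X j \<omega>) / real n"
    and ImZ: "Im (Z \<phi> \<omega>) = (\<Sum>j\<in>J. Im (z (\<phi> j)) * X j \<omega>) / real n" for \<phi> \<omega>
    by (simp_all add: Z_def Re_divide_of_real Im_divide_of_real)
  have e: "integrable M (\<lambda>\<omega>. e \<omega> ^ (2 * s)) \<and> expectation (\<lambda>\<omega>. e \<omega> ^ (2 * s)) \<le> 2 ^ (2 * s) * \<tau>"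
    using scale[of "\<lambda>_. 1" 1] by (simp add: e_def)
  have Re: "integrable M (\<lambda>\<omega>. Re (Z \<phi> \<omega>) ^ (2 * s)) \<and> expectation (\<lambda>\<omega>. Re (Z \<phi> \<omega>) ^ (2 * s)) \<le> 4 ^ (2 * s) * \<tau>" for \<phi>
    using scale[of "\<lambda>j. Re (z (\<phi> j))" 2] order_trans[OF abs_Re_le_cmod z] by (simp add: ReZ)
  have Im: "integrable M (\<lambda>\<omega>. Im (Z \<phi> \<omega>) ^ (2 * s)) \<and> expectation (\<lambda>\<omega>. Im (Z \<phi> \<omega>) ^ (2 * s)) \<le> 4 ^ (2 * s) * \<tau>" for \<phi>
    using scale[of "\<lambda>j. Im (z (\<phi> j))" 2] order_trans[OF abs_Im_le_cmod z] by (simp add: ImZ)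
  have \<tau>0: "0 \<le> \<tau>"
    using \<tau> B by (intro order_trans[OF _ \<tau>]) (auto simp: B_def zero_le_even_power)
  have V0: "0 \<le> V \<phi> \<omega>" for \<phi> \<omega>
    by (auto simp: V_def zero_le_even_power)
  have V: "integrable M (V \<phi>)" "expectation (V \<phi>) \<le> 64 ^ s * \<tau>" for \<phi>
  proof -
    show "integrable M (V \<phi>)"
      unfolding V_def using e Re[of \<phi>] Im[of \<phi>] by auto
    have "expectation (V \<phi>) = 1 / 4 * (4 ^ (2 * s) * expectation (\<lambda>\<omega>. e \<omega> ^ (2 * s))) +
        3 / 8 * ((4 / 3) ^ (2 * s) * 2 ^ s * (expectation (\<lambda>\<omega>. Re (Z \<phi> \<omega>) ^ (2 * s)) + expectation (\<lambda>\<omega>. Im (Z \<phi> \<omega>) ^ (2 * s))))"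
      unfolding V_def using e Re[of \<phi>] Im[of \<phi>] by simp
    also have "\<dots> \<le> 1 / 4 * (4 ^ (2 * s) * (2 ^ (2 * s) * \<tau>)) +
        3 / 8 * ((4 / 3) ^ (2 * s) * 2 ^ s * (4 ^ (2 * s) * \<tau> + 4 ^ (2 * s) * \<tau>))"
      using e Re[of \<phi>] Im[of \<phi>] by (intro add_mono mult_left_mono) auto
    also have "\<dots> = 1 / 4 * (64 ^ s * \<tau>) + 3 / 4 * ((512 / 9) ^ s * \<tau>)"
    proof -
      have "(4::real) ^ (2 * s) * 2 ^ (2 * s) = 64 ^ s" "(4 / 3 :: real) ^ (2 * s) * 2 ^ s * 4 ^ (2 * s) = (512 / 9) ^ s"
        by (simp_all add: power_mult power_divide flip: power_mult_distrib)
      then have eqs: "4 ^ (2 * s) * (2 ^ (2 * s) * \<tau>) = 64 ^ s * \<tau>"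
        "(4 / 3) ^ (2 * s) * 2 ^ s * (4 ^ (2 * s) * \<tau> + 4 ^ (2 * s) * \<tau>) = 2 * ((512 / 9) ^ s * \<tau>)"
        by (simp_all only: distrib_left mult.assoc[symmetric] mult_2 distrib_right)
      show ?thesis unfolding eqs by simp
    qed
    also have "\<dots> \<le> 1 / 4 * (64 ^ s * \<tau>) + 3 / 4 * (64 ^ s * \<tau>)"
      using \<tau>0 by (intro add_mono mult_left_mono mult_right_mono power_mono) auto
    finally show "expectation (V \<phi>) \<le> 64 ^ s * \<tau>" by (simp add: mult.commute)
  qed
  have "(\<integral>\<^sup>+\<omega>. ennreal ((R \<omega>)\<^sup>2) \<partial>M) \<le> (\<integral>\<^sup>+\<omega>. ennreal (\<Sum>\<phi>\<in>?P. ?W \<phi> * V \<phi> \<omega>) \<partial>M)"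
  proof (intro nn_integral_mono ennreal_leI)
    fix \<omega>
    have "(R \<omega>)\<^sup>2 \<le> (\<Sum>\<phi>\<in>?P. ?W \<phi> * ((\<bar>e \<omega>\<bar> + cmod (Z \<phi> \<omega>)) ^ s)\<^sup>2)"
      unfolding R_def e_def[symmetric] Z_def[symmetric] using W sumW by (intro weighted_sum_power2_le) auto
    also have "\<dots> \<le> (\<Sum>\<phi>\<in>?P. ?W \<phi> * V \<phi> \<omega>)"
    proof (intro sum_mono mult_left_mono W)
      fix \<phi>
      have "((\<bar>e \<omega>\<bar> + cmod (Z \<phi> \<omega>)) ^ s)\<^sup>2 = (\<bar>e \<omega>\<bar> + cmod (Z \<phi> \<omega>)) ^ (2 * s)"
        by (simp only: power_mult[symmetric] mult.commute)
      also have "\<dots> \<le> V \<phi> \<omega>"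
        unfolding V_def by (rule power_abs_add_cmod_le[OF s])
      finally show "((\<bar>e \<omega>\<bar> + cmod (Z \<phi> \<omega>)) ^ s)\<^sup>2 \<le> V \<phi> \<omega>" .
    qed
    finally show "(R \<omega>)\<^sup>2 \<le> (\<Sum>\<phi>\<in>?P. ?W \<phi> * V \<phi> \<omega>)" .
  qed
  also have "\<dots> = ennreal (expectation (\<lambda>\<omega>. \<Sum>\<phi>\<in>?P. ?W \<phi> * V \<phi> \<omega>))"
    using V(1) V0 W by (intro nn_integral_eq_integral) (auto intro!: sum_nonneg)
  also have "expectation (\<lambda>\<omega>. \<Sum>\<phi>\<in>?P. ?W \<phi> * V \<phi> \<omega>) = (\<Sum>\<phi>\<in>?P. ?W \<phi> * expectation (V \<phi>))"
    using V(1) by (subst Bochner_Integration.integral_sum) auto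
  also have "\<dots> \<le> (\<Sum>\<phi>\<in>?P. ?W \<phi> * (64 ^ s * \<tau>))"
    using V(2) W by (intro sum_mono mult_left_mono) auto
  also have "\<dots> = 64 ^ s * \<tau>"
    by (simp only: sum_distrib_right[symmetric] sumW mult_1)
  finally show "(\<integral>\<^sup>+\<omega>. ennreal ((R \<omega>)\<^sup>2) \<partial>M) \<le> ennreal (64 ^ s * \<tau>)"
    by (simp add: ennreal_leI)
qed

text \<open>The sum in the estimator starts at \<open>k = 2\<close>, yet it can be extended down to
  0: the statistic of degree 0 is 1, which gives the plug-in term, and the one of degree 1 vanishes
  because centered observations add up to zero. Shifting the observations by \<open>\<theta>\<close>
  shifts their mean alike, so the statistics depend on the noise only.\<close>

lemma estimator_eq_esym:
  fixes x :: "nat \<Rightarrow> real ^ 'd" and \<theta> :: "real ^ 'd"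
  assumes m: "1 \<le> m" "m \<le> n"
  defines "e \<equiv> \<lambda>a. (\<Sum>j=1..n. x j $ a - \<theta> $ a) / real n"
  shows "estimator g m n x = (\<Sum>a\<in>UNIV. 1 / real CARD('d) * (\<Sum>k\<le>m. (deriv ^^ k) g (\<theta> $ a + e a) *
      (esym {1..n} (\<lambda>j. (x j $ a - \<theta> $ a) - e a) k / real (n choose k)) / fact k))"
proof -
  have n: "0 < real n" using m by simp
  have mean: "sample_mean n x $ a = \<theta> $ a + e a" for a
    using n by (simp add: sample_mean_def e_def sum_component sum_subtractf field_simps)
  have ust: "centered_ustat n x k a = esym {1..n} (\<lambda>j. (x j $ a - \<theta> $ a) - e a) k / real (n choose k)"
    if k: "k \<le> n" for k a
    unfolding centered_ustat_def mean
    using k by (subst sum_distinct_lists) (simp_all add: binomial_fact algebra_simps)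
  have e1: "esym {1..n} (\<lambda>j. (x j $ a - \<theta> $ a) - e a) (Suc 0) = 0" for a
    using n by (simp add: esym_1 e_def sum_subtractf)
  have "(\<Sum>k\<le>m. (deriv ^^ k) g (\<theta> $ a + e a) *
      (esym {1..n} (\<lambda>j. (x j $ a - \<theta> $ a) - e a) k / real (n choose k)) / fact k) =
      g (sample_mean n x $ a) + (\<Sum>k=2..m. (deriv ^^ k) g (sample_mean n x $ a) * centered_ustat n x k a / fact k)" for a
  proof -
    have "{..m} = insert 0 (insert 1 {2..m})" using m by auto
    then have "(\<Sum>k\<le>m. (deriv ^^ k) g (\<theta> $ a + e a) *
        (esym {1..n} (\<lambda>j. (x j $ a - \<theta> $ a) - e a) k / real (n choose k)) / fact k) =
        g (\<theta> $ a + e a) + (\<Sum>k=2..m. (deriv ^^ k) g (\<theta> $ a + e a) *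
        (esym {1..n} (\<lambda>j. (x j $ a - \<theta> $ a) - e a) k / real (n choose k)) / fact k)"
      using e1[of a] by (simp add: esym_0)
    also have "\<dots> = g (sample_mean n x $ a) + (\<Sum>k=2..m. (deriv ^^ k) g (sample_mean n x $ a) * centered_ustat n x k a / fact k)"
      unfolding mean using m by (intro arg_cong2[where f = "(+)"] sum.cong refl) (simp add: ust)
    finally show ?thesis .
  qed
  then show ?thesis
    unfolding estimator_def by (simp add: sum_distrib_left)
qed

section \<open>The error of the estimator\<close>

lemma power2_two_powr_seven_halves:
  fixes y :: real
  shows "((2 powr (7 / 2) * y) ^ s)\<^sup>2 = 128 ^ s * y ^ (2 * s)"
proof -
  have "((2 powr (7 / 2) * y) ^ s)\<^sup>2 = ((2 powr (7 / 2))\<^sup>2) ^ s * y ^ (2 * s)"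
    by (simp add: power_mult_distrib power_mult[symmetric] mult.commute)
  also have "(2 powr (7 / 2))\<^sup>2 = (128 :: real)"
    by (simp add: powr_power)
  finally show ?thesis .
qed

text \<open>A Lipschitz constant \<open>L\<close> takes the place of the Hoelder norm, so that the
  bound serves both when this norm is merely finite and when a bound for the \<open>s\<close>-th
  derivative is at hand. The error is dominated by \<open>\<bar>F\<bar> + \<bar>G\<bar>\<close>,
  where \<open>F\<close> consists of minus the bias and an orthogonal sum, and \<open>G\<close>
  bounds the remainder.\<close>

lemma (in prob_space) estimator_L2_bound:
  fixes x :: "nat \<Rightarrow> 'a \<Rightarrow> real ^ 'd" and \<epsilon>' :: "nat \<Rightarrow> 'a \<Rightarrow> real" and \<theta> :: "real ^ 'd" and f0 g :: "real \<Rightarrow> real"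
  assumes n: "n \<ge> 1" and s: "2 < s" "real s \<le> sqrt (real n / 2 * ln 2)"
    and diff: "times_differentiable (s - 1) g"
    and L: "\<And>u v. \<bar>(deriv ^^ (s - 1)) g u - (deriv ^^ (s - 1)) g v\<bar> \<le> L * \<bar>u - v\<bar>" "0 \<le> L"
    and ind: "indep_vars (\<lambda>_. borel) x {1..n}"
    and mean: "\<And>j. j \<in> {1..n} \<Longrightarrow> has_bochner_integral M (x j) \<theta>"
    and cross: "\<And>j a b. j \<in> {1..n} \<Longrightarrow> a \<noteq> b \<Longrightarrow>
           has_bochner_integral M (\<lambda>\<omega>. (x j \<omega> $ a - \<theta> $ a) * (x j \<omega> $ b - \<theta> $ b)) 0"
    and \<sigma>: "\<sigma> > 0"
    and rad: "rademacher M \<epsilon>' {1..n}"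
    and fam: "indep_families M {1..n} \<epsilon>' (\<lambda>j \<omega>. x j \<omega> - \<theta>)"
    and mom: "\<And>a k. 1 \<le> k \<Longrightarrow> k \<le> s \<Longrightarrow>
           (\<integral>\<^sup>+\<omega>. ennreal (\<bar>(1 / real n) * (\<Sum>j=1..n. \<epsilon>' j \<omega> * (x j \<omega> $ a - \<theta> $ a))\<bar> ^ (2 * k)) \<partial>M)
             \<le> ennreal (\<sigma> ^ (2 * k) * 2 ^ (k - 1) * fact k)"
  shows "L2_norm M (\<lambda>\<omega>. estimator g (s - 1) n (\<lambda>j. x j \<omega>) - additive_functional f0 \<theta>)
    \<le> ennreal (sqrt ((bias f0 g \<theta>)\<^sup>2 + var_proxy (real s) g \<sigma> \<theta>) + L * ((2 powr (7 / 2) * \<sigma>) ^ s / sqrt (fact s)))"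
proof -
  let ?J = "{1..n}"
  define m where "m = s - 1"
  have m: "1 \<le> m" "Suc m = s" "m \<le> s" using s by (auto simp: m_def)
  define d where "d = real CARD('d)"
  have d: "0 < d" by (simp add: d_def)
  define D where "D k = (deriv ^^ k) g" for k
  define Y where "Y j \<omega> = x j \<omega> - \<theta>" for j \<omega>
  have Yc: "Y j \<omega> $ a = x j \<omega> $ a - \<theta> $ a" for j \<omega> a by (simp add: Y_def)
  note ratio = power_le_fact_binomial[OF s(2) n]
  have mn: "m \<le> n" using ratio(2)[of m] m by simp
  have D: "(D i has_real_derivative D (Suc i) u) (at u)" if "i < m" for i u
    using diff that DERIV_deriv_iff_real_differentiable
    by (auto simp: D_def m_def times_differentiable_def)
  have xm[measurable]: "x j \<in> borel_measurable M" if "j \<in> ?J" for j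
    using ind that by (auto simp: indep_vars_def)
  have Ym: "Y j \<in> borel_measurable M" if "j \<in> ?J" for j
    unfolding Y_def using xm[OF that] by measurable
  have indY: "indep_vars (\<lambda>_. borel) Y ?J"
    unfolding Y_def by (rule indep_vars_compose2[OF ind]) simp
  have indX: "indep_vars (\<lambda>_. borel) (\<lambda>j \<omega>. Y j \<omega> $ a) ?J" for a
    by (rule indep_vars_compose2[OF indY]) simp
  have Xm: "(\<lambda>\<omega>. Y j \<omega> $ a) \<in> borel_measurable M" if "j \<in> ?J" for j a
    using Ym[OF that] by measurable
  have meanY: "integrable M (\<lambda>\<omega>. Y j \<omega> $ a) \<and> expectation (\<lambda>\<omega>. Y j \<omega> $ a) = 0" if "j \<in> ?J" for j a
  proof -
    have "has_bochner_integral M (\<lambda>\<omega>. x j \<omega> $ a) (\<theta> $ a)"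
      by (rule has_bochner_integral_bounded_linear[OF bounded_linear_vec_nth mean[OF that]])
    then show ?thesis
      by (auto simp: Yc has_bochner_integral_iff prob_space)
  qed
  have crossY: "integrable M (\<lambda>\<omega>. Y j \<omega> $ a * Y j \<omega> $ b) \<and> expectation (\<lambda>\<omega>. Y j \<omega> $ a * Y j \<omega> $ b) = 0"
    if "j \<in> ?J" "a \<noteq> b" for j a b
    using cross[OF that] by (simp add: Yc has_bochner_integral_iff)
  have momY: "(\<integral>\<^sup>+\<omega>. ennreal (\<bar>(1 / real n) * (\<Sum>j\<in>?J. \<epsilon>' j \<omega> * Y j \<omega> $ a)\<bar> ^ (2 * k)) \<partial>M)
      \<le> ennreal (\<sigma> ^ (2 * k) * 2 ^ (k - 1) * fact k)" if "1 \<le> k" "k \<le> s" for a k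
    using mom[OF that] by (simp add: Yc)
  have signs: "r \<in> ?J \<rightarrow>\<^sub>E {1, -1} \<Longrightarrow> integrable M (\<lambda>\<omega>. (\<Sum>j\<in>?J. r j * Y j \<omega> $ a) ^ (2 * k))"
    "\<exists>r. (\<forall>j\<in>?J. r j \<in> {1, -1}) \<and> (1 / real n) ^ (2 * k) * expectation (\<lambda>\<omega>. (\<Sum>j\<in>?J. r j * Y j \<omega> $ a) ^ (2 * k))
      \<le> \<sigma> ^ (2 * k) * 2 ^ (k - 1) * fact k" if "1 \<le> k" "k \<le> s" for r a k
    using rademacher_moment_signs[OF _ _ rad fam[folded Y_def] Ym _ momY[OF that]] n \<sigma> by auto
  have intX: "integrable M (\<lambda>\<omega>. (Y j \<omega> $ a) ^ (2 * s))" if "j \<in> ?J" for j a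
    by (rule integrable_power_of_signs[OF _ that Xm signs(1)]) (use s in auto)
  have sqY: "integrable M (\<lambda>\<omega>. (Y j \<omega> $ a)\<^sup>2)" if "j \<in> ?J" for j a
    by (rule integrable_power_le[OF Xm[OF that] intX[OF that]]) (use s in auto)
  have fin: "finite ?J" by simp

  define v where "v a = (\<lambda>j. expectation (\<lambda>\<omega>. (Y j \<omega> $ a)\<^sup>2))" for a
  have v0: "0 \<le> v a j" for a j by (simp add: v_def)
  \<comment> \<open>The moment bound with \<open>k = 1\<close>, where the factor
    \<open>2 ^ (k - 1) * fact k\<close> equals 1.\<close>
  have sumv: "sum (v a) ?J \<le> (real n * \<sigma>)\<^sup>2" for a
  proof -
    obtain r where r: "\<And>j. j \<in> ?J \<Longrightarrow> r j \<in> {1, -1}"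
      "(1 / real n) ^ (2 * 1) * expectation (\<lambda>\<omega>. (\<Sum>j\<in>?J. r j * Y j \<omega> $ a) ^ (2 * 1)) \<le> \<sigma> ^ (2 * 1) * 2 ^ (1 - 1) * fact 1"
    proof -
      have "(1 :: nat) \<le> 1" "1 \<le> s" using s by auto
      from signs(2)[OF this, of a] that show ?thesis by blast
    qed
    have "expectation (\<lambda>\<omega>. (\<Sum>j\<in>?J. r j * Y j \<omega> $ a)\<^sup>2) = sum (v a) ?J"
      unfolding v_def by (rule second_moment_signed_sum[OF fin indY meanY sqY crossY r(1)])
    then show ?thesis
      using r(2) n by (simp add: power_divide power_mult_distrib pos_divide_le_eq mult.commute)
  qed

  \<comment> \<open>The coefficient of \<open>esym\<close> in the main part:
    \<open>D l / fact l\<close> from Taylor, the inverse binomial coefficient from the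
    normalization, and \<open>1 / d\<close> from averaging over the coordinates.\<close>
  define w where "w a l = 1 / d * (D l (\<theta> $ a) / (fact l * real (n choose l)))" for a l
  define F where "F \<omega> = - bias f0 g \<theta> + (\<Sum>a\<in>UNIV. \<Sum>l=1..m. w a l * esym ?J (\<lambda>j. Y j \<omega> $ a) l)" for \<omega>
  have F_int: "integrable M (\<lambda>\<omega>. (F \<omega>)\<^sup>2)" and F_exp: "expectation (\<lambda>\<omega>. (F \<omega>)\<^sup>2) =
      (- bias f0 g \<theta>)\<^sup>2 + (\<Sum>a\<in>UNIV. \<Sum>l=1..m. (w a l)\<^sup>2 * esym ?J (v a) l)"
    unfolding F_def v_def using esym_second_moment[OF fin indY meanY sqY crossY] by blast+
  have F_meas: "F \<in> borel_measurable M"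
    unfolding F_def esym_def
    by (intro borel_measurable_add borel_measurable_sum borel_measurable_times borel_measurable_const
        borel_measurable_prod Xm) auto
  have kappa: "(\<Sum>a\<in>UNIV. \<Sum>l=1..m. (w a l)\<^sup>2 * esym ?J (v a) l) \<le> var_proxy (real s) g \<sigma> \<theta>"
  proof -
    have le: "(w a l)\<^sup>2 * esym ?J (v a) l \<le> \<bar>D l (\<theta> $ a)\<bar>\<^sup>2 * \<sigma> ^ (2 * l) / (d\<^sup>2 / 2 * fact l)"
      if l: "l \<in> {1..m}" for a l
    proof -
      let ?C = "fact l * real (n choose l)"
      have C: "0 < ?C" using l mn by simp
      have "fact l * esym ?J (v a) l \<le> sum (v a) ?J ^ l"
        by (rule fact_esym_le_power) (auto simp: v0)
      also have "\<dots> \<le> ((real n * \<sigma>)\<^sup>2) ^ l"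
        using v0 by (intro power_mono sumv sum_nonneg) auto
      also have "\<dots> = (real n ^ l)\<^sup>2 * \<sigma> ^ (2 * l)"
        by (simp add: power_mult_distrib power_mult[symmetric] mult.commute)
      also have "\<dots> \<le> (4 / 3 * ?C)\<^sup>2 * \<sigma> ^ (2 * l)"
        using ratio(1)[of l] l m \<sigma> by (intro mult_right_mono power_mono) auto
      \<comment> \<open>The square \<open>16 / 9\<close> of \<open>4 / 3\<close> is rounded up to 2,
        the factor that the denominator \<open>d^2 / 2\<close> of the variance proxy
        provides.\<close>
      also have "\<dots> \<le> 2 * ?C\<^sup>2 * \<sigma> ^ (2 * l)"
        using \<sigma> by (intro mult_right_mono) (auto simp: power_mult_distrib power_divide)
      finally have "esym ?J (v a) l \<le> 2 * ?C\<^sup>2 * \<sigma> ^ (2 * l) / fact l"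
        by (simp add: pos_le_divide_eq mult.commute)
      then have "(w a l)\<^sup>2 * esym ?J (v a) l \<le> (w a l)\<^sup>2 * (2 * ?C\<^sup>2 * \<sigma> ^ (2 * l) / fact l)"
        by (rule mult_left_mono) simp
      also have "\<dots> = (D l (\<theta> $ a))\<^sup>2 / (d\<^sup>2 * ?C\<^sup>2) * (2 * ?C\<^sup>2 * \<sigma> ^ (2 * l) / fact l)"
        by (simp only: w_def power_mult_distrib power_divide) simp
      also have "\<dots> = \<bar>D l (\<theta> $ a)\<bar>\<^sup>2 * \<sigma> ^ (2 * l) / (d\<^sup>2 / 2 * fact l) * (?C\<^sup>2 / ?C\<^sup>2)"
        using d by (simp add: mult_ac)
      also have "\<dots> = \<bar>D l (\<theta> $ a)\<bar>\<^sup>2 * \<sigma> ^ (2 * l) / (d\<^sup>2 / 2 * fact l)"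
        using l mn by simp
      finally show ?thesis .
    qed
    have "(\<Sum>a\<in>UNIV. \<Sum>l=1..m. (w a l)\<^sup>2 * esym ?J (v a) l) \<le>
        (\<Sum>a\<in>UNIV. \<Sum>l=1..m. \<bar>D l (\<theta> $ a)\<bar>\<^sup>2 * \<sigma> ^ (2 * l) / (d\<^sup>2 / 2 * fact l))"
      by (intro sum_mono le)
    also have "\<dots> = (\<Sum>l=1..m. (\<Sum>a\<in>UNIV. \<bar>D l (\<theta> $ a)\<bar>\<^sup>2) * \<sigma> ^ (2 * l) / (d\<^sup>2 / 2 * fact l))"
      by (subst sum.swap) (simp only: sum_distrib_right sum_divide_distrib)
    also have "\<dots> = var_proxy (real s) g \<sigma> \<theta>"
      by (simp add: var_proxy_def m_def D_def d_def)
    finally show ?thesis .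
  qed
  define \<alpha> where "\<alpha> = sqrt ((bias f0 g \<theta>)\<^sup>2 + var_proxy (real s) g \<sigma> \<theta>)"
  have kappa0: "0 \<le> var_proxy (real s) g \<sigma> \<theta>"
    unfolding var_proxy_def using \<sigma>
    by (intro sum_nonneg divide_nonneg_nonneg mult_nonneg_nonneg) auto
  have \<alpha>: "0 \<le> \<alpha>" "\<alpha>\<^sup>2 = (bias f0 g \<theta>)\<^sup>2 + var_proxy (real s) g \<sigma> \<theta>"
    using kappa0 by (simp_all add: \<alpha>_def)
  have F_le: "(\<integral>\<^sup>+\<omega>. ennreal ((F \<omega>)\<^sup>2) \<partial>M) \<le> ennreal (\<alpha>\<^sup>2)"
  proof -
    have "(\<integral>\<^sup>+\<omega>. ennreal ((F \<omega>)\<^sup>2) \<partial>M) = ennreal (expectation (\<lambda>\<omega>. (F \<omega>)\<^sup>2))"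
      by (rule nn_integral_eq_integral[OF F_int]) simp
    also have "\<dots> \<le> ennreal (\<alpha>\<^sup>2)"
      using kappa F_exp \<alpha>(2) by (intro ennreal_leI) simp
    finally show ?thesis .
  qed

  obtain N :: nat and q z where qz: "\<And>i. 0 \<le> q i" "\<And>i. cmod (z i) = 2"
    "\<And>p. p \<le> m \<Longrightarrow> (\<Sum>i<N. complex_of_real (q i) * z i ^ p) = (if p \<le> 1 then 1 else 0)"
    by (rule complex_weights_exist[of m]) blast
  have sumq: "sum q {..<N} = 1"
    using qz(3)[of 0] by (simp flip: of_real_sum)
  define e where "e a \<omega> = (\<Sum>j\<in>?J. Y j \<omega> $ a) / real n" for a \<omega>
  define R where "R a \<omega> = (\<Sum>\<phi>\<in>?J \<rightarrow>\<^sub>E {..<N}. (\<Prod>j\<in>?J. q (\<phi> j)) *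
      (\<bar>(\<Sum>j\<in>?J. Y j \<omega> $ a) / real n\<bar> + cmod ((\<Sum>j\<in>?J. z (\<phi> j) * (Y j \<omega> $ a)) / real n)) ^ s)" for a \<omega>
  define \<tau> where "\<tau> = \<sigma> ^ (2 * s) * 2 ^ (s - 1) * fact s"
  have R: "R a \<in> borel_measurable M" "(\<integral>\<^sup>+\<omega>. ennreal ((R a \<omega>)\<^sup>2) \<partial>M) \<le> ennreal (64 ^ s * \<tau>)" for a
  proof -
    obtain r where r: "\<And>j. j \<in> ?J \<Longrightarrow> r j \<in> {1, -1}"
      "(1 / real n) ^ (2 * s) * expectation (\<lambda>\<omega>. (\<Sum>j\<in>?J. r j * Y j \<omega> $ a) ^ (2 * s)) \<le> \<tau>"
    proof -
      have "1 \<le> s" "s \<le> s" using s by auto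
      from signs(2)[OF this, of a] that show ?thesis unfolding \<tau>_def by blast
    qed
    have pos: "0 < n" "0 < s" using n s by auto
    have mean0: "expectation (\<lambda>\<omega>. Y j \<omega> $ a) = 0" if "j \<in> ?J" for j
      using meanY[OF that] by blast
    have z: "cmod (z i) \<le> 2" for i using qz(2)[of i] by simp
    show "R a \<in> borel_measurable M" "(\<integral>\<^sup>+\<omega>. ennreal ((R a \<omega>)\<^sup>2) \<partial>M) \<le> ennreal (64 ^ s * \<tau>)"
      unfolding R_def
      by (rule polarized_power_second_moment[OF fin pos finite_lessThan indX intX mean0 r qz(1) sumq z], assumption+)+
  qed
  define K where "K = L * (4 / 3) / fact s"
  have K: "0 \<le> K" using L by (simp add: K_def)
  define G where "G \<omega> = K * (\<Sum>a\<in>UNIV. 1 / d * R a \<omega>)" for \<omega>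
  define \<beta> where "\<beta> = L * ((2 powr (7 / 2) * \<sigma>) ^ s / sqrt (fact s))"
  have \<beta>0: "0 \<le> \<beta>" using L \<sigma> by (simp add: \<beta>_def)
  have G_meas: "G \<in> borel_measurable M"
    unfolding G_def using R(1) by measurable
  \<comment> \<open>\<open>64 ^ s * 2 ^ (s - 1)\<close> is half of \<open>128 ^ s\<close>.
    Multiplied by the square of the \<open>4 / 3\<close> in \<open>K\<close>, this half becomes
    \<open>8 / 9\<close>, which is below 1.\<close>
  have K\<tau>: "K\<^sup>2 * (64 ^ s * \<tau>) \<le> \<beta>\<^sup>2"
  proof -
    have "\<beta>\<^sup>2 = L\<^sup>2 * (128 ^ s * \<sigma> ^ (2 * s) / fact s)"
      unfolding \<beta>_def power_mult_distrib[of L] power_divide[of _ "sqrt (fact s)"] power2_two_powr_seven_halves by simp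
    moreover have "K\<^sup>2 * (64 ^ s * \<tau>) = (8 / 9) * (L\<^sup>2 * (128 ^ s * \<sigma> ^ (2 * s) / fact s))"
    proof -
      have "(128 :: real) ^ s = 64 ^ s * 2 ^ s" by (simp flip: power_mult_distrib)
      moreover have "(2 :: real) ^ s = 2 * 2 ^ (s - 1)" using s by (simp add: power_eq_if)
      ultimately show ?thesis
        by (simp add: K_def \<tau>_def power_mult_distrib power_divide power2_eq_square[of "fact s"])
    qed
    moreover have "0 \<le> L\<^sup>2 * (128 ^ s * \<sigma> ^ (2 * s) / fact s)" using \<sigma> by simp
    ultimately show ?thesis by linarith
  qed
  have G_le: "(\<integral>\<^sup>+\<omega>. ennreal ((G \<omega>)\<^sup>2) \<partial>M) \<le> ennreal (\<beta>\<^sup>2)"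
  proof -
    have "(\<integral>\<^sup>+\<omega>. ennreal ((G \<omega>)\<^sup>2) \<partial>M) \<le> (\<integral>\<^sup>+\<omega>. (\<Sum>a\<in>UNIV. ennreal (K\<^sup>2 / d) * ennreal ((R a \<omega>)\<^sup>2)) \<partial>M)"
    proof (rule nn_integral_mono)
      fix \<omega>
      \<comment> \<open>Jensen over the coordinates with weights \<open>1 / d\<close>; this makes
        the bound for the remainder free of \<open>d\<close>.\<close>
      have "(\<Sum>a\<in>UNIV. 1 / d * R a \<omega>)\<^sup>2 \<le> (\<Sum>a\<in>UNIV. 1 / d * (R a \<omega>)\<^sup>2)"
        using d by (intro weighted_sum_power2_le) (auto simp: d_def)
      then have "(G \<omega>)\<^sup>2 \<le> K\<^sup>2 * (\<Sum>a\<in>UNIV. 1 / d * (R a \<omega>)\<^sup>2)"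
        unfolding G_def power_mult_distrib by (rule mult_left_mono) simp
      also have "\<dots> = (\<Sum>a\<in>UNIV. K\<^sup>2 / d * (R a \<omega>)\<^sup>2)"
        by (simp add: sum_distrib_left)
      finally have "ennreal ((G \<omega>)\<^sup>2) \<le> ennreal (\<Sum>a\<in>UNIV. K\<^sup>2 / d * (R a \<omega>)\<^sup>2)"
        by (rule ennreal_leI)
      also have "\<dots> = (\<Sum>a\<in>UNIV. ennreal (K\<^sup>2 / d) * ennreal ((R a \<omega>)\<^sup>2))"
        using d by (simp only: sum_ennreal[symmetric] ennreal_mult divide_nonneg_pos zero_le_power2 mult_nonneg_nonneg)
      finally show "ennreal ((G \<omega>)\<^sup>2) \<le> (\<Sum>a\<in>UNIV. ennreal (K\<^sup>2 / d) * ennreal ((R a \<omega>)\<^sup>2))" .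
    qed
    also have "\<dots> = (\<Sum>a\<in>UNIV. ennreal (K\<^sup>2 / d) * (\<integral>\<^sup>+\<omega>. ennreal ((R a \<omega>)\<^sup>2) \<partial>M))"
      using R(1) by (subst nn_integral_sum) (auto intro!: sum.cong nn_integral_cmult)
    also have "\<dots> \<le> (\<Sum>a\<in>(UNIV :: 'd set). ennreal (K\<^sup>2 / d) * ennreal (64 ^ s * \<tau>))"
      using R(2) by (intro sum_mono mult_left_mono) auto
    also have "\<dots> = (\<Sum>a\<in>(UNIV :: 'd set). ennreal (K\<^sup>2 / d * (64 ^ s * \<tau>)))"
      using d \<sigma> by (intro sum.cong refl ennreal_mult[symmetric]) (auto simp: \<tau>_def)
    also have "\<dots> = ennreal (K\<^sup>2 * (64 ^ s * \<tau>))"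
      using d \<sigma> by (subst sum_ennreal) (auto simp: \<tau>_def d_def)
    also have "\<dots> \<le> ennreal (\<beta>\<^sup>2)"
      by (rule ennreal_leI[OF K\<tau>])
    finally show ?thesis .
  qed

  have pointwise: "\<bar>estimator g (s - 1) n (\<lambda>j. x j \<omega>) - additive_functional f0 \<theta>\<bar> \<le> \<bar>F \<omega>\<bar> + \<bar>G \<omega>\<bar>" for \<omega>
  proof -
    define A where "A a = (\<Sum>k\<le>m. D k (\<theta> $ a + e a \<omega>) *
      (esym ?J (\<lambda>j. Y j \<omega> $ a - e a \<omega>) k / real (n choose k)) / fact k)" for a
    define A' where "A' a = (\<Sum>l\<le>m. D l (\<theta> $ a) * (esym ?J (\<lambda>j. Y j \<omega> $ a) l / real (n choose l)) / fact l)" for a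
    have AA': "\<bar>A a - A' a\<bar> \<le> K * R a \<omega>" for a
      unfolding A_def A'_def K_def R_def e_def m(2)[symmetric]
      using n m mn D L(1)[folded m_def] L(2) qz(1,3) ratio(1)
      by (intro taylor_ustat_remainder_bound) (auto simp: D_def)
    have est: "estimator g (s - 1) n (\<lambda>j. x j \<omega>) = (\<Sum>a\<in>UNIV. 1 / d * A a)"
      unfolding A_def e_def D_def Yc m_def[symmetric] d_def by (rule estimator_eq_esym[OF m(1) mn])
    \<comment> \<open>The terms of degree 0 average \<open>g\<close> instead of \<open>f0\<close>
      over the coordinates of \<open>\<theta>\<close>, so subtracting the target leaves minus the
      bias.\<close>
    have F: "F \<omega> = (\<Sum>a\<in>UNIV. 1 / d * A' a) - additive_functional f0 \<theta>"
    proof -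
      have A': "A' a = g (\<theta> $ a) + (\<Sum>l=1..m. d * (w a l * esym ?J (\<lambda>j. Y j \<omega> $ a) l))" for a
      proof -
        have "{..m} = insert 0 {1..m}" by auto
        then have "A' a = g (\<theta> $ a) + (\<Sum>l=1..m. D l (\<theta> $ a) * (esym ?J (\<lambda>j. Y j \<omega> $ a) l / real (n choose l)) / fact l)"
          unfolding A'_def by (simp add: esym_0 D_def)
        also have "(\<Sum>l=1..m. D l (\<theta> $ a) * (esym ?J (\<lambda>j. Y j \<omega> $ a) l / real (n choose l)) / fact l) =
            (\<Sum>l=1..m. d * (w a l * esym ?J (\<lambda>j. Y j \<omega> $ a) l))"
          using d by (intro sum.cong refl) (simp add: w_def mult_ac)
        finally show ?thesis .
      qed
      have "(\<Sum>a\<in>UNIV. 1 / d * A' a) = (\<Sum>a\<in>UNIV. 1 / d * g (\<theta> $ a)) +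
          (\<Sum>a\<in>UNIV. \<Sum>l=1..m. w a l * esym ?J (\<lambda>j. Y j \<omega> $ a) l)"
        using d by (simp add: A' distrib_left sum.distrib sum_distrib_left del: One_nat_def)
      moreover have "- bias f0 g \<theta> = (\<Sum>a\<in>UNIV. 1 / d * g (\<theta> $ a)) - additive_functional f0 \<theta>"
        unfolding bias_def additive_functional_def d_def[symmetric]
        by (simp add: sum_subtractf right_diff_distrib sum_distrib_left diff_divide_distrib)
      ultimately show ?thesis by (simp add: F_def)
    qed
    have "\<bar>(\<Sum>a\<in>UNIV. 1 / d * A a) - (\<Sum>a\<in>UNIV. 1 / d * A' a)\<bar> = \<bar>\<Sum>a\<in>UNIV. 1 / d * (A a - A' a)\<bar>"
      by (simp add: sum_subtractf right_diff_distrib diff_divide_distrib)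
    also have "\<dots> \<le> (\<Sum>a\<in>UNIV. 1 / d * (K * R a \<omega>))"
      using AA' d by (intro order_trans[OF sum_abs] sum_mono) (simp add: abs_mult divide_right_mono)
    also have "\<dots> = G \<omega>" by (simp add: G_def sum_distrib_left mult_ac)
    finally show ?thesis unfolding est using F by linarith
  qed
  have "(\<integral>\<^sup>+\<omega>. ennreal (\<bar>estimator g (s - 1) n (\<lambda>j. x j \<omega>) - additive_functional f0 \<theta>\<bar>\<^sup>2) \<partial>M) \<le>
      (\<integral>\<^sup>+\<omega>. ennreal ((\<bar>F \<omega>\<bar> + \<bar>G \<omega>\<bar>)\<^sup>2) \<partial>M)"
    by (intro nn_integral_mono ennreal_leI power_mono pointwise) auto
  also have "\<dots> \<le> ennreal ((\<alpha> + \<beta>)\<^sup>2)"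
    by (rule nn_integral_add_power2_le[OF F_meas G_meas F_le G_le \<alpha>(1) \<beta>0])
  finally show ?thesis
    unfolding \<alpha>_def[symmetric] \<beta>_def[symmetric] using \<alpha>(1) \<beta>0 by (intro L2_norm_le) auto
qed

section \<open>Smoothness bounds and the final estimates\<close>

lemma holder_norm_lipschitz:
  assumes "holder_norm s g \<le> ennreal L" "0 \<le> L"
  shows "\<bar>(deriv ^^ (s - 1)) g u - (deriv ^^ (s - 1)) g v\<bar> \<le> L * \<bar>u - v\<bar>"
proof (cases "u = v")
  case False
  have "ennreal (\<bar>(deriv ^^ (s - 1)) g u - (deriv ^^ (s - 1)) g v\<bar> / \<bar>u - v\<bar>) \<le> holder_norm s g"
    unfolding holder_norm_def using False by (intro SUP_upper2[of "(u, v)"]) auto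
  also note assms(1)
  finally have "\<bar>(deriv ^^ (s - 1)) g u - (deriv ^^ (s - 1)) g v\<bar> / \<bar>u - v\<bar> \<le> L"
    using assms(2) by simp
  then show ?thesis using False by (simp add: pos_divide_le_eq)
qed simp

lemma abs_le_of_sup_norm:
  assumes "sup_norm g \<le> ennreal c" "0 \<le> c"
  shows "\<bar>g y\<bar> \<le> c"
proof -
  have "ennreal \<bar>g y\<bar> \<le> sup_norm g"
    unfolding sup_norm_def by (rule SUP_upper) simp
  also note assms(1)
  finally show ?thesis using assms(2) by simp
qed

lemma sum_power_div_fact_le_exp:
  fixes x :: real
  assumes "0 \<le> x" "finite A"
  shows "(\<Sum>k\<in>A. x ^ k / fact k) \<le> exp x"
proof -
  have "(\<Sum>k\<in>A. x ^ k /\<^sub>R fact k) \<le> (\<Sum>k. x ^ k /\<^sub>R fact k)"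
    using assms by (intro sum_le_suminf summable_exp_generic) auto
  then show ?thesis by (simp add: exp_def divide_inverse mult.commute)
qed

text \<open>The variance proxy becomes the squared Euclidean length of a vector indexed by order and
  coordinate, which gives access to the triangle inequality. The orders up to
  \<open>nat \<lceil>t\<rceil> - 1\<close> are the positive integers strictly below
  \<open>t\<close>.\<close>

lemma var_proxy_eq_sum_squares:
  "var_proxy t g \<sigma> (\<theta> :: real ^ 'd) =
    (\<Sum>(k, a)\<in>{k. 1 \<le> k \<and> real k < t} \<times> UNIV. ((deriv ^^ k) g (\<theta> $ a) * \<sigma> ^ k / sqrt ((real CARD('d))\<^sup>2 / 2 * fact k))\<^sup>2)"
proof -
  have k: "{1..nat \<lceil>t\<rceil> - 1} = {k. 1 \<le> k \<and> real k < t}"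
    by (auto simp: less_ceiling_iff[symmetric] zless_nat_eq_int_zless) linarith+
  have "((deriv ^^ k) g (\<theta> $ a) * \<sigma> ^ k / sqrt ((real CARD('d))\<^sup>2 / 2 * fact k))\<^sup>2 =
      \<bar>(deriv ^^ k) g (\<theta> $ a)\<bar>\<^sup>2 * \<sigma> ^ (2 * k) / ((real CARD('d))\<^sup>2 / 2 * fact k)" for k a
  proof -
    have "0 \<le> (real CARD('d))\<^sup>2 / 2 * (fact k :: real)" by simp
    then have "(sqrt ((real CARD('d))\<^sup>2 / 2 * fact k))\<^sup>2 = (real CARD('d))\<^sup>2 / 2 * fact k"
      by (rule real_sqrt_pow2)
    then show ?thesis
      unfolding power_divide power_mult_distrib power_mult[symmetric] by (simp add: mult.commute)
  qed
  then show ?thesis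
    unfolding var_proxy_def k[symmetric] sum.cartesian_product[symmetric]
    by (simp only: sum_distrib_right sum_divide_distrib)
qed

text \<open>The vector of \<open>f0\<close>, set to zero from order \<open>\<alpha>\<close> on,
  differs from that of \<open>g\<close> in each entry by at most
  \<open>\<eta> / h ^ k * c k\<close>: below \<open>\<alpha>\<close> by closeness of the
  derivatives, from \<open>\<alpha>\<close> on by smallness of those of \<open>g\<close>. The
  squares of these bounds sum to \<open>2 * \<eta>^2 / d\<close> times a part of the exponential
  series at \<open>(\<sigma> / h)^2\<close>.\<close>

lemma sqrt_var_proxy_le:
  fixes \<theta> :: "real ^ 'd"
  assumes \<alpha>: "0 < \<alpha>" "\<alpha> \<le> real s" and \<eta>: "0 < \<eta>" and h: "0 < h" and \<sigma>: "0 < \<sigma>"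
    and low: "\<And>k y. real k < \<alpha> \<Longrightarrow> \<bar>(deriv ^^ k) f0 y - (deriv ^^ k) g y\<bar> \<le> \<eta> / h ^ k"
    and high: "\<And>k y. \<alpha> \<le> real k \<Longrightarrow> k \<le> s \<Longrightarrow> \<bar>(deriv ^^ k) g y\<bar> \<le> \<eta> / h ^ k"
  shows "sqrt (var_proxy (real s) g \<sigma> \<theta>) \<le>
    sqrt (var_proxy \<alpha> f0 \<sigma> \<theta>) + \<eta> * sqrt (2 / real CARD('d)) * exp ((\<sigma> / h)\<^sup>2 / 2)"
proof -
  define d where "d = real CARD('d)"
  have d: "0 < d" by (simp add: d_def)
  define c where "c k = \<sigma> ^ k / sqrt (d\<^sup>2 / 2 * fact k)" for k
  have c0: "0 \<le> c k" for k using \<sigma> by (simp add: c_def)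
  let ?K = "{k. 1 \<le> k \<and> real k < real s}"
  let ?A = "?K \<times> (UNIV :: 'd set)" and ?B = "{k. 1 \<le> k \<and> real k < \<alpha>} \<times> (UNIV :: 'd set)"
  have finK: "finite ?K" by (rule finite_subset[of _ "{..s}"]) auto
  define F where "F p = (deriv ^^ fst p) g (\<theta> $ snd p) * c (fst p)" for p
  define F0 where "F0 p = (if real (fst p) < \<alpha> then (deriv ^^ fst p) f0 (\<theta> $ snd p) * c (fst p) else 0)" for p
  define x where "x = (\<sigma> / h)\<^sup>2"
  have "L2_set F ?A = L2_set (\<lambda>p. F0 p + (F p - F0 p)) ?A" by simp
  also have "\<dots> \<le> L2_set F0 ?A + L2_set (\<lambda>p. F p - F0 p) ?A"
    by (rule L2_set_triangle_ineq)
  also have "L2_set F0 ?A = sqrt (var_proxy \<alpha> f0 \<sigma> \<theta>)"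
  proof -
    have "(\<Sum>p\<in>?B. (F0 p)\<^sup>2) = (\<Sum>p\<in>?A. (F0 p)\<^sup>2)"
      using \<alpha> finK by (intro sum.mono_neutral_left) (auto simp: F0_def)
    moreover have "(\<Sum>p\<in>?B. (F0 p)\<^sup>2) = var_proxy \<alpha> f0 \<sigma> \<theta>"
      unfolding var_proxy_eq_sum_squares d_def[symmetric]
      by (intro sum.cong) (auto simp: F0_def c_def)
    ultimately show ?thesis by (simp add: L2_set_def)
  qed
  also have "L2_set (\<lambda>p. F p - F0 p) ?A \<le> \<eta> * sqrt (2 / d) * exp (x / 2)"
  proof -
    have le: "(F p - F0 p)\<^sup>2 \<le> \<eta>\<^sup>2 * (2 / d\<^sup>2) * (x ^ fst p / fact (fst p))" if p: "p \<in> ?A" for p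
    proof -
      obtain k a where pk: "p = (k, a)" by (cases p)
      have "\<bar>F p - F0 p\<bar> \<le> \<eta> / h ^ k * c k"
      proof (cases "real k < \<alpha>")
        case True
        have "\<bar>F p - F0 p\<bar> = \<bar>(deriv ^^ k) f0 (\<theta> $ a) - (deriv ^^ k) g (\<theta> $ a)\<bar> * c k"
          using True c0[of k] by (simp add: F_def F0_def pk abs_minus_commute abs_mult flip: left_diff_distrib)
        also have "\<dots> \<le> \<eta> / h ^ k * c k" by (rule mult_right_mono[OF low[OF True] c0])
        finally show ?thesis .
      next
        case False
        then have "\<bar>F p - F0 p\<bar> = \<bar>(deriv ^^ k) g (\<theta> $ a)\<bar> * c k"
          using c0[of k] by (simp add: F_def F0_def pk abs_mult)
        also have "\<dots> \<le> \<eta> / h ^ k * c k"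
          using False p by (intro mult_right_mono[OF high c0]) (auto simp: pk)
        finally show ?thesis .
      qed
      then have "(F p - F0 p)\<^sup>2 \<le> (\<eta> / h ^ k * c k)\<^sup>2"
        using power_mono[OF _ abs_ge_zero, of "F p - F0 p" "\<eta> / h ^ k * c k" 2] by simp
      also have "\<dots> = \<eta>\<^sup>2 * (2 / d\<^sup>2) * (x ^ k / fact k)"
      proof -
        have "(sqrt (d\<^sup>2 / 2 * fact k))\<^sup>2 = d\<^sup>2 / 2 * fact k"
          by (rule real_sqrt_pow2) simp
        moreover have "x ^ k = (\<sigma> ^ k)\<^sup>2 / (h ^ k)\<^sup>2"
          by (simp add: x_def power_divide mult.commute flip: power_mult)
        ultimately show ?thesis
          by (simp add: c_def power_mult_distrib power_divide mult_ac)
      qed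
      finally show ?thesis by (simp add: pk)
    qed
    have "(\<Sum>p\<in>?A. (F p - F0 p)\<^sup>2) \<le> (\<Sum>p\<in>?A. \<eta>\<^sup>2 * (2 / d\<^sup>2) * (x ^ fst p / fact (fst p)))"
      by (rule sum_mono[OF le])
    also have "\<dots> = (\<Sum>k\<in>?K. \<Sum>a\<in>(UNIV :: 'd set). \<eta>\<^sup>2 * (2 / d\<^sup>2) * (x ^ k / fact k))"
      unfolding sum.cartesian_product by (intro sum.cong) auto
    also have "\<dots> = d * (\<eta>\<^sup>2 * (2 / d\<^sup>2)) * (\<Sum>k\<in>?K. x ^ k / fact k)"
      by (simp add: d_def sum_distrib_left mult.assoc)
    also have "\<dots> \<le> d * (\<eta>\<^sup>2 * (2 / d\<^sup>2)) * exp x"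
      using d finK by (intro mult_left_mono sum_power_div_fact_le_exp) (auto simp: x_def)
    also have "\<dots> = (\<eta> * sqrt (2 / d) * exp (x / 2))\<^sup>2"
    proof -
      have "(exp (x / 2))\<^sup>2 = exp x" by (simp flip: exp_double)
      then show ?thesis using d by (simp add: power_mult_distrib power2_eq_square[of d])
    qed
    finally show ?thesis
      unfolding L2_set_def using \<eta> d by (intro real_le_lsqrt) (auto intro: sum_nonneg)
  qed
  also have "L2_set F ?A = sqrt (var_proxy (real s) g \<sigma> \<theta>)"
    unfolding L2_set_def var_proxy_eq_sum_squares d_def[symmetric]
    by (intro arg_cong[where f = sqrt] sum.cong) (auto simp: F_def c_def)
  finally show ?thesis by (simp add: d_def x_def)
qed

text \<open>After squaring, the condition on \<open>\<sigma> / h\<close> bounds the base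
  \<open>2 ^ 7 * (\<sigma> / h)^2\<close> by \<open>s / exp 1\<close>, the base in the lower bound
  for the factorial. What remains is \<open>1 / sqrt s\<close>, the square of the stated power of
  \<open>s\<close>.\<close>

lemma smooth_remainder_le:
  fixes s :: nat
  assumes s: "0 < s" and \<sigma>: "0 < \<sigma>" and h: "0 < h" and \<eta>: "0 \<le> \<eta>"
    and le: "(\<sigma> / h)\<^sup>2 \<le> real s / (2 ^ 7 * exp 1)"
  shows "\<eta> / h ^ s * ((2 powr (7 / 2) * \<sigma>) ^ s / sqrt (fact s)) \<le> \<eta> * real s powr (- (1 / 4))"
proof -
  let ?q = "(2 powr (7 / 2) * (\<sigma> / h)) ^ s / sqrt (fact s)"
  have "?q\<^sup>2 = (2 ^ 7 * (\<sigma> / h)\<^sup>2) ^ s / fact s"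
    unfolding power_divide[of _ "sqrt (fact s)"] power2_two_powr_seven_halves
    by (simp add: power_mult_distrib power_mult)
  also have "\<dots> \<le> (real s / exp 1) ^ s / fact s"
    using le by (intro divide_right_mono power_mono) (auto simp: field_simps)
  also have "\<dots> \<le> 1 / sqrt (real s)"
    using fact_ge_stirling[OF s] s by (simp add: field_simps)
  also have "\<dots> = (real s powr (- (1 / 4)))\<^sup>2"
    using s by (simp add: powr_half_sqrt[symmetric] powr_minus_divide powr_power power_divide)
  finally have "?q \<le> real s powr (- (1 / 4))"
    by (rule power2_le_imp_le) simp
  then have "\<eta> * ?q \<le> \<eta> * real s powr (- (1 / 4))"
    using \<eta> by (rule mult_left_mono)
  then show ?thesis by (simp add: power_mult_distrib power_divide)
qed

lemma abs_bias_le: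
  fixes \<theta> :: "real ^ 'd"
  assumes "\<And>y. \<bar>f0 y - g y\<bar> \<le> c"
  shows "\<bar>bias f0 g \<theta>\<bar> \<le> c"
proof -
  have "\<bar>\<Sum>a\<in>UNIV. f0 (\<theta> $ a) - g (\<theta> $ a)\<bar> \<le> (\<Sum>a\<in>(UNIV :: 'd set). c)"
    using assms by (intro order_trans[OF sum_abs] sum_mono)
  then show ?thesis by (simp add: bias_def abs_mult field_simps)
qed

theorem theorem5p1:
  fixes M :: "'w measure"
    and x :: "nat \<Rightarrow> 'w \<Rightarrow> real ^ 'd"
    and \<epsilon>' :: "nat \<Rightarrow> 'w \<Rightarrow> real"
    and \<theta> :: "real ^ 'd"
    and f0 fh K :: "real \<Rightarrow> real"
    and h \<sigma> :: real
    and n s :: nat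
  assumes "prob_space M"
    and "n \<ge> 1"
    and "2 < s" and "real s \<le> sqrt (real n / 2 * ln 2)"
    and "h > 0"
    and "kernel_smoothing_exists K h f0"
    and "fh = kernel_smoothing K h f0"
    and "times_differentiable (s - 1) fh"
    and "prob_space.indep_vars M (\<lambda>_. borel) x {1..n}"
    and "\<And>j. j \<in> {1..n} \<Longrightarrow> has_bochner_integral M (x j) \<theta>"
    and "\<And>j a b. j \<in> {1..n} \<Longrightarrow> a \<noteq> b \<Longrightarrow>
           has_bochner_integral M (\<lambda>\<omega>. (x j \<omega> $ a - \<theta> $ a) * (x j \<omega> $ b - \<theta> $ b)) 0"
    and "\<sigma> > 0"
    and "rademacher M \<epsilon>' {1..n}"
    and "indep_families M {1..n} \<epsilon>' (\<lambda>j \<omega>. x j \<omega> - \<theta>)"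
    and "\<And>a k. 1 \<le> k \<Longrightarrow> k \<le> s \<Longrightarrow>
           (\<integral>\<^sup>+\<omega>. ennreal (\<bar>(1 / real n) * (\<Sum>j=1..n. \<epsilon>' j \<omega> * (x j \<omega> $ a - \<theta> $ a))\<bar> ^ (2 * k)) \<partial>M)
             \<le> ennreal (\<sigma> ^ (2 * k) * 2 ^ (k - 1) * fact k)"
  shows "L2_norm M (\<lambda>\<omega>. estimator fh (s - 1) n (\<lambda>j. x j \<omega>) - additive_functional f0 \<theta>)
           \<le> ennreal (sqrt ((bias f0 fh \<theta>)\<^sup>2 + var_proxy (real s) fh \<sigma> \<theta>))
             + holder_norm s fh * ennreal ((2 powr (7 / 2) * \<sigma>) ^ s / sqrt (fact s))
       \<and> (\<forall>\<alpha> \<eta> :: real.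
            0 < \<alpha> \<longrightarrow> \<alpha> \<le> real s \<longrightarrow> 0 < \<eta> \<longrightarrow>
            (\<forall>k. real k < \<alpha> \<longrightarrow> times_differentiable k f0) \<longrightarrow>
            times_differentiable s fh \<longrightarrow>
            (\<forall>k. real k < \<alpha> \<longrightarrow>
               sup_norm (\<lambda>y. (deriv ^^ k) f0 y - (deriv ^^ k) fh y) \<le> ennreal (\<eta> / h ^ k)) \<longrightarrow>
            (\<forall>k. \<alpha> \<le> real k \<and> k \<le> s \<longrightarrow>
               sup_norm ((deriv ^^ k) fh) \<le> ennreal (\<eta> / h ^ k)) \<longrightarrow>
            (\<sigma> / h)\<^sup>2 \<le> real s / (2 ^ 7 * exp 1) \<longrightarrow>
            L2_norm M (\<lambda>\<omega>. estimator fh (s - 1) n (\<lambda>j. x j \<omega>) - additive_functional f0 \<theta>)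
              \<le> ennreal (\<bar>bias f0 fh \<theta>\<bar>
                  + \<eta> * (real s powr (- (1 / 4)) + sqrt (2 / real CARD('d)) * exp ((\<sigma> / h)\<^sup>2 / 2))
                  + sqrt (var_proxy \<alpha> f0 \<sigma> \<theta>))
            \<and> \<bar>bias f0 fh \<theta>\<bar>
                  + \<eta> * (real s powr (- (1 / 4)) + sqrt (2 / real CARD('d)) * exp ((\<sigma> / h)\<^sup>2 / 2))
                  + sqrt (var_proxy \<alpha> f0 \<sigma> \<theta>)
              \<le> \<eta> * (1 + real s powr (- (1 / 4))
                     + sqrt (2 / real CARD('d)) * exp ((\<sigma> / h)\<^sup>2 / 2))
                  + sqrt (var_proxy \<alpha> f0 \<sigma> \<theta>))"
proof -
  interpret prob_space M by fact
  let ?E = "L2_norm M (\<lambda>\<omega>. estimator fh (s - 1) n (\<lambda>j. x j \<omega>) - additive_functional f0 \<theta>)"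
  let ?c = "(2 powr (7 / 2) * \<sigma>) ^ s / sqrt (fact s)"
  have \<sigma>: "0 < \<sigma>" and h: "0 < h" and s: "2 < s" by fact+
  have c: "0 < ?c" using \<sigma> by simp
  have core: "?E \<le> ennreal (sqrt ((bias f0 fh \<theta>)\<^sup>2 + var_proxy (real s) fh \<sigma> \<theta>) + L * ?c)"
    if "\<And>u v. \<bar>(deriv ^^ (s - 1)) fh u - (deriv ^^ (s - 1)) fh v\<bar> \<le> L * \<bar>u - v\<bar>" "0 \<le> L" for L
    by (rule estimator_L2_bound[OF assms(2-4,8) that assms(9-15)])
  have "?E \<le> ennreal (sqrt ((bias f0 fh \<theta>)\<^sup>2 + var_proxy (real s) fh \<sigma> \<theta>)) + holder_norm s fh * ennreal ?c"
  \<comment> \<open>A finite norm is itself a Lipschitz constant; an infinite one makes the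
    right-hand side infinite.\<close>
  proof (cases "holder_norm s fh")
    case (real L)
    then have "?E \<le> ennreal (sqrt ((bias f0 fh \<theta>)\<^sup>2 + var_proxy (real s) fh \<sigma> \<theta>) + L * ?c)"
      by (intro core holder_norm_lipschitz) auto
    also have "\<dots> = ennreal (sqrt ((bias f0 fh \<theta>)\<^sup>2 + var_proxy (real s) fh \<sigma> \<theta>)) + ennreal L * ennreal ?c"
    proof -
      have "0 \<le> var_proxy (real s) fh \<sigma> \<theta>"
        unfolding var_proxy_eq_sum_squares by (auto intro: sum_nonneg)
      then show ?thesis
        using real(1) c by (simp only: ennreal_plus mult_nonneg_nonneg less_imp_le ennreal_mult real_sqrt_ge_zero add_nonneg_nonneg zero_le_power2)
    qed
    finally show ?thesis using real(2) by simp
  next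
    case top
    \<comment> \<open>In \<open>ennreal\<close> the product of \<open>top\<close> and 0 is 0, so
      positivity of the factor matters.\<close>
    have "ennreal ?c \<noteq> 0" using c by (simp only: ennreal_eq_0_iff not_le)
    then have "top * ennreal ?c = top" by (simp only: ennreal_top_mult if_False)
    then show ?thesis unfolding top by (simp only: add_top_right_ennreal top_greatest)
  qed
  moreover have "?E \<le> ennreal (\<bar>bias f0 fh \<theta>\<bar>
        + \<eta> * (real s powr (- (1 / 4)) + sqrt (2 / real CARD('d)) * exp ((\<sigma> / h)\<^sup>2 / 2))
        + sqrt (var_proxy \<alpha> f0 \<sigma> \<theta>))
      \<and> \<bar>bias f0 fh \<theta>\<bar>
        + \<eta> * (real s powr (- (1 / 4)) + sqrt (2 / real CARD('d)) * exp ((\<sigma> / h)\<^sup>2 / 2))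
        + sqrt (var_proxy \<alpha> f0 \<sigma> \<theta>)
      \<le> \<eta> * (1 + real s powr (- (1 / 4)) + sqrt (2 / real CARD('d)) * exp ((\<sigma> / h)\<^sup>2 / 2))
        + sqrt (var_proxy \<alpha> f0 \<sigma> \<theta>)"
    if \<alpha>: "0 < \<alpha>" "\<alpha> \<le> real s" and \<eta>: "0 < \<eta>" and diff: "times_differentiable s fh"
      and low: "\<forall>k. real k < \<alpha> \<longrightarrow>
               sup_norm (\<lambda>y. (deriv ^^ k) f0 y - (deriv ^^ k) fh y) \<le> ennreal (\<eta> / h ^ k)"
      and high: "\<forall>k. \<alpha> \<le> real k \<and> k \<le> s \<longrightarrow> sup_norm ((deriv ^^ k) fh) \<le> ennreal (\<eta> / h ^ k)"
      and le: "(\<sigma> / h)\<^sup>2 \<le> real s / (2 ^ 7 * exp 1)" for \<alpha> \<eta>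
  proof -
    have low': "\<bar>(deriv ^^ k) f0 y - (deriv ^^ k) fh y\<bar> \<le> \<eta> / h ^ k" if "real k < \<alpha>" for k y
      using low that \<eta> h abs_le_of_sup_norm[of "\<lambda>y. (deriv ^^ k) f0 y - (deriv ^^ k) fh y" "\<eta> / h ^ k" y] by auto
    have high': "\<bar>(deriv ^^ k) fh y\<bar> \<le> \<eta> / h ^ k" if "\<alpha> \<le> real k" "k \<le> s" for k y
      using high that \<eta> h abs_le_of_sup_norm[of "(deriv ^^ k) fh" "\<eta> / h ^ k" y] by auto
    \<comment> \<open>Mean value theorem: as \<open>\<alpha> \<le> s\<close>, the order
      \<open>k = s\<close> lies in the range where the derivatives of \<open>fh\<close> are bounded
      by \<open>\<eta> / h ^ k\<close>.\<close>
    have lip: "\<bar>(deriv ^^ (s - 1)) fh u - (deriv ^^ (s - 1)) fh v\<bar> \<le> \<eta> / h ^ s * \<bar>u - v\<bar>" for u v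
    proof -
      have "((deriv ^^ (s - 1)) fh has_real_derivative (deriv ^^ s) fh y) (at y)" for y
      proof -
        have "(deriv ^^ s) fh = deriv ((deriv ^^ (s - 1)) fh)"
          using s by (cases s) auto
        then show ?thesis
          using diff s by (simp add: times_differentiable_def DERIV_deriv_iff_real_differentiable)
      qed
      then have "norm ((deriv ^^ (s - 1)) fh u - (deriv ^^ (s - 1)) fh v) \<le> \<eta> / h ^ s * norm (u - v)"
        using high' \<alpha> by (intro field_differentiable_bound[OF convex_UNIV, where f' = "(deriv ^^ s) fh"]) auto
      then show ?thesis by simp
    qed
    have "?E \<le> ennreal (sqrt ((bias f0 fh \<theta>)\<^sup>2 + var_proxy (real s) fh \<sigma> \<theta>) + \<eta> / h ^ s * ?c)"
      using \<eta> h by (intro core lip) simp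
    also have "\<dots> \<le> ennreal (\<bar>bias f0 fh \<theta>\<bar>
        + \<eta> * (real s powr (- (1 / 4)) + sqrt (2 / real CARD('d)) * exp ((\<sigma> / h)\<^sup>2 / 2))
        + sqrt (var_proxy \<alpha> f0 \<sigma> \<theta>))"
    proof (rule ennreal_leI)
      have "0 \<le> var_proxy (real s) fh \<sigma> \<theta>"
        unfolding var_proxy_eq_sum_squares by (auto intro: sum_nonneg)
      then have "sqrt ((bias f0 fh \<theta>)\<^sup>2 + var_proxy (real s) fh \<sigma> \<theta>) \<le> \<bar>bias f0 fh \<theta>\<bar> + sqrt (var_proxy (real s) fh \<sigma> \<theta>)"
        using sqrt_add_le_add_sqrt[of "(bias f0 fh \<theta>)\<^sup>2" "var_proxy (real s) fh \<sigma> \<theta>"] by simp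
      moreover have "sqrt (var_proxy (real s) fh \<sigma> \<theta>) \<le>
          sqrt (var_proxy \<alpha> f0 \<sigma> \<theta>) + \<eta> * sqrt (2 / real CARD('d)) * exp ((\<sigma> / h)\<^sup>2 / 2)"
        by (rule sqrt_var_proxy_le[OF \<alpha> \<eta> h \<sigma> low' high'])
      moreover have "\<eta> / h ^ s * ?c \<le> \<eta> * real s powr (- (1 / 4))"
        using s \<sigma> h \<eta> le by (intro smooth_remainder_le) auto
      ultimately show "sqrt ((bias f0 fh \<theta>)\<^sup>2 + var_proxy (real s) fh \<sigma> \<theta>) + \<eta> / h ^ s * ?c \<le> \<bar>bias f0 fh \<theta>\<bar>
          + \<eta> * (real s powr (- (1 / 4)) + sqrt (2 / real CARD('d)) * exp ((\<sigma> / h)\<^sup>2 / 2))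
          + sqrt (var_proxy \<alpha> f0 \<sigma> \<theta>)"
        unfolding distrib_left mult.assoc by linarith
    qed
    \<comment> \<open>The order \<open>k = 0\<close> lies below \<open>\<alpha>\<close>, so
      \<open>f0\<close> and \<open>fh\<close> differ by at most \<open>\<eta>\<close> everywhere,
      and so does the bias from 0.\<close>
    finally show ?thesis
      using abs_bias_le[of f0 fh \<eta> \<theta>] low'[of 0] \<alpha> by (simp add: distrib_left)
  qed
  ultimately show ?thesis by blast
qed

end
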